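(* Let $-\frac12<s<0$. There is a constant $c>0$ (depending only on $s$) such that for every Schwartz solution $q$ of $$ i q_t+\tfrac{1}{\sqrt3}\,q_{xx}+2i\,\bar q\,\bar q_x=0 $$ the following hold. (i) The microlocal Sobolev norms of $q$ are almost conserved for all $k\ge1$ big enough depending on $\|q(0)\|_{H^s}$, in the sense that for such $k$ and all $t\in\mathbb R$, $$\|q(t)\|_{H^s_k}\le c\,\|q(0)\|_{H^s_k}.$$ (ii) For all $t\in\mathbb R$, $$\|q(t)\|_{H^s}\le c\,\bigl(1+\|q(0)\|_{H^s}\bigr)^{\frac{-s}{1+2s}}\|q(0)\|_{H^s}.$$
   Context: $q=q(t,x)$ is complex-valued on $\mathbb R\times\mathbb R$; a Schwartz solution is a solution $q\in C^\infty(\mathbb R,\mathcal S(\mathbb R))$. The microlocal Sobolev norms are $\|f\|_{H^s_k}=\bigl(\int_{\mathbb R}|\hat f(\xi)|^2(\xi^2+3k^2)^s\,d\xi\bigr)^{1/2}$ for $k>0$, and $\|f\|_{H^s}$ is the usual Sobolev norm, i.e. $\|f\|_{H^s}=\|f\|_{H^s_k}$ with $k=3^{-1/2}$. *)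

theory Defs
  imports "HOL-Analysis.Analysis"
begin

definition vderiv :: "(real \<Rightarrow> complex) \<Rightarrow> real \<Rightarrow> complex" where
  "vderiv f x = vector_derivative f (at x)"

definition schwartz :: "(real \<Rightarrow> complex) \<Rightarrow> bool" where
  "schwartz f \<longleftrightarrow>
     (\<forall>n x. (vderiv ^^ n) f differentiable (at x)) \<and>
     (\<forall>m n. bounded (range (\<lambda>x. x ^ m *\<^sub>R (vderiv ^^ n) f x)))"

text \<open>The seminorms generating the Frechet topology; meaningful on Schwartz functions only
  (otherwise the supremum may be that of an unbounded set).\<close>

definition schwartz_seminorm :: "nat \<Rightarrow> nat \<Rightarrow> (real \<Rightarrow> complex) \<Rightarrow> real" where
  "schwartz_seminorm m n f = (SUP x. \<bar>x\<bar> ^ m * norm ((vderiv ^^ n) f x))"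

text \<open>Differentiability of a curve in the Schwartz space: the difference quotients converge in
  every seminorm.\<close>

definition has_schwartz_derivative ::
    "(real \<Rightarrow> real \<Rightarrow> complex) \<Rightarrow> (real \<Rightarrow> complex) \<Rightarrow> real \<Rightarrow> bool" where
  "has_schwartz_derivative q g t \<longleftrightarrow>
     (\<forall>m n. ((\<lambda>h. schwartz_seminorm m n (\<lambda>x. (q (t + h) x - q t x) /\<^sub>R h - g x)) \<longlongrightarrow> 0) (at 0))"

text \<open>Membership in the space of smooth curves in the Schwartz space; \<open>D j\<close> is the \<open>j\<close>-th time
  derivative of \<open>q\<close>.\<close>

definition smooth_schwartz_curve :: "(real \<Rightarrow> real \<Rightarrow> complex) \<Rightarrow> bool" where
  "smooth_schwartz_curve q \<longleftrightarrow>
     (\<exists>D :: nat \<Rightarrow> real \<Rightarrow> real \<Rightarrow> complex.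
        D 0 = q \<and>
        (\<forall>j t. schwartz (D j t)) \<and>
        (\<forall>j t. has_schwartz_derivative (D j) (D (Suc j) t) t))"

definition schwartz_solution :: "(real \<Rightarrow> real \<Rightarrow> complex) \<Rightarrow> bool" where
  "schwartz_solution q \<longleftrightarrow>
     smooth_schwartz_curve q \<and>
     (\<forall>t x. \<i> * vderiv (\<lambda>\<tau>. q \<tau> x) t
            + of_real (1 / sqrt 3) * vderiv (vderiv (q t)) x
            + 2 * \<i> * cnj (q t x) * vderiv (\<lambda>y. cnj (q t y)) x = 0)"

text \<open>Unitary normalisation, frequency variable \<open>\<xi>\<close> dual to \<open>x\<close> via \<open>exp (- \<i> \<xi> x)\<close>.\<close>

definition fourier :: "(real \<Rightarrow> complex) \<Rightarrow> real \<Rightarrow> complex" where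
  "fourier f \<xi> = of_real (1 / sqrt (2 * pi)) * (LINT x|lborel. exp (- \<i> * of_real (\<xi> * x)) * f x)"

definition microlocal_norm :: "real \<Rightarrow> real \<Rightarrow> (real \<Rightarrow> complex) \<Rightarrow> real" where
  "microlocal_norm s k f =
     sqrt (LINT \<xi>|lborel. (norm (fourier f \<xi>))\<^sup>2 * (\<xi>\<^sup>2 + 3 * k\<^sup>2) powr s)"

definition sobolev_norm :: "real \<Rightarrow> (real \<Rightarrow> complex) \<Rightarrow> real" where
  "sobolev_norm s f = microlocal_norm s (1 / sqrt 3) f"

end

theory Submission imports Defs "HOL-Probability.Probability" begin

text \<open>The equation has a Lax pair whose spectral problem becomes, in suitable real coordinates
  \<open>\<phi>\<^sub>j\<close>, \<open>j \<in> \<int>/3\<close>, a cooperative linear system with parameter \<open>k > 0\<close>. Its solution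
  tending to \<open>(1, 1, 1)\<close> at \<open>- \<infinity>\<close> is positive and tends to \<open>A (1, 1, 1)\<close> at \<open>\<infinity>\<close>, and
  the zero curvature relation makes \<open>E k = ln A \<ge> 0\<close> independent of time.

  Let \<open>w\<close> be the discrete Fourier coefficient of \<open>ln \<phi>\<^sub>j\<close>. It solves
  \<open>w' = k \<beta> w - q + k n\<close> with \<open>\<bar>n\<bar> \<le> \<rho>\<close>, \<open>\<bar>w\<bar>\<^sup>2 \<le> \<rho>\<close> and \<open>k \<integral> \<rho> = E k\<close>. On the Fourier side
  this bounds \<open>q\<close> by \<open>E k\<close>, both in the norm with weight \<open>k / (\<xi>\<^sup>2 + 3 k\<^sup>2)\<close> and at low frequencies.
  Conversely \<open>E k = - 2 \<integral> Re (q cnj y)\<close>, where \<open>y\<close> is a bounded Lipschitz function of the logarithms;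
  estimating \<open>y\<close> by finite differences gives
  \<open>E k \<le> C k\<^sup>-\<^sup>1\<^sup>-\<^sup>2\<^sup>s \<integral> \<bar>fourier q \<xi>\<bar>\<^sup>2 (\<xi>\<^sup>2 + 3 k\<^sup>2)\<^sup>s\<close> without any smallness assumption.

  Part (i) follows by integrating the first lower bound against \<open>\<kappa>\<^sup>2\<^sup>s d\<kappa>\<close> over \<open>\<kappa> \<ge> k\<close>, where \<open>E \<kappa> \<le> 1\<close>.
  In part (ii) the frequencies above \<open>k\<close> are controlled by part (i) for \<open>k\<close> of order
  \<open>(1 + N)\<^sup>2\<^sup>/\<^sup>(\<^sup>1\<^sup>+\<^sup>2\<^sup>s\<^sup>)\<close>, and those below \<open>\<eta> \<le> k\<close> by the low frequency bound
  with parameter \<open>sqrt (\<eta> k)\<close>.\<close>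

section \<open>Continuous functions with quadratic decay\<close>

text \<open>The obstacle is the size of the data: an expansion in powers of \<open>q\<close> is of
  no use for large \<open>q\<close>. Positivity takes its place, since it makes the logarithms
  global, and the derivative of their mean is exactly \<open>k \<rho>\<close>. The price is that the
  error \<open>n\<close> in the equation for \<open>w\<close> is controlled only in L1. In the
  duality of H^s with H^-s behind the upper bound this is harmless because \<open>y\<close> has
  bounded range: where the L1 term dominates a difference of \<open>y\<close>, the square of that
  difference is at most a constant times the L1 term. The bound for \<open>y\<close> is therefore
  linear in \<open>E k\<close>, and half of \<open>E k\<close> can be absorbed. The differences are
  integrated over the step \<open>h\<close>, and the weight \<open>h powr (2 * s)\<close> that
  arises must be integrable at 0, which \<open>- 1 / 2 < s\<close> provides. The weight
  \<open>\<xi>^2 + 3 * k^2\<close> is comparable to the squared symbol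
  \<open>k \<beta> - i \<xi>\<close> of the equation for \<open>w\<close>. In part (i) the initial
  data are measured at a regularity below \<open>s\<close>; at \<open>s\<close> itself the integral
  over \<open>\<kappa>\<close> would lose a logarithm. In part (ii) the parameter
  \<open>sqrt (\<eta> k)\<close> balances the linear term of the low frequency bound, which favours
  small parameters, against the quadratic one, which favours large ones.\<close>

definition cdec :: "(real \<Rightarrow> 'a::euclidean_space) \<Rightarrow> bool" where
  "cdec f \<longleftrightarrow> continuous_on UNIV f \<and> (\<exists>C. \<forall>x. norm (f x) \<le> C / (1 + x\<^sup>2))"

lemma one_plus_sq_pos [simp]: "1 + (x::real)\<^sup>2 > 0" "1 + (x::real)\<^sup>2 \<noteq> 0" "1 + (x::real)\<^sup>2 \<ge> 0"
  by (auto simp: add_pos_nonneg add_nonneg_eq_0_iff)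

lemma cdec_cont: "cdec f \<Longrightarrow> continuous_on A f"
  unfolding cdec_def using continuous_on_subset by blast

lemma cdec_bound:
  assumes "cdec f" obtains C where "C > 0" "\<And>x. norm (f x) \<le> C / (1 + x\<^sup>2)"
proof -
  obtain C where C: "\<And>x. norm (f x) \<le> C / (1 + x\<^sup>2)" using assms unfolding cdec_def by blast
  have "norm (f x) \<le> (max C 1) / (1 + x\<^sup>2)" for x
    by (rule order_trans[OF C]) (simp add: divide_right_mono)
  then show ?thesis using that[of "max C 1"] by auto
qed

text \<open>Comparison with a known member is how the auxiliary functions of
  \<open>jost_structure\<close> enter the class: \<open>w\<close>, \<open>y\<close> and
  \<open>\<rho>\<close> are dominated by the Jost component \<open>c\<close>, and \<open>n\<close>
  by \<open>\<rho>\<close>.\<close>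

lemma cdecI:
  assumes "continuous_on UNIV f" "cdec g" "\<And>x. norm (f x) \<le> K * norm (g x)"
  shows "cdec f"
proof -
  obtain C where C: "C > 0" "\<And>x. norm (g x) \<le> C / (1 + x\<^sup>2)" using cdec_bound[OF assms(2)] by blast
  have "norm (f x) \<le> (\<bar>K\<bar> * C) / (1 + x\<^sup>2)" for x
  proof -
    have "norm (f x) \<le> \<bar>K\<bar> * norm (g x)"
      using assms(3)[of x] by (smt (verit) abs_ge_self mult_right_mono norm_ge_zero)
    also have "\<dots> \<le> \<bar>K\<bar> * (C / (1 + x\<^sup>2))" by (intro mult_left_mono C) auto
    finally show ?thesis by simp
  qed
  then show ?thesis using assms(1) unfolding cdec_def by blast
qed

lemma cdec_bounded:
  assumes "cdec f" obtains C where "C > 0" "\<And>x. norm (f x) \<le> C"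
proof -
  obtain C where C: "C > 0" "\<And>x. norm (f x) \<le> C / (1 + x\<^sup>2)" using cdec_bound[OF assms] by blast
  have "C / (1 + x\<^sup>2) \<le> C" for x using C(1) by (simp add: divide_le_eq mult_le_cancel_left1)
  then show ?thesis using that C by (meson order_trans)
qed

lemma cdec_add [intro]:
  assumes "cdec f" "cdec g" shows "cdec (\<lambda>x. f x + g x)"
proof -
  obtain C where C: "C > 0" "\<And>x. norm (f x) \<le> C / (1 + x\<^sup>2)" using cdec_bound[OF assms(1)] by blast
  obtain D where D: "D > 0" "\<And>x. norm (g x) \<le> D / (1 + x\<^sup>2)" using cdec_bound[OF assms(2)] by blast
  have "norm (f x + g x) \<le> (C + D) / (1 + x\<^sup>2)" for x
    using norm_triangle_mono[OF C(2) D(2), of x x] by (simp add: add_divide_distrib)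
  moreover have "continuous_on UNIV (\<lambda>x. f x + g x)"
    using assms by (intro continuous_intros cdec_cont)
  ultimately show ?thesis unfolding cdec_def by blast
qed

lemma cdec_uminus [intro]: "cdec f \<Longrightarrow> cdec (\<lambda>x. - f x)"
  by (rule cdecI[where g=f and K=1]) (auto intro: continuous_intros cdec_cont)

lemma cdec_diff [intro]: "cdec f \<Longrightarrow> cdec g \<Longrightarrow> cdec (\<lambda>x. f x - g x)"
  using cdec_add[of f "\<lambda>x. - g x"] cdec_uminus[of g] by simp

lemma cdec_mult_bounded:
  fixes f :: "real \<Rightarrow> 'a::{real_normed_algebra, euclidean_space}"
  assumes "cdec f" "continuous_on UNIV g" "\<And>x. norm (g x) \<le> K"
  shows "cdec (\<lambda>x. f x * g x)" "cdec (\<lambda>x. g x * f x)"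
proof -
  have 1: "norm (f x * g x) \<le> K * norm (f x)" for x
    by (rule order_trans[OF norm_mult_ineq], subst mult.commute) (simp add: assms mult_right_mono)
  have 2: "norm (g x * f x) \<le> K * norm (f x)" for x
    by (rule order_trans[OF norm_mult_ineq]) (simp add: assms mult_right_mono)
  show "cdec (\<lambda>x. f x * g x)"
    by (rule cdecI[OF _ assms(1) 1]) (intro continuous_intros cdec_cont assms)
  show "cdec (\<lambda>x. g x * f x)"
    by (rule cdecI[OF _ assms(1) 2]) (intro continuous_intros cdec_cont assms)
qed

lemma cdec_mult [intro]:
  fixes f :: "real \<Rightarrow> 'a::{real_normed_algebra, euclidean_space}"
  assumes "cdec f" "cdec g" shows "cdec (\<lambda>x. f x * g x)"
proof -
  obtain C where "C > 0" "\<And>x. norm (g x) \<le> C" using cdec_bounded[OF assms(2)] by blast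
  then show ?thesis using assms by (intro cdec_mult_bounded(1)) (auto intro: cdec_cont)
qed

lemma cdec_cmult [intro]:
  fixes f :: "real \<Rightarrow> 'a::{real_normed_algebra, euclidean_space}"
  assumes "cdec f" shows "cdec (\<lambda>x. c * f x)" "cdec (\<lambda>x. f x * c)"
  using cdec_mult_bounded[OF assms, of "\<lambda>_. c" "norm c"] by auto

lemma cdec_cnj [intro]: "cdec f \<Longrightarrow> cdec (\<lambda>x. cnj (f x))"
  by (rule cdecI[of _ f 1]) (auto intro!: continuous_intros intro: cdec_cont)

lemma cdec_Re [intro]: "cdec f \<Longrightarrow> cdec (\<lambda>x. Re (f x))"
  by (rule cdecI[of _ f 1]) (auto intro!: continuous_intros abs_Re_le_cmod intro: cdec_cont)

lemma cdec_of_real [intro]: "cdec f \<Longrightarrow> cdec (\<lambda>x. complex_of_real (f x))"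
  by (rule cdecI[of _ f 1]) (auto intro!: continuous_intros intro: cdec_cont)

lemma cdec_norm [intro]: "cdec f \<Longrightarrow> cdec (\<lambda>x. norm (f x))"
  by (rule cdecI[of _ f 1]) (auto intro!: continuous_intros intro: cdec_cont)

text \<open>Peetre's inequality for the quadratic weight. It makes \<open>cdec\<close> stable under
  translation, under \<open>duhamel\<close> and under \<open>tdiff\<close>.\<close>

lemma weight_shift: "1 + (x::real)\<^sup>2 \<le> 2 * (1 + y\<^sup>2) * (1 + (x - y)\<^sup>2)"
proof -
  have "x\<^sup>2 \<le> 2 * y\<^sup>2 + 2 * (x - y)\<^sup>2"
    using zero_le_power2[of "y - (x - y)"] by (simp add: power2_eq_square algebra_simps)
  moreover have "0 \<le> y\<^sup>2 * (x-y)\<^sup>2" by simp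
  moreover have "2 * (1 + y\<^sup>2) * (1 + (x - y)\<^sup>2) = 2 + 2 * y\<^sup>2 + 2 * (x-y)\<^sup>2 + 2 * (y\<^sup>2 * (x-y)\<^sup>2)"
    by (simp add: distrib_left distrib_right)
  ultimately show ?thesis by linarith
qed

lemma cdec_shift:
  assumes "cdec f" shows "cdec (\<lambda>x. f (x + h))"
proof -
  obtain C where C: "C > 0" "\<And>x. norm (f x) \<le> C / (1 + x\<^sup>2)" using cdec_bound[OF assms(1)] by blast
  have "norm (f (x + h)) \<le> (C * 2 * (1 + h\<^sup>2)) / (1 + x\<^sup>2)" for x
  proof -
    have "1 / (1 + (x+h)\<^sup>2) \<le> (2 * (1 + h\<^sup>2)) / (1 + x\<^sup>2)"
      using weight_shift[of x "x + h"] by (simp add: field_simps)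
    then have "C * (1 / (1 + (x+h)\<^sup>2)) \<le> C * ((2 * (1 + h\<^sup>2)) / (1 + x\<^sup>2))"
      using C(1) by (intro mult_left_mono) auto
    then show ?thesis using C(2)[of "x+h"] by (simp add: mult.assoc)
  qed
  moreover have "continuous_on UNIV (\<lambda>x. f (x + h))"
    using assms by (intro continuous_on_compose2[OF cdec_cont[of f UNIV]] continuous_intros) auto
  ultimately show ?thesis unfolding cdec_def by blast
qed

lemma integrable_inv_sq: "integrable lborel (\<lambda>x::real. C / (1 + x\<^sup>2))"
proof -
  have "integrable lborel (\<lambda>x::real. inverse (1 + x\<^sup>2))"
    using integrable_inverse_1_plus_square unfolding set_integrable_def by simp
  then have "integrable lborel (\<lambda>x::real. C * inverse (1 + x\<^sup>2))" by (rule integrable_mult_right)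
  then show ?thesis by (simp add: divide_inverse)
qed

lemma integral_inv_sq: "(LINT x|lborel. inverse (1 + x\<^sup>2)) = pi"
  using LBINT_inverse_1_plus_square unfolding interval_lebesgue_integral_def set_lebesgue_integral_def
  by simp

lemma cdec_measurable [measurable_dest]: "cdec f \<Longrightarrow> f \<in> borel_measurable borel"
  by (rule borel_measurable_continuous_onI) (rule cdec_cont)

lemma cdec_integrable:
  assumes "cdec f" shows "integrable lborel f"
proof -
  obtain C where C: "C > 0" "\<And>x. norm (f x) \<le> C / (1 + x\<^sup>2)" using cdec_bound[OF assms(1)] by blast
  show ?thesis
    by (rule Bochner_Integration.integrable_bound[OF integrable_inv_sq[of C]])
       (use assms C in \<open>auto intro!: AE_I2 simp: cdec_measurable\<close>)
qed

lemma tendsto_inv_sq: "((\<lambda>x::real. C / (1 + x\<^sup>2)) \<longlongrightarrow> 0) at_top" "((\<lambda>x::real. C / (1 + x\<^sup>2)) \<longlongrightarrow> 0) at_bot"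
proof -
  have "filterlim (\<lambda>x::real. 1 + x\<^sup>2) at_top F" if "filterlim (\<lambda>x::real. x\<^sup>2) at_top F" for F
    by (rule filterlim_tendsto_add_at_top[OF tendsto_const that])
  moreover have "filterlim (\<lambda>x::real. x\<^sup>2) at_top at_top" by (intro filterlim_pow_at_top filterlim_ident) simp
  moreover have "filterlim (\<lambda>x::real. x\<^sup>2) at_top at_bot"
    by (intro filterlim_pow_at_bot_even filterlim_ident) simp_all
  ultimately show "((\<lambda>x::real. C / (1 + x\<^sup>2)) \<longlongrightarrow> 0) at_top" "((\<lambda>x::real. C / (1 + x\<^sup>2)) \<longlongrightarrow> 0) at_bot"
    by (auto intro!: tendsto_divide_0[OF tendsto_const] filterlim_at_top_imp_at_infinity)
qed

lemma cdec_tendsto_0: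
  assumes "cdec f" shows "(f \<longlongrightarrow> 0) at_top" "(f \<longlongrightarrow> 0) at_bot"
proof -
  obtain C where C: "C > 0" "\<And>x. norm (f x) \<le> C / (1 + x\<^sup>2)" using cdec_bound[OF assms(1)] by blast
  show "(f \<longlongrightarrow> 0) at_top" by (rule Lim_null_comparison[OF _ tendsto_inv_sq(1)[of C]]) (simp add: C)
  show "(f \<longlongrightarrow> 0) at_bot" by (rule Lim_null_comparison[OF _ tendsto_inv_sq(2)[of C]]) (simp add: C)
qed

section \<open>Primitives that vanish at minus infinity\<close>

definition J :: "(real \<Rightarrow> 'a::euclidean_space) \<Rightarrow> real \<Rightarrow> 'a" where
  "J g x = (LINT y:{..x}|lborel. g y)"

text \<open>Integrability is asked only on half lines bounded above, because the integrand inside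
  \<open>duhamel\<close> carries a factor that grows exponentially to the right.\<close>

lemma J_deriv_gen:
  fixes g :: "real \<Rightarrow> 'a::euclidean_space"
  assumes g: "continuous_on UNIV g" and i: "\<And>x. set_integrable lborel {..x} g"
  shows "(J g has_vector_derivative g x) (at x)"
proof -
  let ?a = "x - 1" and ?b = "x + 1"
  have eq: "J g y = J g ?a + integral {?a..y} g" if "y \<in> {?a..?b}" for y
  proof -
    have "set_integrable lborel {?a..y} g" by (rule set_integrable_subset[OF i[of y]]) auto
    then have 1: "(LINT t:{?a..y}|lborel. g t) = integral {?a..y} g"
      by (rule set_borel_integral_eq_integral)
    have "J g y = (LINT t:{..?a} \<union> {?a<..y}|lborel. g t)"
      unfolding J_def using that by (intro arg_cong2[where f="\<lambda>A. set_lebesgue_integral lborel A"]) auto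
    also have "\<dots> = J g ?a + (LINT t:{?a<..y}|lborel. g t)"
      unfolding J_def using that
      by (intro set_integral_Un set_integrable_subset[OF i[of y]]) auto
    also have "(LINT t:{?a<..y}|lborel. g t) = (LINT t:{?a..y}|lborel. g t)"
      unfolding set_lebesgue_integral_def
      by (rule integral_cong_AE)
         (use AE_lborel_singleton[of ?a] borel_measurable_continuous_onI[OF g] in \<open>auto elim!: eventually_mono simp: indicator_def\<close>)
    finally show ?thesis using 1 by simp
  qed
  have "((\<lambda>y. J g ?a + integral {?a..y} g) has_vector_derivative g x) (at x within {?a..?b})"
    by (auto intro!: derivative_eq_intros integral_has_vector_derivative continuous_on_subset[OF g])
  then have "(J g has_vector_derivative g x) (at x within {?a..?b})"
    by (rule has_vector_derivative_transform_within[where d=1]) (auto simp: eq[symmetric])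
  moreover have "at x within {?a..?b} = at x" by (rule at_within_interior) auto
  ultimately show ?thesis by simp
qed

lemma cdec_set_integrable: "cdec g \<Longrightarrow> A \<in> sets borel \<Longrightarrow> set_integrable lborel A g"
  using cdec_integrable[of g] unfolding set_integrable_def
  by (intro integrable_mult_indicator) auto

lemma J_deriv: "cdec g \<Longrightarrow> (J g has_vector_derivative g x) (at x)"
  by (intro J_deriv_gen cdec_cont cdec_set_integrable) auto

lemma J_cont: "cdec g \<Longrightarrow> continuous_on UNIV (J g)"
  by (intro continuous_at_imp_continuous_on ballI has_vector_derivative_continuous) (rule J_deriv)

lemma J_at_top: assumes "cdec g" shows "(J g \<longlongrightarrow> (LINT x|lborel. g x)) at_top"
  unfolding J_def[abs_def] set_lebesgue_integral_def
proof (rule integral_dominated_convergence_at_top[where w="\<lambda>x. norm (g x)"])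
  show "g \<in> borel_measurable lborel" using cdec_measurable[OF assms] by simp
  show "AE x in lborel. ((\<lambda>xa. indicator {..xa} x *\<^sub>R g x) \<longlongrightarrow> g x) at_top"
  proof (rule AE_I2)
    fix x
    show "((\<lambda>xa. indicator {..xa} x *\<^sub>R g x) \<longlongrightarrow> g x) at_top"
      by (rule tendsto_eventually) (use eventually_ge_at_top[of x] in \<open>eventually_elim, simp\<close>)
  qed
  show "integrable lborel (\<lambda>x. norm (g x))" using assms by (intro integrable_norm cdec_integrable)
  show "(\<lambda>x. indicator {..t} x *\<^sub>R g x) \<in> borel_measurable lborel" for t
    using cdec_measurable[OF assms] by simp
  show "\<forall>\<^sub>F t in at_top. AE x in lborel. norm (indicator {..t} x *\<^sub>R g x) \<le> norm (g x)"
    by (simp add: indicator_def)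
qed

lemma J_norm_le: assumes "cdec g" shows "norm (J g x) \<le> J (\<lambda>y. norm (g y)) x"
proof -
  have "norm (J g x) \<le> (LINT y|lborel. norm (indicator {..x} y *\<^sub>R g y))"
    unfolding J_def set_lebesgue_integral_def by (rule integral_norm_bound)
  then show ?thesis unfolding J_def set_lebesgue_integral_def by simp
qed

lemma J_le_integral:
  fixes g :: "real \<Rightarrow> real"
  assumes "cdec g" "\<And>x. g x \<ge> 0" shows "J g x \<le> (LINT x|lborel. g x)" "J g x \<ge> 0"
proof -
  have "integrable lborel (\<lambda>y. indicator {..x} y *\<^sub>R g y)"
    using cdec_set_integrable[OF assms(1), of "{..x}"] unfolding set_integrable_def by simp
  then show "J g x \<le> (LINT x|lborel. g x)"
    unfolding J_def set_lebesgue_integral_def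
    by (rule integral_mono) (use assms in \<open>simp_all add: cdec_integrable indicator_def\<close>)
  show "J g x \<ge> 0"
    unfolding J_def set_lebesgue_integral_def
    by (rule Bochner_Integration.integral_nonneg) (simp add: assms)
qed

lemma J_mono_fun:
  fixes g :: "real \<Rightarrow> real"
  assumes "cdec f" "cdec g" "\<And>x. f x \<le> g x" shows "J f x \<le> J g x"
  unfolding J_def
  by (rule set_integral_mono) (use assms in \<open>auto intro: cdec_set_integrable\<close>)

lemma J_at_bot: assumes "cdec g" shows "(J g \<longlongrightarrow> 0) at_bot"
proof -
  have "((\<lambda>t. LINT x|lborel. indicator {..-t} x *\<^sub>R g x) \<longlongrightarrow> (LINT x|(lborel::real measure). 0 *\<^sub>R g x)) at_top"
  proof (rule integral_dominated_convergence_at_top[where w="\<lambda>x. norm (g x)"])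
    show "AE x in lborel. ((\<lambda>xa. indicator {..-xa} x *\<^sub>R g x) \<longlongrightarrow> 0 *\<^sub>R g x) at_top"
    proof (rule AE_I2)
      fix x :: real
      show "((\<lambda>xa. indicator {..-xa} x *\<^sub>R g x) \<longlongrightarrow> 0 *\<^sub>R g x) at_top"
        by (rule tendsto_eventually) (use eventually_gt_at_top[of "-x"] in \<open>eventually_elim, simp\<close>)
    qed
  qed (use assms cdec_measurable in \<open>auto simp: indicator_def intro!: cdec_integrable always_eventually\<close>)
  then have "((\<lambda>t. J g (- t)) \<longlongrightarrow> 0) at_top" unfolding J_def[abs_def] set_lebesgue_integral_def by simp
  then show ?thesis by (simp add: filterlim_at_bot_mirror)
qed

lemma deriv_zero_const:
  fixes F :: "real \<Rightarrow> 'a::real_normed_vector"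
  assumes "\<And>x. (F has_vector_derivative 0) (at x)" shows "F x = F y"
proof -
  obtain c where "\<And>x. x \<in> UNIV \<Longrightarrow> F x = c"
    using has_vector_derivative_zero_constant[of UNIV F] assms by auto
  then show ?thesis by simp
qed

text \<open>The fundamental theorem of calculus based at minus infinity. The second part turns a
  differential identity into the value of an integral over the whole line; both formulas for
  \<open>ln A\<close> in \<open>jost_structure\<close> arise in this way.\<close>

lemma J_unique:
  assumes "\<And>x. (F has_vector_derivative g x) (at x)" "cdec g" "(F \<longlongrightarrow> l) at_bot"
  shows "F x = l + J g x" "(F \<longlongrightarrow> l + (LINT x|lborel. g x)) at_top"
proof -
  have "((\<lambda>x. F x - J g x) has_vector_derivative 0) (at x)" for x
    using has_vector_derivative_diff[OF assms(1)[of x] J_deriv[OF assms(2), of x]] by simp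
  then have c: "F x - J g x = F y - J g y" for x y by (rule deriv_zero_const)
  have "((\<lambda>y. F y - J g y) \<longlongrightarrow> l - 0) at_bot" by (intro tendsto_diff assms J_at_bot)
  moreover have "((\<lambda>y. F y - J g y) \<longlongrightarrow> F 0 - J g 0) at_bot"
    by (intro tendsto_eventually always_eventually allI c)
  ultimately have "F 0 - J g 0 = l" using tendsto_unique[OF trivial_limit_at_bot_linorder] by (metis diff_zero)
  then have F: "F x = l + J g x" for x using c[of x 0] by (simp add: algebra_simps)
  show "F x = l + J g x" by (rule F)
  have "((\<lambda>x. l + J g x) \<longlongrightarrow> l + (LINT x|lborel. g x)) at_top"
    by (intro tendsto_intros J_at_top assms)
  moreover have "(\<lambda>x. l + J g x) = F" using F by (intro ext) simp
  ultimately show "(F \<longlongrightarrow> l + (LINT x|lborel. g x)) at_top" by simp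
qed

section \<open>Plancherel's theorem\<close>

lemma norm_exp_ii [simp]: "norm (exp (- \<i> * complex_of_real r)) = 1" "norm (exp (\<i> * complex_of_real r)) = 1"
  by (simp_all add: norm_exp_eq_Re)

text \<open>In the applications \<open>h\<close> is a unimodular exponential, so integrability of
  \<open>a\<close> and \<open>b\<close> separately gives integrability on the product.\<close>

lemma Fubini_bounded_kernel:
  fixes a b :: "real \<Rightarrow> complex" and h :: "real \<Rightarrow> real \<Rightarrow> complex"
  assumes a: "integrable lborel a" and b: "integrable lborel b"
    and h: "case_prod h \<in> borel_measurable (borel \<Otimes>\<^sub>M borel)" "\<And>x y. norm (h x y) \<le> 1"
  shows "(LINT x|lborel. a x * (LINT y|lborel. b y * h x y)) = (LINT y|lborel. b y * (LINT x|lborel. a x * h x y))"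
proof -
  have [measurable]: "a \<in> borel_measurable borel" "b \<in> borel_measurable borel"
    using a b borel_measurable_integrable by force+
  note h(1)[measurable]
  have 1: "integrable (lborel \<Otimes>\<^sub>M lborel) (case_prod (\<lambda>x y. a x * b y * h x y))"
  proof (rule lborel_pair.Fubini_integrable)
    have "integrable lborel (\<lambda>y. b y * h x y)" for x
      by (rule Bochner_Integration.integrable_bound[OF b])
         (auto intro!: AE_I2 simp: norm_mult mult_left_le h(2))
    then have ib: "integrable lborel (\<lambda>y. a x * b y * h x y)" for x
      using integrable_mult_right[of "a x"] by (simp add: mult.assoc)
    then show "AE x in lborel. integrable lborel (\<lambda>y. case (x, y) of (x, y) \<Rightarrow> a x * b y * h x y)" by simp
    have "norm (LINT y|lborel. norm (a x * b y * h x y)) \<le> norm (a x) * (LINT y|lborel. norm (b y))" for x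
    proof -
      have "(LINT y|lborel. norm (a x * b y * h x y)) \<le> (LINT y|lborel. norm (a x) * norm (b y))"
        using integrable_norm[OF ib[of x]] b
        by (intro integral_mono) (auto simp: norm_mult h(2) intro!: mult_left_le)
      moreover have "(LINT y|lborel. norm (a x * b y * h x y)) \<ge> 0" by simp
      ultimately show ?thesis by simp
    qed
    then show "integrable lborel (\<lambda>x. LINT y|lborel. norm (case (x, y) of (x, y) \<Rightarrow> a x * b y * h x y))"
      by (intro Bochner_Integration.integrable_bound[OF integrable_mult_left[OF integrable_norm[OF a], of "LINT y|lborel. norm (b y)"]])
         (auto intro!: AE_I2)
  qed measurable
  have "(LINT x|lborel. a x * (LINT y|lborel. b y * h x y)) = (LINT x|lborel. LINT y|lborel. a x * b y * h x y)"
    by (simp add: mult.assoc)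
  also have "\<dots> = (LINT y|lborel. LINT x|lborel. a x * b y * h x y)"
    using lborel_pair.Fubini_integral[OF 1] by simp
  also have "\<dots> = (LINT y|lborel. b y * (LINT x|lborel. a x * h x y))"
  proof (rule Bochner_Integration.integral_cong[OF refl])
    fix y
    have "(LINT x|lborel. a x * b y * h x y) = (LINT x|lborel. b y * (a x * h x y))"
      by (rule Bochner_Integration.integral_cong) (simp_all add: mult_ac)
    then show "(LINT x|lborel. a x * b y * h x y) = b y * (LINT x|lborel. a x * h x y)" by simp
  qed
  finally show ?thesis .
qed

lemma cnj_measurable [measurable]: "cnj \<in> borel_measurable borel"
  by (rule borel_measurable_continuous_onI) (intro continuous_intros)

lemma fourier_le:
  assumes "integrable lborel f"
  shows "norm (fourier f \<xi>) \<le> (LINT x|lborel. norm (f x)) / sqrt (2 * pi)"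
proof -
  have "norm (LINT x|lborel. exp (- \<i> * of_real (\<xi> * x)) * f x) \<le> (LINT x|lborel. norm (exp (- \<i> * of_real (\<xi> * x)) * f x))"
    by (rule integral_norm_bound)
  then have "norm (LINT x|lborel. exp (- \<i> * of_real (\<xi> * x)) * f x) \<le> (LINT x|lborel. norm (f x))"
    by (simp only: norm_mult norm_exp_ii mult_1_left)
  then show ?thesis unfolding fourier_def by (simp add: norm_mult norm_divide divide_right_mono)
qed

lemma fourier_measurable:
  assumes "integrable lborel f" shows "fourier f \<in> borel_measurable borel"
proof -
  have [measurable]: "f \<in> borel_measurable borel" using assms borel_measurable_integrable by force
  show ?thesis unfolding fourier_def[abs_def] by measurable
qed

text \<open>Read off from the characteristic function of the standard normal distribution.
  Plancherel's theorem is built on this one explicit transform.\<close>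

lemma gauss_char:
  "(LINT z|lborel. of_real (std_normal_density z) * exp (\<i> * of_real (t * z))) = of_real (exp (- t\<^sup>2 / 2))"
proof -
  have "char std_normal_distribution t = of_real (exp (- t\<^sup>2 / 2))"
    by (simp add: char_std_normal_distribution)
  moreover have "char std_normal_distribution t = (LINT z|lborel. std_normal_density z *\<^sub>R exp (\<i> * of_real (t * z)))"
    unfolding char_def by (subst integral_density) (auto simp: normal_density_nonneg)
  ultimately show ?thesis by (simp add: scaleR_conv_of_real)
qed

lemma gauss_transform:
  assumes "e > 0"
  shows "(LINT \<xi>|lborel. of_real (exp (- (e * \<xi>)\<^sup>2 / 2)) * exp (\<i> * of_real (\<xi> * u))) = of_real (2 * pi / e * std_normal_density (u / e))"
proof -
  have "(LINT \<xi>|lborel. of_real (exp (- (e * \<xi>)\<^sup>2 / 2)) * exp (\<i> * of_real (\<xi> * u)))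
     = (1/e) *\<^sub>R (LINT z|lborel. of_real (exp (- z\<^sup>2 / 2)) * exp (\<i> * of_real ((u / e) * z)))"
    using assms by (subst lborel_integral_real_affine[where c="1/e" and t=0]) (auto simp: mult_ac)
  also have "(LINT z|lborel. of_real (exp (- z\<^sup>2 / 2)) * exp (\<i> * of_real ((u / e) * z)))
     = (LINT z|lborel. of_real (sqrt (2 * pi)) * (of_real (std_normal_density z) * exp (\<i> * of_real ((u / e) * z))))"
    by (intro Bochner_Integration.integral_cong) (auto simp: std_normal_density_def)
  also have "\<dots> = of_real (sqrt (2 * pi) * exp (- (u/e)\<^sup>2 / 2))"
    by (subst integral_mult_right_zero, subst gauss_char) simp
  also have "(1/e) *\<^sub>R complex_of_real (sqrt (2 * pi) * exp (- (u/e)\<^sup>2 / 2)) = of_real (2 * pi / e * std_normal_density (u / e))"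
  proof -
    have "(1/e) * (S * E) = (S * S) / e * (1 / S * E)" if "S > 0" for S E
      using that by simp
    from this[of "sqrt (2 * pi)"] have "(1/e) * (sqrt (2 * pi) * exp (- (u/e)\<^sup>2 / 2)) = 2 * pi / e * std_normal_density (u / e)"
      unfolding std_normal_density_def by simp
    then show ?thesis unfolding scaleR_conv_of_real of_real_mult[symmetric] by (rule arg_cong)
  qed
  finally show ?thesis .
qed

lemma gauss_integrable: "e > 0 \<Longrightarrow> integrable lborel (\<lambda>\<xi>. complex_of_real (exp (- (e * \<xi>)\<^sup>2 / 2)))"
proof -
  assume e: "e > 0"
  have "integrable lborel std_normal_density" by simp
  then have "integrable lborel (\<lambda>\<xi>. sqrt (2 * pi) * std_normal_density (0 + e * \<xi>))"
    using e by (intro integrable_mult_right) (subst lborel_integrable_real_affine_iff, auto)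
  then have "integrable lborel (\<lambda>\<xi>. exp (- (e * \<xi>)\<^sup>2 / 2))" by (simp add: std_normal_density_def)
  then show ?thesis by (simp add: complex_of_real_integrable_eq)
qed

text \<open>The damping is there because \<open>fourier f\<close> need not be integrable. By Fubini
  it becomes a convolution of \<open>f\<close> with a normal density of width \<open>e\<close>,
  written as an average over \<open>z\<close>.\<close>

lemma gauss_inversion:
  assumes "integrable lborel f" "e > 0"
  shows "of_real (1 / sqrt (2 * pi)) * (LINT \<xi>|lborel. of_real (exp (- (e * \<xi>)\<^sup>2 / 2)) * fourier f \<xi> * exp (\<i> * of_real (\<xi> * y)))
    = (LINT z|lborel. of_real (std_normal_density z) * f (y - e * z))"
proof -
  let ?g = "\<lambda>\<xi>. complex_of_real (exp (- (e * \<xi>)\<^sup>2 / 2))"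
  have [measurable]: "f \<in> borel_measurable borel" using assms borel_measurable_integrable by force
  have "(LINT \<xi>|lborel. ?g \<xi> * fourier f \<xi> * exp (\<i> * of_real (\<xi> * y)))
    = of_real (1 / sqrt (2 * pi)) * (LINT \<xi>|lborel. ?g \<xi> * (LINT x|lborel. f x * exp (\<i> * of_real (\<xi> * (y - x)))))"
  proof -
    have K: "(LINT x|lborel. f x * exp (\<i> * of_real (\<xi> * (y - x))))
      = exp (\<i> * of_real (\<xi> * y)) * (LINT x|lborel. exp (- \<i> * of_real (\<xi> * x)) * f x)" for \<xi>
    proof -
      have "exp (\<i> * of_real (\<xi> * (y - x))) = exp (\<i> * of_real (\<xi> * y)) * exp (- \<i> * of_real (\<xi> * x))" for x
        unfolding exp_add[symmetric] by (simp add: algebra_simps)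
      then show ?thesis unfolding integral_mult_right_zero[symmetric]
        by (intro Bochner_Integration.integral_cong refl) (simp only: mult_ac)
    qed
    have "(LINT \<xi>|lborel. ?g \<xi> * fourier f \<xi> * exp (\<i> * of_real (\<xi> * y)))
      = (LINT \<xi>|lborel. of_real (1 / sqrt (2 * pi)) * (?g \<xi> * (LINT x|lborel. f x * exp (\<i> * of_real (\<xi> * (y - x))))))"
      by (intro Bochner_Integration.integral_cong refl, subst K) (simp only: fourier_def mult_ac)
    then show ?thesis by (simp only: integral_mult_right_zero)
  qed
  also have "(LINT \<xi>|lborel. ?g \<xi> * (LINT x|lborel. f x * exp (\<i> * of_real (\<xi> * (y - x)))))
     = (LINT x|lborel. f x * (LINT \<xi>|lborel. ?g \<xi> * exp (\<i> * of_real (\<xi> * (y - x)))))"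
    by (rule Fubini_bounded_kernel[OF gauss_integrable[OF assms(2)] assms(1)]) (simp_all add: norm_exp_ii)
  also have "\<dots> = (LINT x|lborel. f x * of_real (2 * pi / e * std_normal_density ((y - x) / e)))"
    by (simp only: gauss_transform[OF assms(2)])
  also have "\<dots> = of_real (2 * pi) * (LINT z|lborel. of_real (std_normal_density z) * f (y - e * z))"
  proof -
    have "f (y - e * z) * (complex_of_real (2 * pi / e) * complex_of_real (std_normal_density z)) =
       complex_of_real (2 * pi / e) * (complex_of_real (std_normal_density z) * f (y - e * z))" for z by simp
    then show ?thesis
      using assms(2) by (subst lborel_integral_real_affine[where c="-e" and t=y])
        (auto simp: scaleR_conv_of_real mult.left_commute mult.commute[of "f _"] mult.assoc)
  qed
  finally have "(LINT \<xi>|lborel. ?g \<xi> * fourier f \<xi> * exp (\<i> * of_real (\<xi> * y)))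
    = of_real (1 / sqrt (2 * pi)) * (of_real (2 * pi) * (LINT z|lborel. of_real (std_normal_density z) * f (y - e * z)))" .
  moreover have "complex_of_real (1 / sqrt (2 * pi)) * (of_real (1 / sqrt (2 * pi)) * (of_real (2 * pi) * X)) = X" for X
    unfolding mult.assoc[symmetric] of_real_mult[symmetric] by simp
  ultimately show ?thesis by simp
qed

lemma parseval_regularised:
  assumes f: "cdec f" and g: "cdec g" and e: "e > 0"
  shows "(LINT \<xi>|lborel. of_real (exp (- (e * \<xi>)\<^sup>2 / 2)) * fourier f \<xi> * cnj (fourier g \<xi>))
    = (LINT y|lborel. cnj (g y) * (LINT z|lborel. of_real (std_normal_density z) * f (y - e * z)))"
proof -
  let ?g = "\<lambda>\<xi>. complex_of_real (exp (- (e * \<xi>)\<^sup>2 / 2))" and ?c = "complex_of_real (1 / sqrt (2 * pi))"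
  have if': "integrable lborel f" and ig: "integrable lborel (\<lambda>y. cnj (g y))"
    using f g by (auto intro: cdec_integrable)
  note fourier_measurable[OF if', measurable]
  have cn: "cnj (fourier g \<xi>) = ?c * (LINT y|lborel. cnj (g y) * exp (\<i> * of_real (\<xi> * y)))" for \<xi>
  proof -
    have "cnj (LINT x|lborel. exp (- \<i> * of_real (\<xi> * x)) * g x) = (LINT x|lborel. cnj (exp (- \<i> * of_real (\<xi> * x)) * g x))"
      by (rule Bochner_Integration.integral_cnj[symmetric])
    also have "\<dots> = (LINT y|lborel. cnj (g y) * exp (\<i> * of_real (\<xi> * y)))"
      by (intro Bochner_Integration.integral_cong refl) (simp add: exp_cnj)
    finally show ?thesis unfolding fourier_def complex_cnj_mult complex_cnj_complex_of_real by simp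
  qed
  have b: "exp (- (e * \<xi>)\<^sup>2 / 2) * norm (fourier f \<xi>) \<le> exp (- (e * \<xi>)\<^sup>2 / 2) * ((LINT x|lborel. norm (f x)) / sqrt (2 * pi))" for \<xi>
    by (intro mult_left_mono fourier_le if') simp
  have int: "integrable lborel (\<lambda>\<xi>. ?g \<xi> * fourier f \<xi>)"
    by (rule Bochner_Integration.integrable_bound[OF integrable_mult_left[OF gauss_integrable[OF e], of "of_real ((LINT x|lborel. norm (f x)) / sqrt (2 * pi))"]])
       (use b in \<open>auto intro!: AE_I2 simp: norm_mult norm_divide\<close>)
  have "(LINT \<xi>|lborel. ?g \<xi> * fourier f \<xi> * cnj (fourier g \<xi>))
    = (LINT \<xi>|lborel. ?c * (?g \<xi> * fourier f \<xi> * (LINT y|lborel. cnj (g y) * exp (\<i> * of_real (\<xi> * y)))))"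
    by (intro Bochner_Integration.integral_cong refl) (simp only: cn mult_ac)
  also have "\<dots> = ?c * (LINT y|lborel. cnj (g y) * (LINT \<xi>|lborel. ?g \<xi> * fourier f \<xi> * exp (\<i> * of_real (\<xi> * y))))"
    unfolding integral_mult_right_zero
    by (subst Fubini_bounded_kernel[OF int ig]) (simp_all add: norm_exp_ii)
  also have "\<dots> = (LINT y|lborel. cnj (g y) * (?c * (LINT \<xi>|lborel. ?g \<xi> * fourier f \<xi> * exp (\<i> * of_real (\<xi> * y)))))"
    by (subst integral_mult_right_zero[symmetric]) (intro Bochner_Integration.integral_cong refl, simp only: mult_ac)
  also have "\<dots> = (LINT y|lborel. cnj (g y) * (LINT z|lborel. of_real (std_normal_density z) * f (y - e * z)))"
    by (simp only: gauss_inversion[OF if' e])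
  finally show ?thesis .
qed

lemma gauss_average:
  assumes f: "cdec f" and B: "\<And>x. norm (f x) \<le> B"
  shows "integrable lborel (\<lambda>z. complex_of_real (std_normal_density z) * f (y - e * z))"
    "norm (LINT z|lborel. complex_of_real (std_normal_density z) * f (y - e * z)) \<le> B"
proof -
  have [measurable]: "f \<in> borel_measurable borel" using f by (rule cdec_measurable)
  have ib: "integrable lborel (\<lambda>z. std_normal_density z * B)" by simp
  show i: "integrable lborel (\<lambda>z. complex_of_real (std_normal_density z) * f (y - e * z))"
    by (rule Bochner_Integration.integrable_bound[OF ib])
       (auto intro!: AE_I2 mult_left_mono order_trans[OF B] simp: norm_mult normal_density_nonneg abs_mult)
  have "norm (LINT z|lborel. complex_of_real (std_normal_density z) * f (y - e * z)) \<le>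
    (LINT z|lborel. std_normal_density z * B)"
    by (rule Bochner_Integration.integral_norm_bound_integral[OF i ib])
       (auto intro!: mult_left_mono B simp: norm_mult normal_density_nonneg)
  also have "\<dots> = B" by simp
  finally show "norm (LINT z|lborel. complex_of_real (std_normal_density z) * f (y - e * z)) \<le> B" .
qed

lemma gauss_average_tendsto:
  assumes f: "cdec f"
  shows "(\<lambda>k. LINT z|lborel. complex_of_real (std_normal_density z) * f (y - inverse (Suc k) * z)) \<longlonglongrightarrow> f y"
proof -
  have [measurable]: "f \<in> borel_measurable borel" using f by (rule cdec_measurable)
  obtain B where B: "B > 0" "\<And>x. norm (f x) \<le> B" using cdec_bounded[OF f] by blast
  have lim: "(\<lambda>k. f (y - inverse (Suc k) * z)) \<longlonglongrightarrow> f (y - 0 * z)" for z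
    by (intro isCont_tendsto_compose[of _ f] tendsto_intros LIMSEQ_inverse_real_of_nat)
       (use cdec_cont[OF f, of UNIV] in \<open>simp add: continuous_on_eq_continuous_at\<close>)
  have "(\<lambda>k. LINT z|lborel. complex_of_real (std_normal_density z) * f (y - inverse (Suc k) * z))
    \<longlonglongrightarrow> (LINT z|lborel. complex_of_real (std_normal_density z) * f (y - 0 * z))"
    by (rule integral_dominated_convergence[where w="\<lambda>z. std_normal_density z * B"])
       (auto intro!: AE_I2 tendsto_mult lim[simplified] mult_left_mono B simp: norm_mult normal_density_nonneg)
  moreover have "(LINT z|lborel. complex_of_real (std_normal_density z) * f (y - 0 * z)) = f y"
    using gauss_char[of 0] by simp
  ultimately show ?thesis by simp
qed

lemma parseval_rhs_bound:
  assumes f: "cdec f" and g: "cdec g" and B: "\<And>x. norm (f x) \<le> B"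
  shows "norm (LINT y|lborel. cnj (g y) * (LINT z|lborel. of_real (std_normal_density z) * f (y - e * z)))
    \<le> B * (LINT y|lborel. norm (g y))"
proof -
  have [measurable]: "f \<in> borel_measurable borel" "g \<in> borel_measurable borel" using f g by (auto intro: cdec_measurable)
  have Bp: "B \<ge> 0" using B[of 0] norm_ge_zero order_trans by blast
  have ib: "integrable lborel (\<lambda>y. B * norm (g y))" using g by (auto intro: cdec_integrable)
  have le: "norm (cnj (g y) * (LINT z|lborel. of_real (std_normal_density z) * f (y - e * z))) \<le> B * norm (g y)" for y
    unfolding norm_mult complex_mod_cnj mult.commute[of "norm (g y)"]
    by (intro mult_right_mono gauss_average(2)[OF f B]) simp
  have i: "integrable lborel (\<lambda>y. cnj (g y) * (LINT z|lborel. of_real (std_normal_density z) * f (y - e * z)))"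
    by (rule Bochner_Integration.integrable_bound[OF ib])
       (use le Bp in \<open>auto intro!: AE_I2\<close>)
  show ?thesis
    using Bochner_Integration.integral_norm_bound_integral[OF i ib le] by simp
qed

text \<open>The damped Parseval identity with \<open>g = f\<close> has a right side bounded by the
  supremum of \<open>f\<close> times its L1 norm, uniformly in the damping, and Fatou's lemma
  removes the damping. This has to precede \<open>parseval\<close>, whose dominated convergence
  argument uses it as the majorant.\<close>

lemma fourier_L2:
  assumes f: "cdec f" shows "integrable lborel (\<lambda>\<xi>. (norm (fourier f \<xi>))\<^sup>2)"
proof -
  obtain B where B: "B > 0" "\<And>x. norm (f x) \<le> B" using cdec_bounded[OF f] by blast
  let ?M = "B * (LINT y|lborel. norm (f y))"
  let ?g = "\<lambda>k \<xi>. exp (- (inverse (Suc k) * \<xi>)\<^sup>2 / 2) * (norm (fourier f \<xi>))\<^sup>2"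
  note fourier_measurable[OF cdec_integrable[OF f], measurable]
  have int: "integrable lborel (?g k)" for k
  proof -
    have "integrable lborel (\<lambda>\<xi>. complex_of_real (exp (- (inverse (Suc k) * \<xi>)\<^sup>2 / 2)) * of_real (((LINT x|lborel. norm (f x)) / sqrt (2 * pi))\<^sup>2))"
      by (rule integrable_mult_left[OF gauss_integrable]) simp
    then show ?thesis
      by (rule Bochner_Integration.integrable_bound)
         (auto intro!: AE_I2 mult_left_mono power_mono fourier_le cdec_integrable f simp: norm_mult norm_power norm_divide abs_mult)
  qed
  have le: "(LINT \<xi>|lborel. ?g k \<xi>) \<le> ?M" for k
  proof -
    have "of_real (LINT \<xi>|lborel. ?g k \<xi>) = (LINT \<xi>|lborel. complex_of_real (?g k \<xi>))"
      by (rule integral_complex_of_real[symmetric])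
    also have "\<dots> = (LINT \<xi>|lborel. of_real (exp (- (inverse (Suc k) * \<xi>)\<^sup>2 / 2)) * fourier f \<xi> * cnj (fourier f \<xi>))"
      by (intro Bochner_Integration.integral_cong refl) (simp only: of_real_mult complex_norm_square mult.assoc)
    also have "\<dots> = (LINT y|lborel. cnj (f y) * (LINT z|lborel. of_real (std_normal_density z) * f (y - inverse (Suc k) * z)))"
      by (rule parseval_regularised[OF f f]) simp
    finally have "norm (of_real (LINT \<xi>|lborel. ?g k \<xi>) :: complex) \<le> ?M"
      using parseval_rhs_bound[OF f f B(2)] by simp
    then show ?thesis by simp
  qed
  have "(\<integral>\<^sup>+\<xi>. ennreal ((norm (fourier f \<xi>))\<^sup>2) \<partial>lborel) = (\<integral>\<^sup>+\<xi>. liminf (\<lambda>k. ennreal (?g k \<xi>)) \<partial>lborel)"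
  proof (intro nn_integral_cong)
    fix \<xi> :: real
    have "(\<lambda>k. ?g k \<xi>) \<longlonglongrightarrow> exp (- (0 * \<xi>)\<^sup>2 / 2) * (norm (fourier f \<xi>))\<^sup>2"
      by (intro tendsto_intros LIMSEQ_inverse_real_of_nat) auto
    then have "(\<lambda>k. ennreal (?g k \<xi>)) \<longlonglongrightarrow> ennreal ((norm (fourier f \<xi>))\<^sup>2)"
      by (intro tendsto_ennrealI) simp
    then show "ennreal ((norm (fourier f \<xi>))\<^sup>2) = liminf (\<lambda>k. ennreal (?g k \<xi>))"
      by (intro lim_imp_Liminf[symmetric]) auto
  qed
  also have "\<dots> \<le> liminf (\<lambda>k. \<integral>\<^sup>+\<xi>. ennreal (?g k \<xi>) \<partial>lborel)"
    by (rule nn_integral_liminf) measurable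
  also have "\<dots> \<le> ennreal ?M"
  proof (rule Liminf_le)
    show "\<forall>\<^sub>F k in sequentially. (\<integral>\<^sup>+\<xi>. ennreal (?g k \<xi>) \<partial>lborel) \<le> ennreal ?M"
      using le by (intro always_eventually allI, subst nn_integral_eq_integral[OF int]) (auto intro!: ennreal_leI)
  qed simp
  finally have "(\<integral>\<^sup>+\<xi>. ennreal ((norm (fourier f \<xi>))\<^sup>2) \<partial>lborel) < \<infinity>"
    by (rule le_less_trans) simp
  then show ?thesis by (intro integrableI_nonneg) auto
qed

theorem parseval:
  assumes f: "cdec f" and g: "cdec g"
  shows "(LINT \<xi>|lborel. fourier f \<xi> * cnj (fourier g \<xi>)) = (LINT x|lborel. f x * cnj (g x))"
proof -
  obtain B where B: "B > 0" "\<And>x. norm (f x) \<le> B" using cdec_bounded[OF f] by blast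
  have [measurable]: "f \<in> borel_measurable borel" "g \<in> borel_measurable borel" using f g by (auto intro: cdec_measurable)
  note fourier_measurable[OF cdec_integrable[OF f], measurable] fourier_measurable[OF cdec_integrable[OF g], measurable]
  let ?l = "\<lambda>k. LINT \<xi>|lborel. of_real (exp (- (inverse (Suc k) * \<xi>)\<^sup>2 / 2)) * fourier f \<xi> * cnj (fourier g \<xi>)"
  have "?l \<longlonglongrightarrow> (LINT \<xi>|lborel. fourier f \<xi> * cnj (fourier g \<xi>))"
  proof (rule integral_dominated_convergence[where w="\<lambda>\<xi>. (norm (fourier f \<xi>))\<^sup>2 + (norm (fourier g \<xi>))\<^sup>2"])
    show "integrable lborel (\<lambda>\<xi>. (norm (fourier f \<xi>))\<^sup>2 + (norm (fourier g \<xi>))\<^sup>2)"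
      using fourier_L2 f g by auto
    show "AE \<xi> in lborel. (\<lambda>k. of_real (exp (- (inverse (Suc k) * \<xi>)\<^sup>2 / 2)) * fourier f \<xi> * cnj (fourier g \<xi>)) \<longlonglongrightarrow> fourier f \<xi> * cnj (fourier g \<xi>)"
    proof (rule AE_I2)
      fix \<xi> :: real
      have "(\<lambda>k. complex_of_real (exp (- (inverse (Suc k) * \<xi>)\<^sup>2 / 2)) * fourier f \<xi> * cnj (fourier g \<xi>)) \<longlonglongrightarrow> of_real (exp (- (0 * \<xi>)\<^sup>2 / 2)) * fourier f \<xi> * cnj (fourier g \<xi>)"
        by (intro tendsto_intros LIMSEQ_inverse_real_of_nat) auto
      then show "(\<lambda>k. of_real (exp (- (inverse (Suc k) * \<xi>)\<^sup>2 / 2)) * fourier f \<xi> * cnj (fourier g \<xi>)) \<longlonglongrightarrow> fourier f \<xi> * cnj (fourier g \<xi>)" by simp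
    qed
    show "AE \<xi> in lborel. norm (of_real (exp (- (inverse (Suc k) * \<xi>)\<^sup>2 / 2)) * fourier f \<xi> * cnj (fourier g \<xi>)) \<le> (norm (fourier f \<xi>))\<^sup>2 + (norm (fourier g \<xi>))\<^sup>2" for k
    proof (rule AE_I2)
      fix \<xi> :: real
      have 1: "a * b \<le> a\<^sup>2 + b\<^sup>2" if "a \<ge> 0" "b \<ge> 0" for a b :: real
        using sum_squares_bound[of a b] that mult_nonneg_nonneg[OF that] by linarith
      have "exp (- (inverse (Suc k) * \<xi>)\<^sup>2 / 2) * (norm (fourier f \<xi>) * norm (fourier g \<xi>)) \<le> 1 * (norm (fourier f \<xi>) * norm (fourier g \<xi>))"
        by (intro mult_right_mono) auto
      also have "\<dots> \<le> (norm (fourier f \<xi>))\<^sup>2 + (norm (fourier g \<xi>))\<^sup>2" using 1 by simp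
      finally show "norm (of_real (exp (- (inverse (Suc k) * \<xi>)\<^sup>2 / 2)) * fourier f \<xi> * cnj (fourier g \<xi>)) \<le> (norm (fourier f \<xi>))\<^sup>2 + (norm (fourier g \<xi>))\<^sup>2"
        by (simp add: norm_mult mult.assoc)
    qed
  qed measurable
  moreover have "?l \<longlonglongrightarrow> (LINT y|lborel. cnj (g y) * f y)"
  proof -
    have "(\<lambda>k. LINT y|lborel. cnj (g y) * (LINT z|lborel. of_real (std_normal_density z) * f (y - inverse (Suc k) * z))) \<longlonglongrightarrow> (LINT y|lborel. cnj (g y) * f y)"
      by (rule integral_dominated_convergence[where w="\<lambda>y. B * norm (g y)"])
         (use g in \<open>auto intro!: AE_I2 tendsto_mult gauss_average_tendsto[OF f, unfolded of_nat_Suc] integrable_mult_right integrable_norm mult_left_mono gauss_average(2)[OF f B(2)] simp: norm_mult cdec_integrable mult.commute[of B]\<close>)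
    then show ?thesis by (subst parseval_regularised[OF f g]) (auto simp del: of_nat_Suc)
  qed
  ultimately have "(LINT \<xi>|lborel. fourier f \<xi> * cnj (fourier g \<xi>)) = (LINT y|lborel. cnj (g y) * f y)"
    by (rule LIMSEQ_unique)
  then show ?thesis by (simp add: mult.commute)
qed

lemma fourier_add:
  assumes "cdec f" "cdec g"
  shows "fourier (\<lambda>x. f x + g x) \<xi> = fourier f \<xi> + fourier g \<xi>"
proof -
  have i: "integrable lborel (\<lambda>x. exp (- \<i> * of_real (\<xi> * x)) * f x)" if "cdec f" for f
    by (rule Bochner_Integration.integrable_bound[OF cdec_integrable[OF that]])
       (use cdec_measurable[OF that] in \<open>auto intro!: AE_I2 simp: norm_mult norm_exp_eq_Re\<close>)
  show ?thesis unfolding fourier_def distrib_left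
    by (subst Bochner_Integration.integral_add[OF i[OF assms(1)] i[OF assms(2)]]) (simp add: distrib_left)
qed

lemma fourier_cmult: "fourier (\<lambda>x. a * f x) \<xi> = a * fourier f \<xi>"
  unfolding fourier_def by (simp add: mult.left_commute)

lemma fourier_diff:
  assumes "cdec f" "cdec g"
  shows "fourier (\<lambda>x. f x - g x) \<xi> = fourier f \<xi> - fourier g \<xi>"
  using fourier_add[OF assms(1) cdec_cmult(1)[OF assms(2), of "-1"], of \<xi>] fourier_cmult[of "-1" g \<xi>] by simp

lemma fourier_shift: "fourier (\<lambda>x. f (x + h)) \<xi> = exp (\<i> * of_real (\<xi> * h)) * fourier f \<xi>"
proof -
  have e: "exp (- \<i> * of_real (\<xi> * (- h + 1 * x))) = exp (\<i> * of_real (\<xi> * h)) * exp (- \<i> * of_real (\<xi> * x))" for x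
    unfolding exp_add[symmetric] by (simp add: algebra_simps)
  have "(LINT x|lborel. exp (- \<i> * of_real (\<xi> * x)) * f (x + h))
    = (LINT x|lborel. exp (- \<i> * of_real (\<xi> * (- h + 1 * x))) * f (- h + 1 * x + h))"
    by (subst lborel_integral_real_affine[where c=1 and t="-h"]) auto
  also have "\<dots> = (LINT x|lborel. exp (\<i> * of_real (\<xi> * h)) * (exp (- \<i> * of_real (\<xi> * x)) * f x))"
    by (simp only: e mult.assoc) simp
  finally show ?thesis unfolding fourier_def by (simp add: mult.left_commute)
qed

text \<open>Integration by parts: the function \<open>exp (- i \<xi> x) * F x\<close> vanishes at
  both ends, so the integral of its derivative is 0.\<close>

lemma fourier_deriv:
  assumes F: "\<And>x. (F has_vector_derivative g x) (at x)" and c: "cdec F" "cdec g"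
  shows "fourier g \<xi> = \<i> * of_real \<xi> * fourier F \<xi>"
proof -
  let ?e = "\<lambda>x. exp (- \<i> * of_real (\<xi> * x))"
  have ce: "continuous_on UNIV ?e" by (intro continuous_intros)
  have cd: "cdec (\<lambda>x. ?e x * f x)" if "cdec f" for f
    by (rule cdec_mult_bounded(2)[OF that ce, of 1]) simp
  have de: "(?e has_vector_derivative (- \<i> * of_real \<xi>) * ?e x) (at x)" for x
    unfolding of_real_mult
    by (rule has_vector_derivative_real_field[where f="\<lambda>z. exp (- \<i> * (of_real \<xi> * z))"])
       (auto intro!: derivative_eq_intros)
  have "((\<lambda>x. ?e x * F x) has_vector_derivative (?e x * g x - \<i> * of_real \<xi> * (?e x * F x))) (at x)" for x
    using has_vector_derivative_mult[OF de F[of x]] by (simp add: algebra_simps)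
  moreover have cc: "cdec (\<lambda>x. ?e x * g x - \<i> * of_real \<xi> * (?e x * F x))"
    by (intro cdec_diff cdec_cmult(1) cd c)
  ultimately have "((\<lambda>x. ?e x * F x) \<longlongrightarrow> 0 + (LINT x|lborel. ?e x * g x - \<i> * of_real \<xi> * (?e x * F x))) at_top"
    by (rule J_unique(2)) (rule cdec_tendsto_0[OF cd[OF c(1)]])
  then have "(LINT x|lborel. ?e x * g x - \<i> * of_real \<xi> * (?e x * F x)) = 0"
    using tendsto_unique[OF trivial_limit_at_top_linorder _ cdec_tendsto_0(1)[OF cd[OF c(1)]]] by simp
  then have "(LINT x|lborel. ?e x * g x) = \<i> * of_real \<xi> * (LINT x|lborel. ?e x * F x)"
    using cdec_integrable[OF cd[OF c(1)]] cdec_integrable[OF cd[OF c(2)]] by simp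
  then show ?thesis unfolding fourier_def by simp
qed

lemma plancherel:
  assumes "cdec f"
  shows "(LINT \<xi>|lborel. (norm (fourier f \<xi>))\<^sup>2) = (LINT x|lborel. (norm (f x))\<^sup>2)"
proof -
  have "complex_of_real (LINT \<xi>|lborel. (norm (fourier f \<xi>))\<^sup>2) = of_real (LINT x|lborel. (norm (f x))\<^sup>2)"
    using parseval[OF assms assms] by (simp only: complex_norm_square[symmetric] integral_complex_of_real)
  then show ?thesis by (simp only: of_real_eq_iff)
qed

section \<open>The Jost system\<close>

definition \<beta> :: complex where "\<beta> = Complex (- 3 / 2) (- (sqrt 3 / 2))"

text \<open>The particular solution of \<open>c' = k \<beta> c + g\<close> with no homogeneous part.
  For \<open>k > 0\<close> the kernel decays to the right because \<open>Re \<beta> < 0\<close>, so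
  integration may start at minus infinity.\<close>

definition duhamel :: "real \<Rightarrow> (real \<Rightarrow> complex) \<Rightarrow> real \<Rightarrow> complex" where
  "duhamel k g x = exp (of_real x * (of_real k * \<beta>)) * J (\<lambda>y. exp (- (of_real y * (of_real k * \<beta>))) * g y) x"

lemma beta_simps [simp]: "Re \<beta> = - 3 / 2" "Im \<beta> = - (sqrt 3 / 2)"
  by (simp_all add: \<beta>_def)

lemma norm_exp_beta: "norm (exp (of_real x * (of_real k * \<beta>))) = exp (- (3/2 * k * x))"
  "norm (exp (- (of_real x * (of_real k * \<beta>)))) = exp (3/2 * k * x)"
  by (simp_all add: norm_exp_eq_Re \<beta>_def)

lemma exp_beta_deriv:
  "((\<lambda>x. exp (of_real x * (of_real k * \<beta>))) has_vector_derivative of_real k * \<beta> * exp (of_real x * (of_real k * \<beta>))) (at x)"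
  by (rule has_vector_derivative_real_field[where f="\<lambda>z. exp (z * (of_real k * \<beta>))"])
     (auto intro!: derivative_eq_intros)

text \<open>The weight stands on both sides for the sake of \<open>duhamel_cdec\<close>: one factor
  pays for moving the decay of \<open>g\<close> from \<open>y\<close> to \<open>x\<close>, and the
  other leaves a kernel that is integrable in \<open>x - y\<close>.\<close>

lemma exp_weight_le: fixes \<mu> :: real assumes "\<mu> > 0" obtains K where "K > 0" "\<And>s. s \<ge> 0 \<Longrightarrow> exp (- (\<mu> * s)) * (1 + s\<^sup>2) \<le> K / (1 + s\<^sup>2)"
proof -
  \<comment> \<open>With this \<open>d\<close> one has
    \<open>d * (1 + s) \<le> exp (\<mu> * s / 4)\<close>, and the fourth power of the left side
    dominates two copies of the quadratic weight.\<close>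
  define d where "d = min 1 (\<mu> / 4)"
  have d: "d > 0" "d \<le> 1" "d \<le> \<mu> / 4" using assms by (auto simp: d_def)
  have "exp (- (\<mu> * s)) * (1 + s\<^sup>2) \<le> (1 / d ^ 4) / (1 + s\<^sup>2)" if s: "s \<ge> 0" for s
  proof -
    have "d * (1 + s) \<le> exp (\<mu> * s / 4)"
    proof -
      have "d * (1 + s) \<le> 1 + \<mu> * s / 4"
        using mult_right_mono[OF d(3) s] d(2) by (simp add: distrib_left)
      also have "\<dots> \<le> exp (\<mu> * s / 4)" by simp
      finally show ?thesis .
    qed
    then have "(d * (1 + s)) ^ 4 \<le> exp (\<mu> * s / 4) ^ 4" using d s by (intro power_mono) auto
    also have "\<dots> = exp (\<mu> * s)" by (simp flip: exp_of_nat_mult)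
    finally have 1: "d ^ 4 * (1 + s) ^ 4 \<le> exp (\<mu> * s)" by (simp add: power_mult_distrib)
    have "1 + s\<^sup>2 \<le> (1 + s)\<^sup>2" using s by (simp add: power2_sum)
    then have "(1 + s\<^sup>2)\<^sup>2 \<le> ((1 + s)\<^sup>2)\<^sup>2" by (intro power_mono) auto
    then have "d ^ 4 * (1 + s\<^sup>2)\<^sup>2 \<le> d ^ 4 * (1 + s) ^ 4" using d by (intro mult_left_mono) auto
    with 1 have 2: "d ^ 4 * (1 + s\<^sup>2)\<^sup>2 \<le> exp (\<mu> * s)" by linarith
    have "exp (- (\<mu> * s)) * (d ^ 4 * (1 + s\<^sup>2)\<^sup>2) \<le> exp (- (\<mu> * s)) * exp (\<mu> * s)"
      by (intro mult_left_mono 2) simp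
    also have "\<dots> = 1" by (simp flip: exp_add)
    finally have "exp (- (\<mu> * s)) * (1 + s\<^sup>2) * (d ^ 4 * (1 + s\<^sup>2)) \<le> 1" by (simp add: power2_eq_square mult_ac)
    then show ?thesis using d by (simp add: pos_le_divide_eq mult_ac)
  qed
  then show ?thesis using that[of "1 / d ^ 4"] d by auto
qed

context
  fixes k :: real and g :: "real \<Rightarrow> complex"
  assumes k: "k > 0" and g: "cdec g"
begin

private definition "E y = exp (- (of_real y * (of_real k * \<beta>))) * g y"

private lemma norm_E: "norm (E y) = exp (3/2 * k * y) * norm (g y)"
  unfolding E_def norm_mult norm_exp_beta ..

private lemma E_cont: "continuous_on UNIV E"
  unfolding E_def[abs_def] by (intro continuous_intros cdec_cont[OF g])

private lemma E_int: "set_integrable lborel {..x} E"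
proof (rule set_integrable_bound[OF set_integrable_mult_right[of "exp (3/2 * k * x)" lborel "{..x}" "\<lambda>y. norm (g y)"]])
  show "set_integrable lborel {..x} (\<lambda>y. norm (g y))"
    by (intro cdec_set_integrable cdec_norm g) simp
  show "set_borel_measurable lborel {..x} E"
    using borel_measurable_continuous_onI[OF E_cont] by (simp add: set_borel_measurable_def)
  show "AE y in lborel. y \<in> {..x} \<longrightarrow> norm (E y) \<le> norm (exp (3/2 * k * x) * norm (g y))"
    using k by (auto intro!: AE_I2 mult_right_mono simp: E_def norm_mult norm_exp_beta)
qed

lemma duhamel_deriv: "(duhamel k g has_vector_derivative of_real k * \<beta> * duhamel k g x + g x) (at x)"
proof -
  have "(J E has_vector_derivative E x) (at x)" by (rule J_deriv_gen[OF E_cont E_int])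
  from has_vector_derivative_mult[OF exp_beta_deriv[of k x] this]
  have "((\<lambda>x. exp (of_real x * (of_real k * \<beta>)) * J E x) has_vector_derivative
     exp (of_real x * (of_real k * \<beta>)) * E x + of_real k * \<beta> * exp (of_real x * (of_real k * \<beta>)) * J E x) (at x)" .
  moreover have "exp (of_real x * (of_real k * \<beta>)) * E x = g x"
    unfolding E_def mult.assoc[symmetric] exp_add[symmetric] by simp
  ultimately have "((\<lambda>x. exp (of_real x * (of_real k * \<beta>)) * J E x) has_vector_derivative
     of_real k * \<beta> * (exp (of_real x * (of_real k * \<beta>)) * J E x) + g x) (at x)"
    by (simp only: add.commute mult.assoc)
  then show ?thesis by (simp only: duhamel_def[abs_def] E_def[abs_def])
qed

lemma duhamel_cont: "continuous_on UNIV (duhamel k g)"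
  by (intro continuous_at_imp_continuous_on ballI has_vector_derivative_continuous) (rule duhamel_deriv)

lemma duhamel_norm: "norm (duhamel k g x) \<le> exp (- (3/2 * k * x)) * (LINT y:{..x}|lborel. exp (3/2 * k * y) * norm (g y))"
proof -
  have "norm (J E x) \<le> (LINT y:{..x}|lborel. norm (E y))"
    unfolding J_def set_lebesgue_integral_def
    by (rule order_trans[OF integral_norm_bound]) simp
  also have "\<dots> = (LINT y:{..x}|lborel. exp (3/2 * k * y) * norm (g y))"
    by (simp only: norm_E)
  finally show ?thesis unfolding duhamel_def norm_mult norm_exp_beta(1) E_def[abs_def]
    by (intro mult_left_mono) auto
qed

private lemma E_norm_int: "set_integrable lborel {..x} (\<lambda>y. exp (3/2 * k * y) * norm (g y))"
  using set_integrable_norm[OF E_int[of x]] by (simp only: norm_E)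

lemma duhamel_norm_J: "norm (duhamel k g x) \<le> J (\<lambda>y. norm (g y)) x"
proof -
  have "exp (- (3/2 * k * x)) * (LINT y:{..x}|lborel. exp (3/2 * k * y) * norm (g y))
    = (LINT y:{..x}|lborel. exp (- (3/2 * k * x)) * (exp (3/2 * k * y) * norm (g y)))" by simp
  also have "\<dots> \<le> (LINT y:{..x}|lborel. norm (g y))"
  proof (rule set_integral_mono)
    show "set_integrable lborel {..x} (\<lambda>y. norm (g y))"
      by (intro cdec_set_integrable cdec_norm g) simp
    fix y assume "y \<in> {..x}"
    then have "exp (- (3/2 * k * x)) * exp (3/2 * k * y) \<le> 1"
      using k by (simp flip: exp_add)
    then have "exp (- (3/2 * k * x)) * exp (3/2 * k * y) * norm (g y) \<le> 1 * norm (g y)" by (intro mult_right_mono) auto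
    then show "exp (- (3/2 * k * x)) * (exp (3/2 * k * y) * norm (g y)) \<le> norm (g y)" by simp
  qed (intro set_integrable_mult_right E_norm_int)
  finally show ?thesis using duhamel_norm unfolding J_def by (meson order_trans)
qed

lemma duhamel_cdec: "cdec (duhamel k g)"
proof -
  obtain C where C: "C > 0" "\<And>x. norm (g x) \<le> C / (1 + x\<^sup>2)" using cdec_bound[OF g] by blast
  obtain K where K: "K > 0" "\<And>s. s \<ge> 0 \<Longrightarrow> exp (- (3/2 * k * s)) * (1 + s\<^sup>2) \<le> K / (1 + s\<^sup>2)"
    using exp_weight_le[of "3/2 * k"] k by auto
  have "norm (duhamel k g x) \<le> (2 * C * K * pi) / (1 + x\<^sup>2)" for x
  proof -
    have "exp (- (3/2 * k * x)) * (LINT y:{..x}|lborel. exp (3/2 * k * y) * norm (g y))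
      = (LINT y|lborel. indicator {..x} y * (exp (- (3/2 * k * x)) * (exp (3/2 * k * y) * norm (g y))))"
      unfolding set_lebesgue_integral_def by (simp flip: integral_mult_right_zero add: mult_ac)
    also have "\<dots> \<le> (LINT y|lborel. 2 * C * K / (1 + x\<^sup>2) * inverse (1 + (x - y)\<^sup>2))"
    proof (rule integral_mono)
      show "integrable lborel (\<lambda>y. indicator {..x} y * (exp (- (3/2 * k * x)) * (exp (3/2 * k * y) * norm (g y))))"
        using set_integrable_mult_right[OF E_norm_int[of x], where a="exp (- (3/2 * k * x))"] unfolding set_integrable_def by simp
      have "integrable lborel (\<lambda>y. inverse (1 + (x + (-1) * y)\<^sup>2))"
        using integrable_inv_sq[of 1] by (subst lborel_integrable_real_affine_iff) (auto simp: divide_inverse)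
      then show "integrable lborel (\<lambda>y. 2 * C * K / (1 + x\<^sup>2) * inverse (1 + (x - y)\<^sup>2))" by simp
      fix y
      show "indicator {..x} y * (exp (- (3/2 * k * x)) * (exp (3/2 * k * y) * norm (g y))) \<le> 2 * C * K / (1 + x\<^sup>2) * inverse (1 + (x - y)\<^sup>2)"
      proof (cases "y \<le> x")
        case True
        have a: "norm (g y) \<le> 2 * C / (1 + x\<^sup>2) * (1 + (x - y)\<^sup>2)"
        proof -
          have "1 / (1 + y\<^sup>2) \<le> 2 / (1 + x\<^sup>2) * (1 + (x - y)\<^sup>2)"
            using weight_shift[of x y] by (simp add: field_simps)
          then have "C * (1 / (1 + y\<^sup>2)) \<le> C * (2 / (1 + x\<^sup>2) * (1 + (x - y)\<^sup>2))"
            using C(1) by (intro mult_left_mono) auto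
          moreover have "C * (2 / (1 + x\<^sup>2) * (1 + (x - y)\<^sup>2)) = 2 * C / (1 + x\<^sup>2) * (1 + (x - y)\<^sup>2)" by simp
          moreover have "C * (1 / (1 + y\<^sup>2)) = C / (1 + y\<^sup>2)" by simp
          ultimately show ?thesis using C(2)[of y] by linarith
        qed
        have e: "exp (- (3/2 * k * x)) * exp (3/2 * k * y) = exp (- (3/2 * k * (x - y)))"
          unfolding exp_add[symmetric] by (rule arg_cong[where f=exp]) argo
        have "exp (- (3/2 * k * x)) * (exp (3/2 * k * y) * norm (g y)) = exp (- (3/2 * k * (x - y))) * norm (g y)"
          unfolding mult.assoc[symmetric] e ..
        also have "\<dots> \<le> exp (- (3/2 * k * (x - y))) * (2 * C / (1 + x\<^sup>2) * (1 + (x - y)\<^sup>2))"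
          by (intro mult_left_mono a) simp
        also have "\<dots> = 2 * C / (1 + x\<^sup>2) * (exp (- (3/2 * k * (x - y))) * (1 + (x - y)\<^sup>2))" by simp
        also have "\<dots> \<le> 2 * C / (1 + x\<^sup>2) * (K / (1 + (x - y)\<^sup>2))"
          using C(1) True by (intro mult_left_mono K) auto
        also have "\<dots> = 2 * C * K / (1 + x\<^sup>2) * inverse (1 + (x - y)\<^sup>2)" by (simp add: divide_inverse)
        finally show ?thesis using True by simp
      qed (use C K in \<open>auto\<close>)
    qed
    also have "\<dots> = 2 * C * K / (1 + x\<^sup>2) * pi"
    proof -
      have "(LINT y|lborel. inverse (1 + (x + (-1) * y)\<^sup>2)) = pi"
        using lborel_integral_real_affine[of "-1" "\<lambda>y. inverse (1 + y\<^sup>2)" x] integral_inv_sq by simp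
      then show ?thesis by simp
    qed
    finally show ?thesis using duhamel_norm[of x] by simp
  qed
  with duhamel_cont show ?thesis unfolding cdec_def by blast
qed

end

text \<open>Homogeneous solutions are multiples of \<open>exp (x k \<beta>)\<close>, which is
  unbounded at minus infinity, so boundedness alone selects the Duhamel solution. Linearity of
  \<open>duhamel\<close> is derived from this as well, instead of from the integral.\<close>

lemma duhamel_unique:
  assumes k: "k > 0" and g: "cdec g" and c: "\<And>x. norm (c x) \<le> B"
    and d: "\<And>x. (c has_vector_derivative (of_real k * \<beta> * c x + g x)) (at x)"
  shows "c x = duhamel k g x"
proof -
  let ?e = "\<lambda>x. exp (- (of_real x * (of_real k * \<beta>)))"
  let ?u = "\<lambda>x. c x - duhamel k g x"
  obtain D where D: "\<And>x. norm (duhamel k g x) \<le> D" using cdec_bounded[OF duhamel_cdec[OF k g]] by blast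
  have de: "(?e has_vector_derivative - (of_real k * \<beta>) * ?e x) (at x)" for x
    using exp_beta_deriv[of "-k" x] by simp
  have du: "(?u has_vector_derivative of_real k * \<beta> * ?u x) (at x)" for x
    using has_vector_derivative_diff[OF d[of x] duhamel_deriv[OF k g, of x]] by (simp add: algebra_simps)
  have "((\<lambda>x. ?e x * ?u x) has_vector_derivative 0) (at x)" for x
    using has_vector_derivative_mult[OF de du[of x]] by (simp add: algebra_simps)
  then have e: "?e x * ?u x = ?e y * ?u y" for x y by (rule deriv_zero_const)
  have lim: "((\<lambda>y. exp (3/2 * k * y) * (B + D)) \<longlongrightarrow> 0) at_bot"
    using k by (intro tendsto_mult_left_zero filterlim_compose[OF exp_at_bot] filterlim_tendsto_pos_mult_at_bot[OF tendsto_const _ filterlim_ident]) auto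
  have "((\<lambda>y. ?e y * ?u y) \<longlongrightarrow> 0) at_bot"
    by (rule Lim_null_comparison[OF _ lim])
       (intro always_eventually allI, unfold norm_mult norm_exp_beta, intro mult_left_mono order_trans[OF norm_triangle_ineq4] add_mono c D, simp)
  moreover have "(\<lambda>y. ?e y * ?u y) = (\<lambda>y. ?e x * ?u x)" by (intro ext e)
  ultimately have "((\<lambda>y. ?e x * ?u x) \<longlongrightarrow> 0) (at_bot :: real filter)" by simp
  then have "?e x * ?u x = 0" by (simp add: tendsto_const_iff)
  then show ?thesis by simp
qed

text \<open>In the variables \<open>\<phi>\<^sub>j = m + 2 Re (\<omega>\<^sup>j c)\<close>, \<open>j \<in> \<int>/3\<close> (see \<open>jcomp\<close> below), with
  \<open>\<omega> = exp (2 \<pi> \<i> / 3)\<close> and \<open>\<beta> = cnj \<omega> - 1\<close>, this is the linear system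
  \<open>\<phi>\<^sub>j' = k (\<phi>\<^sub>j\<^sub>-\<^sub>1 - \<phi>\<^sub>j) - 2 Re (\<omega>\<^sup>j q) \<phi>\<^sub>j\<close>, whose off-diagonal coefficients are nonnegative. It is the
  spectral problem of the Lax pair, with the growth of the free solution removed.\<close>

definition jost :: "real \<Rightarrow> (real \<Rightarrow> complex) \<Rightarrow> (real \<Rightarrow> real) \<Rightarrow> (real \<Rightarrow> complex) \<Rightarrow> bool" where
  "jost k q m c \<longleftrightarrow>
     (\<forall>x. (m has_vector_derivative (- 2 * Re (q x * cnj (c x)))) (at x)) \<and>
     (\<forall>x. (c has_vector_derivative (of_real k * \<beta> * c x + - (q x * of_real (m x) + cnj (q x) * cnj (c x)))) (at x)) \<and>
     (m \<longlongrightarrow> 1) at_bot \<and> bounded (range m) \<and> cdec c"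

text \<open>In the supremum norm weighted by \<open>wt\<close> the Volterra operator of the Jost system is a
  contraction.\<close>

definition wt :: "(real \<Rightarrow> complex) \<Rightarrow> real \<Rightarrow> real" where
  "wt q x = exp (8 * J (\<lambda>y. norm (q y)) x)"

lemma wt_deriv: assumes "cdec q" shows "(wt q has_vector_derivative 8 * norm (q x) * wt q x) (at x)"
proof -
  have "((\<lambda>x. J (\<lambda>y. norm (q y)) x) has_real_derivative norm (q x)) (at x)"
    using J_deriv[OF cdec_norm[OF assms], of x] by (simp add: has_real_derivative_iff_has_vector_derivative)
  then have "(wt q has_real_derivative 8 * norm (q x) * wt q x) (at x)"
    unfolding wt_def[abs_def] by (auto intro!: derivative_eq_intros)
  then show ?thesis by (simp add: has_real_derivative_iff_has_vector_derivative)
qed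

lemma wt_bounds: assumes "cdec q"
  shows "wt q x \<ge> 1" "wt q x \<le> exp (8 * (LINT y|lborel. norm (q y)))" "continuous_on UNIV (wt q)" "cdec (\<lambda>x. norm (q x) * wt q x)"
proof -
  note J = J_le_integral[OF cdec_norm[OF assms]]
  show a: "wt q x \<ge> 1" for x using J(2) by (simp add: wt_def)
  show b: "wt q x \<le> exp (8 * (LINT y|lborel. norm (q y)))" for x using J(1) by (simp add: wt_def)
  show c: "continuous_on UNIV (wt q)"
    by (intro continuous_at_imp_continuous_on ballI has_vector_derivative_continuous) (rule wt_deriv[OF assms])
  have "norm (wt q x) \<le> exp (8 * (LINT y|lborel. norm (q y)))" for x using a[of x] b[of x] by simp
  then show "cdec (\<lambda>x. norm (q x) * wt q x)"
    by (intro cdec_mult_bounded(1) cdec_norm assms c)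
qed

lemma J_wt: assumes "cdec q" shows "J (\<lambda>y. 8 * (norm (q y) * wt q y)) x = wt q x - 1"
proof -
  have lim: "(wt q \<longlongrightarrow> exp (8 * 0)) at_bot"
    unfolding wt_def[abs_def] by (intro tendsto_intros J_at_bot cdec_norm assms)
  have "wt q x = exp (8 * 0) + J (\<lambda>y. 8 * (norm (q y) * wt q y)) x"
    by (rule J_unique(1)[OF _ _ lim])
       (use wt_deriv[OF assms] cdec_cmult(1)[OF wt_bounds(4)[OF assms], of 8] in \<open>auto simp: mult.assoc\<close>)
  then show ?thesis by simp
qed

text \<open>The right-hand side of the Volterra equation of the Jost system, without its value
  \<open>(1, 0)\<close> at \<open>- \<infinity>\<close>.\<close>

definition volt :: "real \<Rightarrow> (real \<Rightarrow> complex) \<Rightarrow> (real \<Rightarrow> real \<times> complex) \<Rightarrow> real \<Rightarrow> real \<times> complex" where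
  "volt k q \<phi> x = (J (\<lambda>y. - 2 * Re (q y * cnj (snd (\<phi> y)))) x,
     duhamel k (\<lambda>y. - (q y * of_real (fst (\<phi> y)) + cnj (q y) * cnj (snd (\<phi> y)))) x)"

lemma norm_prod_components: "norm (fst p) \<le> norm p" "norm (snd p) \<le> norm p"
  by (cases p; simp add: norm_fst_le norm_snd_le)+

lemma volt_cdec:
  assumes q: "cdec q" and \<phi>: "continuous_on UNIV \<phi>" "\<And>x. norm (\<phi> x) \<le> B"
  shows "cdec (\<lambda>y. - 2 * Re (q y * cnj (snd (\<phi> y))))"
    "cdec (\<lambda>y. - (q y * of_real (fst (\<phi> y)) + cnj (q y) * cnj (snd (\<phi> y))))"
proof -
  have "norm (cnj (snd (\<phi> y))) \<le> B" for y using order_trans[OF norm_prod_components(2) \<phi>(2)] by simp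
  moreover have "norm (complex_of_real (fst (\<phi> y))) \<le> B" for y
    using order_trans[OF norm_prod_components(1) \<phi>(2)] by (simp only: norm_of_real real_norm_def)
  ultimately have b: "norm (cnj (snd (\<phi> y))) \<le> B" "norm (complex_of_real (fst (\<phi> y))) \<le> B" for y by blast+
  have 1: "cdec (\<lambda>y. q y * cnj (snd (\<phi> y)))"
    by (rule cdec_mult_bounded(1)[OF q _ b(1)]) (intro continuous_intros \<phi>)
  have 2: "cdec (\<lambda>y. q y * of_real (fst (\<phi> y)))"
    by (rule cdec_mult_bounded(1)[OF q _ b(2)]) (intro continuous_intros \<phi>)
  have 3: "cdec (\<lambda>y. cnj (q y) * cnj (snd (\<phi> y)))"
    by (rule cdec_mult_bounded(1)[OF cdec_cnj[OF q] _ b(1)]) (intro continuous_intros \<phi>)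
  show "cdec (\<lambda>y. - 2 * Re (q y * cnj (snd (\<phi> y))))" by (intro cdec_cmult(1) cdec_Re 1)
  show "cdec (\<lambda>y. - (q y * of_real (fst (\<phi> y)) + cnj (q y) * cnj (snd (\<phi> y))))"
    by (intro cdec_uminus cdec_add 2 3)
qed

lemma volt_cont:
  assumes "k > 0" "cdec q" "continuous_on UNIV \<phi>" "\<And>x. norm (\<phi> x) \<le> B"
  shows "continuous_on UNIV (volt k q \<phi>)"
  unfolding volt_def[abs_def]
  by (intro continuous_on_Pair J_cont duhamel_cont volt_cdec[OF assms(2-4)] assms(1))

text \<open>The rate 8 in \<open>wt\<close> is made for this bound. Each component is at most
  \<open>J\<close> of \<open>2 * D * (norm q * wt q)\<close>, hence at most
  \<open>D / 4 * wt q\<close>, because \<open>8 * norm q * wt q\<close> is the derivative of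
  \<open>wt q\<close>. The two components add up to the factor 1/2.\<close>

lemma volt_bound:
  assumes k: "k > 0" and q: "cdec q" and \<phi>: "continuous_on UNIV \<phi>" "\<And>x. norm (\<phi> x) \<le> D * wt q x"
  shows "norm (volt k q \<phi> x) \<le> D / 2 * wt q x"
proof -
  have D: "D \<ge> 0" using order_trans[OF norm_ge_zero \<phi>(2)[of 0]] wt_bounds(1)[OF q, of 0]
    by (simp add: zero_le_mult_iff)
  have b: "norm (\<phi> x) \<le> D * exp (8 * (LINT y|lborel. norm (q y)))" for x
    by (rule order_trans[OF \<phi>(2)]) (intro mult_left_mono wt_bounds q D)
  note cd = volt_cdec[OF q \<phi>(1) b]
  let ?w = "\<lambda>y. norm (q y) * wt q y"
  have cw: "cdec (\<lambda>y. 2 * D * ?w y)" by (intro cdec_cmult(1) wt_bounds(4) q)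
  have s: "norm (snd (\<phi> y)) \<le> D * wt q y" "norm (fst (\<phi> y)) \<le> D * wt q y" for y
    using order_trans[OF norm_prod_components(2) \<phi>(2)] order_trans[OF norm_prod_components(1) \<phi>(2)] by auto
  have "norm (J (\<lambda>y. - 2 * Re (q y * cnj (snd (\<phi> y)))) x) \<le> J (\<lambda>y. norm (- 2 * Re (q y * cnj (snd (\<phi> y))))) x"
    by (rule J_norm_le[OF cd(1)])
  also have "\<dots> \<le> J (\<lambda>y. 2 * D * ?w y) x"
  proof (rule J_mono_fun[OF cdec_norm[OF cd(1)] cw])
    fix y
    have "\<bar>Re (q y * cnj (snd (\<phi> y)))\<bar> \<le> norm (q y) * norm (snd (\<phi> y))"
      using abs_Re_le_cmod[of "q y * cnj (snd (\<phi> y))"] by (simp add: norm_mult)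
    also have "\<dots> \<le> norm (q y) * (D * wt q y)" by (intro mult_left_mono s) simp
    finally show "norm (- 2 * Re (q y * cnj (snd (\<phi> y)))) \<le> 2 * D * ?w y" by (simp add: mult_ac abs_mult)
  qed
  finally have 1: "norm (fst (volt k q \<phi> x)) \<le> J (\<lambda>y. 2 * D * ?w y) x" by (simp add: volt_def)
  have "norm (duhamel k (\<lambda>y. - (q y * of_real (fst (\<phi> y)) + cnj (q y) * cnj (snd (\<phi> y)))) x)
    \<le> J (\<lambda>y. norm (- (q y * of_real (fst (\<phi> y)) + cnj (q y) * cnj (snd (\<phi> y))))) x"
    by (rule duhamel_norm_J[OF k cd(2)])
  also have "\<dots> \<le> J (\<lambda>y. 2 * D * ?w y) x"
  proof (rule J_mono_fun[OF cdec_norm[OF cd(2)] cw])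
    fix y
    have "norm (- (q y * of_real (fst (\<phi> y)) + cnj (q y) * cnj (snd (\<phi> y)))) \<le> norm (q y) * norm (fst (\<phi> y)) + norm (q y) * norm (snd (\<phi> y))"
      by (subst norm_minus_cancel, rule order_trans[OF norm_triangle_ineq]) (simp add: norm_mult)
    also have "\<dots> \<le> norm (q y) * (D * wt q y) + norm (q y) * (D * wt q y)" by (intro add_mono mult_left_mono s) simp_all
    finally show "norm (- (q y * of_real (fst (\<phi> y)) + cnj (q y) * cnj (snd (\<phi> y)))) \<le> 2 * D * ?w y" by (simp add: mult_ac)
  qed
  finally have 2: "norm (snd (volt k q \<phi> x)) \<le> J (\<lambda>y. 2 * D * ?w y) x" by (simp add: volt_def)
  have "J (\<lambda>y. 2 * D * ?w y) x = D / 4 * J (\<lambda>y. 8 * ?w y) x"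
    unfolding J_def set_integral_mult_right[symmetric] by (simp add: mult_ac)
  also have "\<dots> \<le> D / 4 * wt q x" unfolding J_wt[OF q] using D by (intro mult_left_mono) auto
  finally have 3: "J (\<lambda>y. 2 * D * ?w y) x \<le> D / 4 * wt q x" .
  have "norm (volt k q \<phi> x) \<le> norm (fst (volt k q \<phi> x)) + norm (snd (volt k q \<phi> x))"
    by (metis norm_Pair_le prod.collapse)
  with 1 2 3 show ?thesis by simp
qed

lemma volt_diff:
  assumes k: "k > 0" and q: "cdec q" and \<phi>: "continuous_on UNIV \<phi>" "\<And>x. norm (\<phi> x) \<le> B"
    and \<psi>: "continuous_on UNIV \<psi>" "\<And>x. norm (\<psi> x) \<le> B'"
  shows "volt k q \<phi> x - volt k q \<psi> x = volt k q (\<lambda>y. \<phi> y - \<psi> y) x"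
proof -
  note c1 = volt_cdec[OF q \<phi>] and c2 = volt_cdec[OF q \<psi>]
  have b: "norm (\<phi> y - \<psi> y) \<le> B + B'" for y
    by (rule order_trans[OF norm_triangle_ineq4]) (intro add_mono \<phi> \<psi>)
  note c3 = volt_cdec[OF q continuous_on_diff[OF \<phi>(1) \<psi>(1)] b]
  have 1: "J (\<lambda>y. - 2 * Re (q y * cnj (snd (\<phi> y)))) x - J (\<lambda>y. - 2 * Re (q y * cnj (snd (\<psi> y)))) x
    = J (\<lambda>y. - 2 * Re (q y * cnj (snd (\<phi> y - \<psi> y)))) x"
    unfolding J_def
  proof (subst set_integral_diff(2)[symmetric])
    have "- 2 * Re (q y * cnj (snd (\<phi> y))) - - 2 * Re (q y * cnj (snd (\<psi> y))) = - 2 * Re (q y * cnj (snd (\<phi> y - \<psi> y)))" for y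
      by (simp add: algebra_simps)
    then show "(LINT y:{..x}|lborel. - 2 * Re (q y * cnj (snd (\<phi> y))) - - 2 * Re (q y * cnj (snd (\<psi> y)))) = (LINT y:{..x}|lborel. - 2 * Re (q y * cnj (snd (\<phi> y - \<psi> y))))"
      by simp
  qed (intro cdec_set_integrable c1 c2, simp)+
  let ?d1 = "duhamel k (\<lambda>y. - (q y * of_real (fst (\<phi> y)) + cnj (q y) * cnj (snd (\<phi> y))))"
  let ?d2 = "duhamel k (\<lambda>y. - (q y * of_real (fst (\<psi> y)) + cnj (q y) * cnj (snd (\<psi> y))))"
  obtain B1 where B1: "\<And>x. norm (?d1 x - ?d2 x) \<le> B1"
    using cdec_bounded[OF cdec_diff[OF duhamel_cdec[OF k c1(2)] duhamel_cdec[OF k c2(2)]]] by blast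
  have 2: "?d1 x - ?d2 x = duhamel k (\<lambda>y. - (q y * of_real (fst (\<phi> y - \<psi> y)) + cnj (q y) * cnj (snd (\<phi> y - \<psi> y)))) x"
  proof (rule duhamel_unique[OF k c3(2) B1])
    fix x
    show "((\<lambda>x. ?d1 x - ?d2 x) has_vector_derivative of_real k * \<beta> * (?d1 x - ?d2 x) +
       - (q x * of_real (fst (\<phi> x - \<psi> x)) + cnj (q x) * cnj (snd (\<phi> x - \<psi> x)))) (at x)"
      by (rule has_vector_derivative_eq_rhs[OF has_vector_derivative_diff[OF duhamel_deriv[OF k c1(2)] duhamel_deriv[OF k c2(2)]]])
         (simp add: algebra_simps)
  qed
  show ?thesis unfolding volt_def using 1 2 by simp
qed

text \<open>If \<open>D\<close> is the weighted supremum of \<open>z\<close>, the contraction gives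
  \<open>D \<le> D / 2 + e\<close>. Through \<open>jost_system_stable\<close> this compares Jost
  solutions at nearby times.\<close>

lemma volt_fixpoint_stable:
  assumes k: "k > 0" and q: "cdec q" and z: "continuous_on UNIV z" "\<And>x. norm (z x) \<le> B"
    and e: "\<And>x. norm (z x - volt k q z x) \<le> e"
  shows "norm (z x) \<le> 2 * e * exp (8 * (LINT y|lborel. norm (q y)))"
proof -
  let ?W = "exp (8 * (LINT y|lborel. norm (q y)))"
  have w1: "wt q x \<ge> 1" for x by (rule wt_bounds(1)[OF q])
  define D where "D = (SUP x. norm (z x) / wt q x)"
  have "norm (z x) / wt q x \<le> B" for x
    using z(2)[of x] w1[of x] by (smt (verit) divide_le_eq_1 frac_le norm_ge_zero div_by_1)
  then have bdd: "bdd_above (range (\<lambda>x. norm (z x) / wt q x))" by (auto intro!: bdd_aboveI[of _ B])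
  have D: "norm (z x) \<le> D * wt q x" for x
    using cSUP_upper[OF UNIV_I bdd, of x] w1[of x] unfolding D_def by (simp add: divide_le_eq)
  have e0: "e \<ge> 0" using order_trans[OF norm_ge_zero e] .
  have "norm (z x) / wt q x \<le> D / 2 + e" for x
  proof -
    have "norm (z x) \<le> norm (z x - volt k q z x) + norm (volt k q z x)"
      using norm_triangle_sub by (metis add.commute)
    also have "\<dots> \<le> e * wt q x + D / 2 * wt q x"
      using mult_left_mono[OF w1[of x] e0] e[of x] volt_bound[OF k q z(1) D, of x] by simp
    finally show ?thesis using w1[of x] by (simp add: divide_le_eq algebra_simps)
  qed
  then have "D \<le> D / 2 + e" unfolding D_def by (intro cSUP_least) auto
  then have "D \<le> 2 * e" by simp
  then have "D * wt q x \<le> 2 * e * ?W"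
    using e0 w1[of x] wt_bounds(2)[OF q, of x] by (intro mult_mono) auto
  then show ?thesis using D[of x] by linarith
qed

lemma jost_exists:
  assumes k: "k > 0" and q: "cdec q" shows "\<exists>m c. jost k q m c"
proof -
  note W = wt_bounds[OF q]
  let ?W = "exp (8 * (LINT y|lborel. norm (q y)))"
  \<comment> \<open>Dividing by \<open>wt q\<close> turns the weighted norm into the plain supremum
    norm, so that Banach's theorem applies in the space of bounded continuous functions.\<close>
  define F where "F Z x = inverse (wt q x) *\<^sub>R ((1, 0) + volt k q (\<lambda>y. wt q y *\<^sub>R apply_bcontfun Z y) x)" for Z :: "real \<Rightarrow>\<^sub>C (real \<times> complex)" and x
  have Zc: "continuous_on UNIV (\<lambda>y. wt q y *\<^sub>R apply_bcontfun Z y)" for Z :: "real \<Rightarrow>\<^sub>C (real \<times> complex)"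
    by (intro continuous_intros W(3)) auto
  have Zb: "\<exists>D. \<forall>y. norm (wt q y *\<^sub>R apply_bcontfun Z y) \<le> D * wt q y" for Z :: "real \<Rightarrow>\<^sub>C (real \<times> complex)"
  proof -
    obtain D where "\<And>y. norm (apply_bcontfun Z y) \<le> D" using bounded_apply_bcontfun[of Z] by (auto simp: bounded_iff)
    then show ?thesis using W(1) by (intro exI[of _ D] allI) (smt (verit) abs_of_nonneg mult.commute mult_right_mono norm_scaleR)
  qed
  have Zb': "\<exists>D. \<forall>y. norm (wt q y *\<^sub>R apply_bcontfun Z y) \<le> D" for Z :: "real \<Rightarrow>\<^sub>C (real \<times> complex)"
  proof -
    obtain D where D: "\<And>y. norm (wt q y *\<^sub>R apply_bcontfun Z y) \<le> D * wt q y" using Zb by blast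
    have "D * wt q y \<le> \<bar>D\<bar> * ?W" for y using W(1)[of y] W(2)[of y] by (intro mult_mono) auto
    then show ?thesis using D order_trans by blast
  qed
  have Fb: "F Z \<in> bcontfun" for Z
  proof -
    obtain D where D: "\<And>y. norm (wt q y *\<^sub>R apply_bcontfun Z y) \<le> D * wt q y" using Zb by blast
    obtain D' where D': "\<And>y. norm (wt q y *\<^sub>R apply_bcontfun Z y) \<le> D'" using Zb' by blast
    have n0: "wt q x \<noteq> 0" for x using W(1)[of x] by auto
    have "continuous_on UNIV (F Z)" unfolding F_def
      by (intro continuous_intros W(3) volt_cont[OF k q Zc D']) (use n0 in auto)
    moreover have "norm (F Z x) \<le> 1 + D / 2" for x
    proof -
      have "norm ((1, 0) + volt k q (\<lambda>y. wt q y *\<^sub>R apply_bcontfun Z y) x) \<le> 1 + D / 2 * wt q x"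
        using norm_triangle_mono[OF _ volt_bound[OF k q Zc D]] by (metis norm_Pair norm_one norm_zero order_refl power_zero_numeral add.right_neutral real_sqrt_abs abs_one power_one real_sqrt_one)
      also have "\<dots> \<le> (1 + D / 2) * wt q x" using W(1)[of x] by (simp add: distrib_right)
      finally show ?thesis using W(1)[of x] unfolding F_def by (simp add: inverse_eq_divide divide_le_eq)
    qed
    ultimately show ?thesis by (auto simp: bcontfun_def bounded_iff)
  qed
  have Fdist: "dist (Bcontfun (F Z)) (Bcontfun (F Y)) \<le> (1/2) * dist Z Y" for Z Y
  proof (rule dist_bound)
    fix x
    obtain D where D: "\<And>y. norm (wt q y *\<^sub>R apply_bcontfun Z y) \<le> D" using Zb' by blast
    obtain E where E: "\<And>y. norm (wt q y *\<^sub>R apply_bcontfun Y y) \<le> E" using Zb' by blast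
    let ?d = "\<lambda>y. wt q y *\<^sub>R apply_bcontfun Z y - wt q y *\<^sub>R apply_bcontfun Y y"
    have "norm (?d y) \<le> dist Z Y * wt q y" for y
    proof -
      have "norm (?d y) = wt q y * dist (apply_bcontfun Z y) (apply_bcontfun Y y)"
        using W(1)[of y] by (simp flip: scaleR_diff_right add: dist_norm)
      also have "\<dots> \<le> wt q y * dist Z Y" using W(1)[of y] by (intro mult_left_mono dist_bounded) auto
      finally show ?thesis by (simp add: mult.commute)
    qed
    then have v: "norm (volt k q ?d x) \<le> dist Z Y / 2 * wt q x"
      by (intro volt_bound[OF k q] continuous_on_diff Zc)
    have "F Z x - F Y x = inverse (wt q x) *\<^sub>R volt k q ?d x"
      unfolding F_def volt_diff[OF k q Zc D Zc E, symmetric] by (simp flip: scaleR_diff_right)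
    then have "norm (F Z x - F Y x) \<le> 1 / 2 * dist Z Y"
      using v W(1)[of x] by (simp add: inverse_eq_divide divide_le_eq)
    then show "dist (apply_bcontfun (Bcontfun (F Z)) x) (apply_bcontfun (Bcontfun (F Y)) x) \<le> 1 / 2 * dist Z Y"
      by (simp add: Bcontfun_inverse[OF Fb] dist_norm)
  qed
  obtain Z where "Bcontfun (F Z) = Z"
    using banach_fix_type[of "1/2" "\<lambda>Z. Bcontfun (F Z)"] Fdist by auto
  then have Z: "F Z x = apply_bcontfun Z x" for x by (metis Bcontfun_inverse Fb)
  define \<phi> where "\<phi> x = wt q x *\<^sub>R apply_bcontfun Z x" for x
  have \<phi>: "\<phi> x = (1, 0) + volt k q \<phi> x" for x
  proof -
    have "\<phi> x = wt q x *\<^sub>R F Z x" by (simp add: \<phi>_def Z)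
    also have "\<dots> = (1, 0) + volt k q (\<lambda>y. wt q y *\<^sub>R apply_bcontfun Z y) x"
      using W(1)[of x] by (simp add: F_def)
    finally show ?thesis by (simp only: \<phi>_def[abs_def])
  qed
  obtain D where D: "\<And>y. norm (\<phi> y) \<le> D" using Zb'[of Z] unfolding \<phi>_def by blast
  have cont: "continuous_on UNIV \<phi>" using Zc[of Z] unfolding \<phi>_def[abs_def] .
  note cd = volt_cdec[OF q cont D]
  define m where "m x = fst (\<phi> x)" for x
  define c where "c x = snd (\<phi> x)" for x
  have m: "m = (\<lambda>x. 1 + J (\<lambda>y. - 2 * Re (q y * cnj (c y))) x)"
    unfolding m_def[abs_def] c_def by (subst \<phi>) (simp add: volt_def)
  have c: "c = duhamel k (\<lambda>y. - (q y * of_real (m y) + cnj (q y) * cnj (c y)))"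
    unfolding m_def c_def[abs_def] by (subst \<phi>) (simp add: volt_def fun_eq_iff)
  have dm: "(m has_vector_derivative (- 2 * Re (q x * cnj (c x)))) (at x)" for x
    by (subst m, rule has_vector_derivative_eq_rhs[OF has_vector_derivative_add[OF has_vector_derivative_const J_deriv[OF cd(1)[folded c_def]]]]) simp
  have dc: "(c has_vector_derivative (of_real k * \<beta> * c x + - (q x * of_real (m x) + cnj (q x) * cnj (c x)))) (at x)" for x
    by (subst (1 2) c) (rule duhamel_deriv[OF k cd(2)[folded c_def m_def]])
  have "(m \<longlongrightarrow> 1 + 0) at_bot"
    by (subst m) (intro tendsto_intros J_at_bot cd(1)[folded c_def])
  moreover have "bounded (range m)"
    using order_trans[OF norm_prod_components(1) D] by (auto simp: bounded_iff m_def)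
  moreover have "cdec c" by (subst c) (rule duhamel_cdec[OF k cd(2)[folded c_def m_def]])
  ultimately have "jost k q m c" unfolding jost_def using dm dc by simp
  then show ?thesis by blast
qed

section \<open>Positivity and logarithmic variables\<close>

definition excess :: "real \<Rightarrow> real" where "excess d = exp d - 1 - d"

lemma excess_nonneg: "excess d \<ge> 0"
  using exp_ge_add_one_self[of d] unfolding excess_def by linarith

lemma excess_ge: "d \<ge> 0 \<Longrightarrow> d\<^sup>2 / 2 \<le> excess d"
  using exp_lower_Taylor_quadratic[of d] by (simp add: excess_def)

text \<open>For negative arguments \<open>excess\<close> grows only linearly and cannot bound the
  square. As the three numbers add up to 0, the squares of the negative ones are paid for by the
  nonnegative ones, where \<open>excess_ge\<close> applies.\<close>

lemma excess_sum_aux: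
  assumes "(a \<ge> 0 \<and> b \<ge> 0) \<or> (a \<le> 0 \<and> b \<le> 0)" "a + b + c = 0"
  shows "a\<^sup>2 + b\<^sup>2 + c\<^sup>2 \<le> 6 * (excess a + excess b + excess c)"
proof -
  have c: "c = - (a + b)" using assms(2) by simp
  have ab: "a * b \<ge> 0" using assms(1) by (auto intro: mult_nonneg_nonneg mult_nonpos_nonpos)
  have sq: "c\<^sup>2 = a\<^sup>2 + b\<^sup>2 + 2 * (a * b)" unfolding c power2_minus power2_sum by simp
  have ab2: "2 * (a * b) \<le> a\<^sup>2 + b\<^sup>2" using sum_squares_bound[of a b] by simp
  show ?thesis
  proof (cases "a \<ge> 0 \<and> b \<ge> 0")
    case True
    then have "a\<^sup>2 / 2 \<le> excess a" "b\<^sup>2 / 2 \<le> excess b" using excess_ge by blast+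
    then have "a\<^sup>2 \<le> 2 * excess a" "b\<^sup>2 \<le> 2 * excess b" by simp_all
    moreover have "c\<^sup>2 \<le> 2 * a\<^sup>2 + 2 * b\<^sup>2" using sq ab2 by simp
    ultimately show ?thesis using excess_nonneg[of c] by (simp add: distrib_left)
  next
    case False
    then have "c \<ge> 0" using assms(1) c by auto
    then have "c\<^sup>2 / 2 \<le> excess c" by (rule excess_ge)
    then have "c\<^sup>2 \<le> 2 * excess c" by simp
    moreover have "a\<^sup>2 + b\<^sup>2 \<le> c\<^sup>2" using sq ab by simp
    ultimately show ?thesis using excess_nonneg[of a] excess_nonneg[of b] excess_nonneg[of c] by (simp add: distrib_left)
  qed
qed

text \<open>Among three reals two always share a sign, which is the hypothesis of
  \<open>excess_sum_aux\<close> up to a permutation.\<close>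

lemma excess_sum:
  assumes "a + b + c = 0"
  shows "a\<^sup>2 + b\<^sup>2 + c\<^sup>2 \<le> 6 * (excess a + excess b + excess c)"
proof -
  consider "(a \<ge> 0 \<and> b \<ge> 0) \<or> (a \<le> 0 \<and> b \<le> 0)" | "(b \<ge> 0 \<and> c \<ge> 0) \<or> (b \<le> 0 \<and> c \<le> 0)" | "(a \<ge> 0 \<and> c \<ge> 0) \<or> (a \<le> 0 \<and> c \<le> 0)"
    by linarith
  then show ?thesis
  proof cases
    case 1 then show ?thesis by (rule excess_sum_aux) (use assms in simp)
  next
    case 2 then show ?thesis using excess_sum_aux[of b c a] assms by simp
  next
    case 3 then show ?thesis using excess_sum_aux[of a c b] assms by simp
  qed
qed

section \<open>Discrete Fourier analysis on three points\<close>

definition \<omega> :: complex where "\<omega> = Complex (- 1 / 2) (sqrt 3 / 2)"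

lemma omega_simps [simp]: "Re \<omega> = - 1 / 2" "Im \<omega> = sqrt 3 / 2"
  by (simp_all add: \<omega>_def)

lemma norm_omega [simp]: "norm \<omega> = 1"
  by (simp add: cmod_def power_divide)

text \<open>Three times a discrete Fourier coefficient at a nontrivial character. It annihilates
  constants and recovers \<open>c\<close> from the components \<open>jcomp\<close>, see
  \<open>tri_jcomp\<close>.\<close>

definition tri :: "real \<Rightarrow> real \<Rightarrow> real \<Rightarrow> complex" where
  "tri a b c = of_real a + cnj \<omega> * of_real b + \<omega> * of_real c"

lemma tri_Re_Im: "Re (tri a b c) = a - b / 2 - c / 2" "Im (tri a b c) = sqrt 3 / 2 * (c - b)"
  by (simp_all add: tri_def algebra_simps)

lemma tri_diff: "tri a b c - tri a' b' c' = tri (a - a') (b - b') (c - c')"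
  by (simp add: tri_def algebra_simps)

lemma norm_tri_le: "norm (tri a b c) \<le> \<bar>a\<bar> + \<bar>b\<bar> + \<bar>c\<bar>"
proof -
  have "norm (tri a b c) \<le> norm (of_real a + cnj \<omega> * of_real b) + norm (\<omega> * of_real c)"
    unfolding tri_def by (rule norm_triangle_ineq)
  also have "norm (of_real a + cnj \<omega> * of_real b) \<le> norm (complex_of_real a) + norm (cnj \<omega> * of_real b)"
    by (rule norm_triangle_ineq)
  finally show ?thesis by (simp add: norm_mult)
qed

lemma norm_tri_sq: "(norm (tri a b c))\<^sup>2 = ((c - a)\<^sup>2 + (a - b)\<^sup>2 + (b - c)\<^sup>2) / 2"
  unfolding cmod_power2 tri_Re_Im power_mult_distrib
  by (simp add: power2_eq_square field_simps)

text \<open>The map sending logarithmic variables to \<open>c / m\<close>; it is the gradient of a log-sum-exp function.\<close>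

definition softtri :: "real \<Rightarrow> real \<Rightarrow> real \<Rightarrow> complex" where
  "softtri a b c = tri (exp a) (exp b) (exp c) / of_real (exp a + exp b + exp c)"

lemma softmax_le:
  fixes x x' S S' \<delta> :: real
  assumes "0 < x'" "0 < S" "0 < S'" "x \<le> exp \<delta> * x'" "S' \<le> exp \<delta> * S"
  shows "x / S \<le> exp (2 * \<delta>) * (x' / S')"
proof -
  have "x / S \<le> exp \<delta> * x' / S" using assms by (intro divide_right_mono) auto
  also have "\<dots> \<le> exp \<delta> * x' * (exp \<delta> / S')"
    unfolding divide_inverse[of _ S] using assms
    by (intro mult_left_mono) (simp_all add: field_simps)
  also have "\<dots> = exp (2 * \<delta>) * (x' / S')" by (simp add: exp_double power2_eq_square)
  finally show ?thesis .
qed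

text \<open>A softmax weight changes by a factor of at most \<open>exp (2 * \<delta>)\<close>,
  numerator and normalisation contributing \<open>exp \<delta>\<close> each. The weights sum to 1,
  so the total change is at most \<open>exp (2 * \<delta>) - 1\<close>. The bound 2 is the l1
  distance of two probability vectors, and it also settles the first claim for large
  \<open>\<delta>\<close>.\<close>

lemma softtri_lipschitz:
  assumes "\<bar>a - a'\<bar> \<le> \<delta>" "\<bar>b - b'\<bar> \<le> \<delta>" "\<bar>c - c'\<bar> \<le> \<delta>"
  shows "norm (softtri a b c - softtri a' b' c') \<le> 4 * \<delta>" "norm (softtri a b c - softtri a' b' c') \<le> 2"
proof -
  define S where "S = exp a + exp b + exp c"
  define S' where "S' = exp a' + exp b' + exp c'"
  have pos: "S > 0" "S' > 0" by (auto simp: S_def S'_def intro!: add_pos_pos)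
  have d0: "\<delta> \<ge> 0" using assms(1) by linarith
  have ex: "exp x \<le> exp \<delta> * exp x'" if "\<bar>x - x'\<bar> \<le> \<delta>" for x x' :: real
    unfolding exp_add[symmetric] using that by simp
  have S: "S \<le> exp \<delta> * S'" "S' \<le> exp \<delta> * S"
    unfolding S_def S'_def distrib_left using assms by (auto intro!: add_mono ex simp: abs_minus_commute)
  define p where "p x = exp x / S" for x
  define p' where "p' x = exp x / S'" for x
  have diff: "\<bar>p x - p' x'\<bar> \<le> (exp (2 * \<delta>) - 1) * p' x'" if d: "\<bar>x - x'\<bar> \<le> \<delta>" for x x'
  proof -
    have 1: "p x \<le> exp (2 * \<delta>) * p' x'"
      unfolding p_def p'_def using pos S ex[OF d] by (intro softmax_le) auto
    have "p' x' \<le> exp (2 * \<delta>) * p x"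
      unfolding p_def p'_def using pos S ex[of x' x] d by (intro softmax_le) (auto simp: abs_minus_commute)
    then have 2: "exp (- (2 * \<delta>)) * p' x' \<le> p x"
      by (simp add: exp_minus field_simps)
    have p0: "p' x' \<ge> 0" using pos by (simp add: p'_def)
    \<comment> \<open>This says
      \<open>1 - exp (- (2 * \<delta>)) \<le> exp (2 * \<delta>) - 1\<close>, which puts downward
      changes under the same bound as upward ones.\<close>
    have "2 \<le> exp (2 * \<delta>) + exp (- (2 * \<delta>))"
      using exp_ge_add_one_self[of "2 * \<delta>"] exp_ge_add_one_self[of "- (2 * \<delta>)"] by linarith
    then have "2 * p' x' \<le> (exp (2 * \<delta>) + exp (- (2 * \<delta>))) * p' x'" by (intro mult_right_mono p0)
    then have 3: "p' x' - exp (- (2 * \<delta>)) * p' x' \<le> (exp (2 * \<delta>) - 1) * p' x'" by (simp add: algebra_simps)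
    show ?thesis using 1 2 3 by (simp add: algebra_simps abs_le_iff)
  qed
  have sums: "p a + p b + p c = 1" "p' a' + p' b' + p' c' = 1"
    using pos by (simp_all add: p_def p'_def S_def S'_def flip: add_divide_distrib)
  have nonneg: "p x \<ge> 0" "p' x \<ge> 0" for x using pos by (simp_all add: p_def p'_def)
  have eq: "softtri a b c - softtri a' b' c' = tri (p a - p' a') (p b - p' b') (p c - p' c')"
    unfolding tri_diff[symmetric]
    by (simp add: softtri_def tri_def p_def p'_def S_def S'_def add_divide_distrib)
  have le: "norm (softtri a b c - softtri a' b' c') \<le> \<bar>p a - p' a'\<bar> + \<bar>p b - p' b'\<bar> + \<bar>p c - p' c'\<bar>"
    unfolding eq by (rule norm_tri_le)
  have "\<bar>p a - p' a'\<bar> + \<bar>p b - p' b'\<bar> + \<bar>p c - p' c'\<bar> \<le> p a + p' a' + (p b + p' b') + (p c + p' c')"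
    by (intro add_mono) (use nonneg in \<open>simp_all add: abs_le_iff\<close>)
  then show two: "norm (softtri a b c - softtri a' b' c') \<le> 2" using le sums by linarith
  have "\<bar>p a - p' a'\<bar> + \<bar>p b - p' b'\<bar> + \<bar>p c - p' c'\<bar> \<le> (exp (2 * \<delta>) - 1) * p' a' + (exp (2 * \<delta>) - 1) * p' b' + (exp (2 * \<delta>) - 1) * p' c'"
    by (intro add_mono diff assms)
  also have "\<dots> = (exp (2 * \<delta>) - 1) * (p' a' + p' b' + p' c')" by (simp add: algebra_simps)
  finally have e: "norm (softtri a b c - softtri a' b' c') \<le> exp (2 * \<delta>) - 1" using le sums by simp
  show "norm (softtri a b c - softtri a' b' c') \<le> 4 * \<delta>"
  proof (cases "\<delta> \<le> 1 / 2")
    case True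
    have "exp (2 * \<delta>) \<le> 1 + 2 * \<delta> + (2 * \<delta>)\<^sup>2" using True d0 by (intro exp_bound) auto
    moreover have "(2 * \<delta>)\<^sup>2 \<le> 2 * \<delta>"
      using mult_right_mono[of "2 * \<delta>" 1 "2 * \<delta>"] True d0 by (simp add: power2_eq_square)
    ultimately show ?thesis using e by linarith
  qed (use two in simp)
qed

text \<open>First-zero argument. All components are positive near minus infinity. Let
  \<open>b\<close> be the first point where some component \<open>j0\<close> fails to be positive;
  up to \<open>b\<close> the coupling to \<open>pr j0\<close> is nonnegative, so \<open>j0\<close>
  times an integrating factor has been nondecreasing and cannot have lost its positivity.\<close>

lemma positivity:
  fixes f :: "nat \<Rightarrow> real \<Rightarrow> real"
  assumes d: "\<And>j x. j < 3 \<Longrightarrow> (f j has_real_derivative (k * f (pr j) x - (k + v j x) * f j x)) (at x)"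
    and pr: "\<And>j. j < 3 \<Longrightarrow> pr j < 3" and k: "k > 0" and v: "\<And>j. j < 3 \<Longrightarrow> cdec (v j)"
    and lim: "\<And>j. j < 3 \<Longrightarrow> (f j \<longlongrightarrow> 1) at_bot" and i: "i < 3"
  shows "f i x > 0"
proof (rule ccontr)
  assume neg: "\<not> f i x > 0"
  have cont: "continuous_on A (f j)" if "j < 3" for j A
    using d[OF that] by (meson DERIV_isCont continuous_at_imp_continuous_on)
  have "eventually (\<lambda>y. \<forall>j\<in>{..<3}. f j y > 0) at_bot"
    by (intro eventually_ball_finite ballI order_tendstoD(1)[OF lim]) auto
  then obtain N where N: "\<And>y j. y \<le> N \<Longrightarrow> j < 3 \<Longrightarrow> f j y > 0" by (auto simp: eventually_at_bot_linorder)
  define a where "a = min N x"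
  have a: "a \<le> x" "\<And>y j. y \<le> a \<Longrightarrow> j < 3 \<Longrightarrow> f j y > 0" using N by (auto simp: a_def)
  define B where "B = (\<Union>j\<in>{..<3}. {y\<in>{a..x}. f j y \<in> {..0}})"
  have "closed B" unfolding B_def
    by (intro closed_UN ballI continuous_closed_preimage[unfolded vimage_def Collect_conj_eq[symmetric] Int_def mem_Collect_eq] cont) auto
  moreover have "B \<noteq> {}" using neg i a(1) by (force simp: B_def)
  moreover have bdd: "bdd_below B" by (rule bdd_belowI[of _ a]) (auto simp: B_def)
  ultimately have "Inf B \<in> B" by (intro closed_contains_Inf)
  define b where "b = Inf B"
  have b: "b \<in> B" using \<open>Inf B \<in> B\<close> by (simp add: b_def)
  then obtain j0 where j0: "j0 < 3" "f j0 b \<le> 0" "a \<le> b" "b \<le> x" by (auto simp: B_def)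
  have before: "f j y > 0" if "a \<le> y" "y < b" "j < 3" for y j
  proof (rule ccontr)
    assume "\<not> f j y > 0"
    then have "y \<in> B" using that j0(4) by (force simp: B_def)
    then show False using cInf_lower[OF _ bdd] that(2) b_def by (meson not_le)
  qed
  have ab: "a < b" using a(2)[of b j0] j0 by (cases "b \<le> a") auto
  \<comment> \<open>The integrating factor that removes the diagonal coefficient
    \<open>k + v j0\<close>.\<close>
  define e where "e y = exp (k * y + J (v j0) y)" for y
  have de: "(e has_real_derivative (k + v j0 y) * e y) (at y)" for y
  proof -
    have "(J (v j0) has_real_derivative v j0 y) (at y)"
      using J_deriv[OF v[OF j0(1)]] by (simp add: has_real_derivative_iff_has_vector_derivative)
    then show ?thesis unfolding e_def[abs_def] by (auto intro!: derivative_eq_intros)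
  qed
  have def: "((\<lambda>y. e y * f j0 y) has_real_derivative e y * k * f (pr j0) y) (at y)" for y
    using DERIV_mult[OF de d[OF j0(1)], of y] by (simp add: algebra_simps)
  have "e a * f j0 a \<le> e b * f j0 b"
  proof (rule DERIV_nonneg_imp_increasing_open[OF less_imp_le[OF ab]])
    fix y assume y: "a < y" "y < b"
    have "e y * k * f (pr j0) y \<ge> 0"
      using before[of y "pr j0"] y pr[OF j0(1)] k by (simp add: e_def less_imp_le)
    then show "\<exists>D. ((\<lambda>y. e y * f j0 y) has_real_derivative D) (at y) \<and> 0 \<le> D" using def by blast
  qed (use def in \<open>meson DERIV_isCont continuous_at_imp_continuous_on\<close>)
  moreover have "e a * f j0 a > 0" using a(2)[of a j0] j0(1) by (simp add: e_def)
  moreover have "e b * f j0 b \<le> 0" using j0(2) by (simp add: e_def mult_le_0_iff)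
  ultimately show False by linarith
qed

definition root3 :: "nat \<Rightarrow> complex" where
  "root3 j = (if j = 0 then 1 else if j = 1 then \<omega> else cnj \<omega>)"

definition jcomp :: "nat \<Rightarrow> real \<Rightarrow> complex \<Rightarrow> real" where
  "jcomp j m c = m + 2 * Re (root3 j * c)"

lemma jcomp_simps:
  "jcomp 0 m c = m + 2 * Re c" "jcomp 1 m c = m - Re c - sqrt 3 * Im c"
  "jcomp (Suc 0) m c = m - Re c - sqrt 3 * Im c" "jcomp 2 m c = m - Re c + sqrt 3 * Im c"
  by (simp_all add: jcomp_def root3_def)

lemma jcomp_bound: "\<bar>jcomp j m c - m\<bar> \<le> 2 * norm c"
proof -
  have "norm (root3 j) = 1" by (simp add: root3_def)
  then show ?thesis using abs_Re_le_cmod[of "root3 j * c"] by (simp add: jcomp_def norm_mult)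
qed

text \<open>\<open>(j + 2) mod 3\<close> is the cyclic predecessor written without subtraction on
  naturals, and \<open>jcomp j 0 q\<close> is the potential \<open>2 Re (\<omega>^j q)\<close> of
  the component.\<close>

lemma jcomp_deriv:
  assumes "(m has_vector_derivative (- 2 * Re (q * cnj (c x)))) (at x)"
    "(c has_vector_derivative (of_real k * \<beta> * c x + - (q * of_real (m x) + cnj q * cnj (c x)))) (at x)"
    and j: "j < 3"
  shows "((\<lambda>x. jcomp j (m x) (c x)) has_real_derivative
    (k * jcomp ((j + 2) mod 3) (m x) (c x) - (k + jcomp j 0 q) * jcomp j (m x) (c x))) (at x)"
proof -
  have m: "(m has_real_derivative (- 2 * (Re q * Re (c x) + Im q * Im (c x)))) (at x)"
    using assms(1) by (simp add: has_real_derivative_iff_has_vector_derivative)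
  have c: "((\<lambda>x. Re (c x)) has_real_derivative
      (k * (- 3 / 2 * Re (c x) + sqrt 3 / 2 * Im (c x)) - (Re q * m x + Re q * Re (c x) - Im q * Im (c x)))) (at x)"
     "((\<lambda>x. Im (c x)) has_real_derivative
      (k * (- 3 / 2 * Im (c x) - sqrt 3 / 2 * Re (c x)) - (Im q * m x - Re q * Im (c x) - Im q * Re (c x)))) (at x)"
    using assms(2) unfolding has_vector_derivative_complex_iff
    by (auto simp: algebra_simps)
  have s: "sqrt 3 * (sqrt 3 * r) = 3 * r" for r by (simp flip: mult.assoc)
  have e: "j = 0 \<or> j = 1 \<or> j = 2" using j by linarith
  have 0: "((\<lambda>x. m x + (2 * Re (c x))) has_real_derivative
      (k * jcomp 2 (m x) (c x) - (k + jcomp 0 0 q) * jcomp 0 (m x) (c x))) (at x)"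
    by (rule DERIV_cong[OF DERIV_add[OF m DERIV_cmult[OF c(1)]]]) (simp add: jcomp_simps algebra_simps s)
  have 1: "((\<lambda>x. m x - Re (c x) - sqrt 3 * Im (c x)) has_real_derivative
      (k * jcomp 0 (m x) (c x) - (k + jcomp 1 0 q) * jcomp 1 (m x) (c x))) (at x)"
    by (rule DERIV_cong[OF DERIV_diff[OF DERIV_diff[OF m c(1)] DERIV_cmult[OF c(2)]]]) (simp add: jcomp_simps algebra_simps s)
  have 2: "((\<lambda>x. m x - Re (c x) + sqrt 3 * Im (c x)) has_real_derivative
      (k * jcomp 1 (m x) (c x) - (k + jcomp 2 0 q) * jcomp 2 (m x) (c x))) (at x)"
    by (rule DERIV_cong[OF DERIV_add[OF DERIV_diff[OF m c(1)] DERIV_cmult[OF c(2)]]]) (simp add: jcomp_simps algebra_simps s)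
  have i: "(0 + 2) mod 3 = (2::nat)" "(1 + 2) mod 3 = (0::nat)" "(2 + 2) mod 3 = (1::nat)" by simp_all
  have f: "(\<lambda>x. jcomp 0 (m x) (c x)) = (\<lambda>x. m x + 2 * Re (c x))"
    "(\<lambda>x. jcomp 1 (m x) (c x)) = (\<lambda>x. m x - Re (c x) - sqrt 3 * Im (c x))"
    "(\<lambda>x. jcomp 2 (m x) (c x)) = (\<lambda>x. m x - Re (c x) + sqrt 3 * Im (c x))"
    by (simp_all only: jcomp_simps)
  show ?thesis using e 0[folded f] 1[folded f] 2[folded f] i by (elim disjE) (simp_all only:)
qed

lemma jcomp_sum: "jcomp 0 m c + jcomp 1 m c + jcomp 2 m c = 3 * m" by (simp add: jcomp_simps)

lemma tri_jcomp: "tri (jcomp 0 m c) (jcomp 1 m c) (jcomp 2 m c) = 3 * c"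
proof -
  have s: "sqrt 3 * (sqrt 3 * r) = 3 * r" for r by (simp flip: mult.assoc)
  show ?thesis by (simp add: complex_eq_iff tri_Re_Im jcomp_simps s) (simp add: field_simps s)
qed

lemma cdec_jcomp: "cdec q \<Longrightarrow> cdec (\<lambda>x. jcomp j 0 (q x))"
  by (rule cdecI[of _ q 2]) (use jcomp_bound[of j 0] cdec_cont[of q UNIV] in \<open>auto simp: jcomp_def intro!: continuous_intros\<close>)

lemma DERIV_fun_ln:
  assumes "(f has_real_derivative D) (at x)" "f x > 0"
  shows "((\<lambda>x. ln (f x)) has_real_derivative D / f x) (at x)"
  using assms by (auto intro!: derivative_eq_intros)

lemma abs_ln_diff_le:
  fixes a b e :: real
  assumes "e > 0" "a \<ge> e" "b \<ge> e"
  shows "\<bar>ln a - ln b\<bar> \<le> \<bar>a - b\<bar> / e"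
proof -
  have *: "ln x - ln y \<le> \<bar>x - y\<bar> / e" if "x \<ge> e" "y \<ge> e" for x y
  proof -
    have xy: "x > 0" "y > 0" using that assms by auto
    have "ln x - ln y \<le> (x - y) / y" by (rule ln_diff_le[OF xy])
    also have "\<dots> \<le> \<bar>x - y\<bar> / y" using xy by (intro divide_right_mono) auto
    also have "\<dots> \<le> \<bar>x - y\<bar> / e" using that assms by (intro divide_left_mono) auto
    finally show ?thesis .
  qed
  show ?thesis using *[of a b] *[of b a] assms by (auto simp: abs_le_iff abs_minus_commute)
qed

text \<open>The two expressions for \<open>ln A\<close> come from different averages:
  \<open>k\<close> times the integral of \<open>\<rho>\<close> from the mean of the logarithms of
  the components, and the pairing with \<open>y = c / m\<close> from the logarithm of their mean
  \<open>m\<close>. The two have the same limits at both ends.\<close>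

theorem jost_structure:
  assumes k: "k > 0" and q: "cdec q" and j: "jost k q m c"
  obtains A w y n \<rho> where
    "(m \<longlongrightarrow> A) at_top" "A \<ge> 1" "cdec w" "cdec y" "cdec n" "cdec \<rho>" "\<And>x. \<rho> x \<ge> 0"
    "k * (LINT x|lborel. \<rho> x) = ln A"
    "\<And>x. (w has_vector_derivative (of_real k * \<beta> * w x - q x + of_real k * n x)) (at x)"
    "\<And>x. norm (n x) \<le> \<rho> x" "\<And>x. (norm (w x))\<^sup>2 \<le> \<rho> x"
    "\<And>x. norm (y x) \<le> 8 * norm (w x)" "\<And>x x'. norm (y x - y x') \<le> 2" "\<And>x x'. norm (y x - y x') \<le> 8 * norm (w x - w x')"
    "ln A = - 2 * (LINT x|lborel. Re (q x * cnj (y x)))"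
proof -
  have j': "\<And>x. (m has_vector_derivative (- 2 * Re (q x * cnj (c x)))) (at x)"
    "\<And>x. (c has_vector_derivative (of_real k * \<beta> * c x + - (q x * of_real (m x) + cnj (q x) * cnj (c x)))) (at x)"
    "(m \<longlongrightarrow> 1) at_bot" "bounded (range m)" "cdec c"
    using j unfolding jost_def by auto
  define f where "f j x = jcomp j (m x) (c x)" for j x
  define v where "v j x = jcomp j 0 (q x)" for j x
  have fd: "(f j has_real_derivative (k * f ((j + 2) mod 3) x - (k + v j x) * f j x)) (at x)" if "j < 3" for j x
    unfolding f_def[abs_def] v_def by (rule jcomp_deriv[OF j'(1,2) that])
  have clim: "(c \<longlongrightarrow> 0) at_bot" "(c \<longlongrightarrow> 0) at_top" using cdec_tendsto_0[OF j'(5)] by auto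
  have jcomp_lim: "((\<lambda>x. jcomp j (m x) (c x)) \<longlongrightarrow> a) F" if "(m \<longlongrightarrow> a) F" "(c \<longlongrightarrow> 0) F" for a F j
  proof -
    have "((\<lambda>x. jcomp j (m x) (c x)) \<longlongrightarrow> a + 2 * Re (root3 j * 0)) F"
      unfolding jcomp_def by (intro tendsto_intros that)
    then show ?thesis by simp
  qed
  have fpos: "f j x > 0" if "j < 3" for j x
    by (rule positivity[where f=f and k=k and v=v and pr="\<lambda>j. (j + 2) mod 3", OF fd _ k _ _ that])
       (auto simp: v_def[abs_def] f_def[abs_def] intro!: cdec_jcomp q jcomp_lim j' clim)
  obtain M where M: "\<And>x. m x \<le> M" "M \<ge> 1"
  proof -
    obtain M where "\<And>x. norm (m x) \<le> M" using j'(4) by (auto simp: bounded_iff)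
    then have "m x \<le> max M 1" for x using abs_le_D1[of "m x" M] by (simp add: le_max_iff_disj)
    then show ?thesis using that[of "max M 1"] by simp
  qed
  have fsum: "f 0 x + f 1 x + f 2 x = 3 * m x" for x unfolding f_def by (rule jcomp_sum)
  have fp: "f 0 x > 0" "f 1 x > 0" "f 2 x > 0" for x using fpos by simp_all
  define l where "l j x = ln (f j x)" for j x
  have ld: "(l j has_real_derivative (k * (f ((j + 2) mod 3) x / f j x) - (k + v j x))) (at x)" if "j < 3" for j x
    unfolding l_def[abs_def]
    by (rule DERIV_cong[OF DERIV_fun_ln[OF fd[OF that] fpos[OF that]]])
       (use fpos[OF that, of x] in \<open>simp add: diff_divide_distrib\<close>)
  have el: "exp (l j x) = f j x" if "j < 3" for j x using fpos[OF that] by (simp add: l_def)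
  \<comment> \<open>Logarithms of the ratios of cyclic neighbours, predecessor over component; their
    sum is 0.\<close>
  define d0 where "d0 x = l 2 x - l 0 x" for x
  define d1 where "d1 x = l 0 x - l 1 x" for x
  define d2 where "d2 x = l 1 x - l 2 x" for x
  have ed: "exp (d0 x) = f 2 x / f 0 x" "exp (d1 x) = f 0 x / f 1 x" "exp (d2 x) = f 1 x / f 2 x" for x
    unfolding d0_def d1_def d2_def exp_diff by (simp_all add: el)
  have dsum: "d0 x + d1 x + d2 x = 0" for x by (simp add: d0_def d1_def d2_def)
  \<comment> \<open>Because the \<open>d\<close>s sum to 0, the linear parts of
    \<open>excess\<close> drop out and \<open>\<rho>\<close> is the mean ratio minus 1. The
    potentials \<open>v\<close> sum to 0 too, so \<open>k * \<rho>\<close> is exactly the derivative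
    of the mean logarithm \<open>L\<close>.\<close>
  define \<rho> where "\<rho> x = (excess (d0 x) + excess (d1 x) + excess (d2 x)) / 3" for x
  have \<rho>0: "\<rho> x \<ge> 0" for x using excess_nonneg[of "d0 x"] excess_nonneg[of "d1 x"] excess_nonneg[of "d2 x"] by (simp add: \<rho>_def)
  have \<rho>': "\<rho> x = (f 2 x / f 0 x + f 0 x / f 1 x + f 1 x / f 2 x) / 3 - 1" for x
    using dsum[of x] unfolding \<rho>_def excess_def ed[symmetric] by argo
  have vsum: "v 0 x + v 1 x + v 2 x = 0" for x using jcomp_sum[of 0 "q x"] by (simp add: v_def)
  define L where "L x = (l 0 x + l 1 x + l 2 x) / 3" for x
  have Ld: "(L has_real_derivative k * \<rho> x) (at x)" for x
    unfolding L_def[abs_def]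
  proof (rule DERIV_cong[OF DERIV_cdivide[OF DERIV_add[OF DERIV_add[OF ld[of 0] ld[of 1]] ld[of 2]]]])
    have mean: "(k * e0 - (k + v0) + (k * e1 - (k + v1)) + (k * e2 - (k + v2))) / 3 = k * ((e0 + e1 + e2) / 3 - 1)"
      if "v0 + v1 + v2 = 0" for e0 e1 e2 v0 v1 v2
    proof -
      have v2: "v2 = - v0 - v1" using that by simp
      show ?thesis unfolding v2 by (simp add: field_simps)
    qed
    have i: "(0 + 2) mod 3 = (2::nat)" "(1 + 2) mod 3 = (0::nat)" "(2 + 2) mod 3 = (1::nat)" by simp_all
    show "(k * (f ((0 + 2) mod 3) x / f 0 x) - (k + v 0 x) + (k * (f ((1 + 2) mod 3) x / f 1 x) - (k + v 1 x)) +
       (k * (f ((2 + 2) mod 3) x / f 2 x) - (k + v 2 x))) / 3 = k * \<rho> x"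
      unfolding i \<rho>' by (rule mean[OF vsum])
  qed simp_all
  have llim: "(l j \<longlongrightarrow> ln a) F" if "(m \<longlongrightarrow> a) F" "(c \<longlongrightarrow> 0) F" "a > 0" for a F j
    unfolding l_def[abs_def] f_def using that by (intro tendsto_ln jcomp_lim) auto
  have Llim: "(L \<longlongrightarrow> ln a) F" if "(m \<longlongrightarrow> a) F" "(c \<longlongrightarrow> 0) F" "a > 0" for a F
  proof -
    have "(L \<longlongrightarrow> (ln a + ln a + ln a) / 3) F" unfolding L_def[abs_def] by (intro tendsto_intros llim that) simp
    then show ?thesis by simp
  qed
  have Lbot: "(L \<longlongrightarrow> 0) at_bot" using Llim[OF j'(3) clim(1)] by simp
  have L0: "L x \<ge> 0" for x
  proof -
    have "L y \<le> L x" if "y \<le> x" for y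
      by (rule DERIV_nonneg_imp_nondecreasing[OF that]) (use Ld k \<rho>0 in \<open>meson less_imp_le mult_nonneg_nonneg\<close>)
    then have "eventually (\<lambda>y. L y \<le> L x) at_bot" by (auto simp: eventually_at_bot_linorder intro!: exI[of _ x])
    then show ?thesis by (intro tendsto_upperbound[OF Lbot]) (simp_all add: trivial_limit_at_bot_linorder)
  qed
  \<comment> \<open>Arithmetic against geometric mean: \<open>L x\<close> is the logarithm of the
    geometric mean of the components and \<open>m x\<close> is their arithmetic mean, so
    \<open>ln (m x) \<ge> L x \<ge> 0\<close>.\<close>
  have m1: "m x \<ge> 1" for x
  proof -
    have mp: "m x > 0" using fsum[of x] fp[of x] by linarith
    have "l j x - ln (m x) \<le> (f j x - m x) / m x" if "j < 3" for j
      unfolding l_def by (rule ln_diff_le[OF fpos[OF that] mp])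
    from this[of 0] this[of 1] this[of 2]
    have "l 0 x - ln (m x) + (l 1 x - ln (m x)) + (l 2 x - ln (m x)) \<le> (f 0 x - m x) / m x + (f 1 x - m x) / m x + (f 2 x - m x) / m x"
      by simp
    moreover have "3 * L x - 3 * ln (m x) = l 0 x - ln (m x) + (l 1 x - ln (m x)) + (l 2 x - ln (m x))" by (simp add: L_def)
    ultimately have "3 * L x - 3 * ln (m x) \<le> (f 0 x - m x) / m x + (f 1 x - m x) / m x + (f 2 x - m x) / m x"
      by (simp only:)
    also have "\<dots> = 0" using fsum[of x] unfolding add_divide_distrib[symmetric] by simp
    finally have "ln (m x) \<ge> 0" using L0[of x] by linarith
    then show ?thesis using mp by simp
  qed
  \<comment> \<open>The product of the components is \<open>exp (3 * L x) \<ge> 1\<close> and each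
    is at most \<open>3 * M\<close>, so each is at least \<open>1 / (9 * M^2)\<close>. This bound
    depends on the solution and enters only qualitative decay statements, never the
    estimates.\<close>
  define \<epsilon> where "\<epsilon> = 1 / (9 * M\<^sup>2)"
  have \<epsilon>: "\<epsilon> > 0" "\<epsilon> \<le> 1" using M(2)
  proof -
    have "1 \<le> M\<^sup>2" using M(2) by (rule one_le_power)
    then have "1 \<le> 9 * M\<^sup>2" by linarith
    then show "\<epsilon> > 0" "\<epsilon> \<le> 1" using M(2) by (simp_all add: \<epsilon>_def divide_le_eq)
  qed
  have flow: "f j x \<ge> \<epsilon>" if "j < 3" for j x
  proof -
    have le: "f i x \<le> 3 * M" if "i < 3" for i
    proof -
      have "i = 0 \<or> i = 1 \<or> i = 2" using that by linarith
      moreover have "f 0 x \<le> 3 * M" "f 1 x \<le> 3 * M" "f 2 x \<le> 3 * M"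
        using fsum[of x] fp[of x] M(1)[of x] by linarith+
      ultimately show ?thesis by auto
    qed
    have "1 \<le> exp (3 * L x)" using L0[of x] by simp
    also have "3 * L x = l 0 x + l 1 x + l 2 x" by (simp add: L_def)
    also have "exp (l 0 x + l 1 x + l 2 x) = f 0 x * f 1 x * f 2 x" by (simp add: exp_add el)
    finally have p: "1 \<le> f 0 x * f 1 x * f 2 x" .
    have b: "a * b * e \<ge> 1 \<Longrightarrow> a \<ge> \<epsilon>" if "a > 0" "b > 0" "b \<le> 3 * M" "e > 0" "e \<le> 3 * M" for a b e
    proof -
      assume 1: "a * b * e \<ge> 1"
      have "b * e \<le> (3 * M) * (3 * M)" using that by (intro mult_mono) auto
      then have "a * (b * e) \<le> a * (9 * M\<^sup>2)" using that by (intro mult_left_mono) (auto simp: power2_eq_square)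
      then have "1 \<le> a * (9 * M\<^sup>2)" using 1 by (simp only: mult.assoc)
      then show "a \<ge> \<epsilon>" using M(2) by (simp add: \<epsilon>_def divide_le_eq)
    qed
    have "j = 0 \<or> j = 1 \<or> j = 2" using that by linarith
    then show ?thesis
      using b[of "f 0 x" "f 1 x" "f 2 x"] b[of "f 1 x" "f 0 x" "f 2 x"] b[of "f 2 x" "f 0 x" "f 1 x"] p
        fp[of x] le[of 0] le[of 1] le[of 2] by (auto simp: mult_ac)
  qed
  have fm: "\<bar>f j x - m x\<bar> \<le> 2 * norm (c x)" for j x unfolding f_def by (rule jcomp_bound)
  have lm: "\<bar>l j x - ln (m x)\<bar> \<le> 2 * norm (c x) / \<epsilon>" if "j < 3" for j x
  proof -
    have "\<epsilon> \<le> m x" using m1[of x] \<epsilon> by linarith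
    then have "\<bar>l j x - ln (m x)\<bar> \<le> \<bar>f j x - m x\<bar> / \<epsilon>"
      unfolding l_def by (intro abs_ln_diff_le \<epsilon> flow that)
    also have "\<dots> \<le> 2 * norm (c x) / \<epsilon>" using \<epsilon> by (intro divide_right_mono fm) simp
    finally show ?thesis .
  qed
  have lcont: "continuous_on UNIV (l j)" if "j < 3" for j
    using ld[OF that] by (meson DERIV_isCont continuous_at_imp_continuous_on)
  have fcont: "continuous_on UNIV (f j)" if "j < 3" for j
    using fd[OF that] by (meson DERIV_isCont continuous_at_imp_continuous_on)
  have mcont: "continuous_on UNIV m"
    using j'(1) by (meson has_vector_derivative_continuous continuous_at_imp_continuous_on)
  define w where "w x = tri (l 0 x) (l 1 x) (l 2 x) / 3" for x
  define n where "n x = tri (excess (d0 x)) (excess (d1 x)) (excess (d2 x)) / 3" for x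
  define y where "y x = c x / of_real (m x)" for x
  have excont: "continuous_on UNIV (\<lambda>x. excess (d x))" if "continuous_on UNIV d" for d :: "real \<Rightarrow> real"
    unfolding excess_def by (intro continuous_intros that)
  have dcont: "continuous_on UNIV d0" "continuous_on UNIV d1" "continuous_on UNIV d2"
    unfolding d0_def[abs_def] d1_def[abs_def] d2_def[abs_def] by (intro continuous_intros lcont; simp)+
  have \<rho>c: "cdec \<rho>"
  proof (rule cdecI[OF _ j'(5)])
    show "continuous_on UNIV \<rho>" unfolding \<rho>_def[abs_def] by (intro continuous_intros excont dcont) simp
    have b: "f i x / f j x - 1 \<le> 4 * norm (c x) / \<epsilon>" if "j < 3" for i j x
    proof -
      have "f i x / f j x - 1 = (f i x - f j x) / f j x" using fpos[OF that, of x] by (simp add: diff_divide_distrib)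
      also have "\<dots> \<le> (4 * norm (c x)) / f j x" using fpos[OF that, of x] fm[of i x] fm[of j x] by (intro divide_right_mono) auto
      also have "\<dots> \<le> 4 * norm (c x) / \<epsilon>" using fpos[OF that, of x] flow[OF that, of x] \<epsilon> by (intro divide_left_mono) auto
      finally show ?thesis .
    qed
    show "norm (\<rho> x) \<le> 4 / \<epsilon> * norm (c x)" for x
    proof -
      have "\<rho> x \<le> 4 * norm (c x) / \<epsilon>"
      proof -
        have "f 2 x / f 0 x - 1 \<le> 4 * norm (c x) / \<epsilon>" "f 0 x / f 1 x - 1 \<le> 4 * norm (c x) / \<epsilon>"
          "f 1 x / f 2 x - 1 \<le> 4 * norm (c x) / \<epsilon>" by (rule b, simp)+
        then show ?thesis unfolding \<rho>' by argo
      qed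
      then show ?thesis using \<rho>0[of x] by simp
    qed
  qed
  have nb: "norm (n x) \<le> \<rho> x" for x
    using norm_tri_le[of "excess (d0 x)" "excess (d1 x)" "excess (d2 x)"]
    by (simp add: n_def \<rho>_def norm_divide excess_nonneg)
  have tricont: "continuous_on UNIV (\<lambda>x. tri (a x) (b x) (e x))" if "continuous_on UNIV a" "continuous_on UNIV b" "continuous_on UNIV e" for a b e :: "real \<Rightarrow> real"
    unfolding tri_def by (intro continuous_intros that)
  have nc: "cdec n"
    by (rule cdecI[OF _ \<rho>c, where K=1]) (use nb \<rho>0 in \<open>auto simp: n_def[abs_def] intro!: continuous_intros tricont excont dcont\<close>)
  have triconst: "tri a a a = 0" for a by (simp add: complex_eq_iff tri_Re_Im)
  have wc: "cdec w"
  proof (rule cdecI[OF _ j'(5)])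
    show "continuous_on UNIV w" unfolding w_def[abs_def] by (intro continuous_intros tricont lcont) auto
    fix x
    have "tri (l 0 x) (l 1 x) (l 2 x) = tri (l 0 x - ln (m x)) (l 1 x - ln (m x)) (l 2 x - ln (m x))"
      unfolding tri_diff[symmetric] triconst by simp
    then have "norm (w x) \<le> (\<bar>l 0 x - ln (m x)\<bar> + \<bar>l 1 x - ln (m x)\<bar> + \<bar>l 2 x - ln (m x)\<bar>) / 3"

      using norm_tri_le[of "l 0 x - ln (m x)" "l 1 x - ln (m x)" "l 2 x - ln (m x)"] by (simp add: w_def norm_divide)
    then show "norm (w x) \<le> 2 / \<epsilon> * norm (c x)" using lm[of 0 x] lm[of 1 x] lm[of 2 x] by simp
  qed
  have mn0: "m x \<noteq> 0" for x using m1[of x] by auto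
  have yc: "cdec y"
  proof (rule cdecI[OF _ j'(5), where K=1])
    show "continuous_on UNIV y" unfolding y_def[abs_def] using mn0 by (intro continuous_intros mcont cdec_cont j') auto
    show "norm (y x) \<le> 1 * norm (c x)" for x
    proof -
      have "norm (c x) * 1 \<le> norm (c x) * m x" by (intro mult_left_mono m1) simp
      then show ?thesis using m1[of x] by (simp add: y_def norm_divide divide_le_eq)
    qed
  qed
  \<comment> \<open>By \<open>norm_tri_sq\<close>, nine times the square of
    \<open>norm (w x)\<close> is half the sum of the squared differences, and
    \<open>excess_sum\<close> bounds that sum by \<open>18 * \<rho> x\<close>.\<close>
  have wsq: "(norm (w x))\<^sup>2 \<le> \<rho> x" for x
    using excess_sum[OF dsum[of x]]
    by (simp add: w_def norm_divide power_divide norm_tri_sq \<rho>_def d0_def d1_def d2_def)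
  have wd: "(w has_vector_derivative (of_real k * \<beta> * w x - q x + of_real k * n x)) (at x)" for x
  proof -
    have ld': "(l j has_real_derivative (k * (exp (d x)) - (k + v j x))) (at x)" if "j < 3" "exp (d x) = f ((j + 2) mod 3) x / f j x" for j d
      using ld[OF that(1), of x] that(2) by simp
    note l0 = ld'[of 0 d0] and l1 = ld'[of 1 d1] and l2 = ld'[of 2 d2]
    have tri_d: "((\<lambda>x. tri (a x) (b x) (e x)) has_vector_derivative tri a' b' e') (at x)"
      if "(a has_real_derivative a') (at x)" "(b has_real_derivative b') (at x)" "(e has_real_derivative e') (at x)" for a b e a' b' e'
      unfolding has_vector_derivative_complex_iff tri_Re_Im using that by (auto intro!: derivative_eq_intros)
    have "(w has_vector_derivative tri (k * exp (d0 x) - (k + v 0 x)) (k * exp (d1 x) - (k + v 1 x)) (k * exp (d2 x) - (k + v 2 x)) / 3) (at x)"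
      unfolding w_def[abs_def] by (intro has_vector_derivative_divide tri_d l0 l1 l2) (simp_all add: ed numeral_2_eq_2)
    moreover have "tri (k * exp (d0 x) - (k + v 0 x)) (k * exp (d1 x) - (k + v 1 x)) (k * exp (d2 x) - (k + v 2 x)) / 3
      = of_real k * \<beta> * w x - q x + of_real k * n x"
    proof -
      have s: "sqrt 3 * (sqrt 3 * r) = 3 * r" for r by (simp flip: mult.assoc)
      have vq: "tri (v 0 x) (v 1 x) (v 2 x) = 3 * q x" unfolding v_def by (rule tri_jcomp)
      \<comment> \<open>The cyclic shift multiplies the coefficient by \<open>cnj \<omega>\<close>,
        so shift minus identity multiplies it by \<open>\<beta>\<close>. The nonlinear remainder
        comes from \<open>exp d - 1 = d + excess d\<close> and gives \<open>n\<close>.\<close>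
      have bw: "of_real k * \<beta> * w x = of_real k * tri (d0 x) (d1 x) (d2 x) / 3"
        by (simp add: complex_eq_iff w_def tri_Re_Im d0_def d1_def d2_def s field_simps)
      have "tri (k * exp (d0 x) - (k + v 0 x)) (k * exp (d1 x) - (k + v 1 x)) (k * exp (d2 x) - (k + v 2 x))
        = of_real k * tri (d0 x) (d1 x) (d2 x) + of_real k * tri (excess (d0 x)) (excess (d1 x)) (excess (d2 x)) - tri (v 0 x) (v 1 x) (v 2 x)"
        by (simp add: complex_eq_iff tri_Re_Im excess_def field_simps)
      then show ?thesis unfolding vq bw n_def by (simp add: add_divide_distrib diff_divide_distrib)
    qed
    ultimately show ?thesis by (simp only:)
  qed
  have ysoft: "y x = softtri (l 0 x) (l 1 x) (l 2 x)" for x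
    unfolding softtri_def y_def using el[of 0 x] el[of 1 x] el[of 2 x] fsum[of x] tri_jcomp[of "m x" "c x"] by (simp add: f_def)
  have soft_shift: "softtri (a + t) (b + t) (e + t) = softtri a b e" for a b e t
  proof -
    have "tri (exp (a + t)) (exp (b + t)) (exp (e + t)) = of_real (exp t) * tri (exp a) (exp b) (exp e)"
      by (simp add: tri_def exp_add algebra_simps)
    moreover have "exp (a + t) + exp (b + t) + exp (e + t) = exp t * (exp a + exp b + exp e)"
      by (simp add: exp_add algebra_simps)
    ultimately show ?thesis by (simp add: softtri_def)
  qed
  \<comment> \<open>Inverse discrete Fourier transform: \<open>w\<close> sees everything but the
    mean \<open>L\<close>. Since \<open>softtri\<close> is unchanged by a common shift,
    \<open>y x\<close> is a function of \<open>w x\<close> alone, with Lipschitz constant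
    \<open>4 * 2\<close> by \<open>softtri_lipschitz\<close> and \<open>cb\<close>.\<close>
  have lw: "l j x = jcomp j 0 (w x) + L x" if "j < 3" for j x
  proof -
    have s: "sqrt 3 * (sqrt 3 * r) = 3 * r" for r by (simp flip: mult.assoc)
    have "j = 0 \<or> j = 1 \<or> j = 2" using that by linarith
    then show ?thesis by (auto simp: jcomp_simps w_def tri_Re_Im L_def s field_simps)
  qed
  have yw: "y x = softtri (jcomp 0 0 (w x)) (jcomp 1 0 (w x)) (jcomp 2 0 (w x))" for x
    unfolding ysoft using lw[of 0 x] lw[of 1 x] lw[of 2 x] soft_shift by simp
  have cb: "\<bar>jcomp j 0 a - jcomp j 0 b\<bar> \<le> 2 * norm (a - b)" for j a b
  proof -
    have "jcomp j 0 a - jcomp j 0 b = jcomp j 0 (a - b)" by (simp add: jcomp_def algebra_simps)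
    then show ?thesis using jcomp_bound[of j 0 "a - b"] by simp
  qed
  have y8: "norm (y x - y x') \<le> 8 * norm (w x - w x')" "norm (y x - y x') \<le> 2" for x x'
    unfolding yw using softtri_lipschitz[OF cb[of 0 "w x" "w x'"] cb[of 1 "w x" "w x'"] cb[of 2 "w x" "w x'"]] by simp_all
  have ywb: "norm (y x) \<le> 8 * norm (w x)" for x
  proof -
    have "softtri 0 0 0 = 0" by (simp add: softtri_def triconst)
    then show ?thesis unfolding yw using softtri_lipschitz(1)[OF cb[of 0 "w x" 0] cb[of 1 "w x" 0] cb[of 2 "w x" 0]] by (simp add: jcomp_simps)
  qed
  have cq: "cdec (\<lambda>x. - 2 * Re (q x * cnj (c x)))" "cdec (\<lambda>x. - 2 * Re (q x * cnj (y x)))"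
    by (intro cdec_cmult(1) cdec_Re cdec_mult q cdec_cnj j' yc)+
  have "(m \<longlongrightarrow> 1 + (LINT x|lborel. - 2 * Re (q x * cnj (c x)))) at_top"
    by (rule J_unique(2)[OF j'(1) cq(1) j'(3)])
  then obtain A where A: "(m \<longlongrightarrow> A) at_top" by blast
  have A1: "A \<ge> 1" by (rule tendsto_lowerbound[OF A]) (auto intro: always_eventually m1 simp: trivial_limit_at_top_linorder)
  have E1: "k * (LINT x|lborel. \<rho> x) = ln A"
  proof -
    have "(L \<longlongrightarrow> 0 + (LINT x|lborel. k * \<rho> x)) at_top"
      by (rule J_unique(2)[OF _ cdec_cmult(1)[OF \<rho>c] Lbot]) (use Ld in \<open>simp add: has_real_derivative_iff_has_vector_derivative\<close>)
    moreover have "(L \<longlongrightarrow> ln A) at_top" by (rule Llim[OF A clim(2)]) (use A1 in simp)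
    ultimately show ?thesis using tendsto_unique[OF trivial_limit_at_top_linorder] by fastforce
  qed
  have E2: "ln A = - 2 * (LINT x|lborel. Re (q x * cnj (y x)))"
  proof -
    have d: "((\<lambda>x. ln (m x)) has_vector_derivative - 2 * Re (q x * cnj (y x))) (at x)" for x
    proof -
      have "(m has_real_derivative - 2 * Re (q x * cnj (c x))) (at x)"
        using j'(1) by (simp add: has_real_derivative_iff_has_vector_derivative)
      from DERIV_fun_ln[OF this] m1[of x]
      have "((\<lambda>x. ln (m x)) has_real_derivative (- 2 * Re (q x * cnj (c x))) / m x) (at x)" by simp
      moreover have "(- 2 * Re (q x * cnj (c x))) / m x = - 2 * Re (q x * cnj (y x))"
        by (simp add: y_def add_divide_distrib diff_divide_distrib)
      ultimately show ?thesis by (simp only: has_real_derivative_iff_has_vector_derivative)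
    qed
    have "((\<lambda>x. ln (m x)) \<longlongrightarrow> ln 1) at_bot" by (intro tendsto_ln j') simp
    then have "((\<lambda>x. ln (m x)) \<longlongrightarrow> ln 1 + (LINT x|lborel. - 2 * Re (q x * cnj (y x)))) at_top"
      by (rule J_unique(2)[OF d cq(2)])
    moreover have "((\<lambda>x. ln (m x)) \<longlongrightarrow> ln A) at_top" by (intro tendsto_ln A) (use A1 in simp)
    ultimately have "ln A = ln 1 + (LINT x|lborel. - 2 * Re (q x * cnj (y x)))"
      using tendsto_unique[OF trivial_limit_at_top_linorder] by blast
    also have "\<dots> = - 2 * (LINT x|lborel. Re (q x * cnj (y x)))" by (subst integral_mult_right_zero) simp
    finally show ?thesis .
  qed
  show thesis
    by (rule that[OF A A1 wc yc nc \<rho>c \<rho>0 E1 wd nb wsq ywb y8(2) y8(1) E2])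
qed

section \<open>Conservation of the growth along the flow\<close>

lemma schwartz_deriv:
  assumes "schwartz f"
  shows "((vderiv ^^ n) f has_vector_derivative (vderiv ^^ Suc n) f x) (at x)"
proof -
  have "(vderiv ^^ n) f differentiable (at x)" using assms by (simp add: schwartz_def)
  then have "((vderiv ^^ n) f has_vector_derivative vector_derivative ((vderiv ^^ n) f) (at x)) (at x)"
    by (simp add: vector_derivative_works)
  then show ?thesis by (simp add: vderiv_def)
qed

lemma schwartz_cdec:
  assumes "schwartz f" shows "cdec ((vderiv ^^ n) f)"
proof -
  let ?g = "(vderiv ^^ n) f"
  have b: "bounded (range (\<lambda>x. x ^ m *\<^sub>R ?g x))" for m using assms by (simp add: schwartz_def)
  obtain C0 where C0: "\<And>x. norm (x ^ 0 *\<^sub>R ?g x) \<le> C0" using b[of 0] by (auto simp: bounded_iff)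
  obtain C2 where C2: "\<And>x. norm (x ^ 2 *\<^sub>R ?g x) \<le> C2" using b[of 2] by (auto simp: bounded_iff)
  have "norm (?g x) \<le> (C0 + C2) / (1 + x\<^sup>2)" for x
    using C0[of x] C2[of x] by (simp add: pos_le_divide_eq algebra_simps)
  moreover have "continuous_on UNIV ?g"
    by (intro continuous_at_imp_continuous_on ballI has_vector_derivative_continuous[OF schwartz_deriv[OF assms]])
  ultimately show ?thesis unfolding cdec_def by blast
qed

lemma schwartz_seminorm_bound:
  assumes "bounded (range (\<lambda>x. x ^ m *\<^sub>R r x))"
  shows "\<bar>x\<bar> ^ m * norm (r x) \<le> schwartz_seminorm m 0 r"
proof -
  have "bdd_above (range (\<lambda>x. \<bar>x\<bar> ^ m * norm (r x)))"
    using bounded_imp_bdd_above[OF bounded_norm_comp[THEN iffD2, OF assms]] by (simp add: power_abs)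
  then show ?thesis unfolding schwartz_seminorm_def by (intro cSUP_upper2[of _ _ x]) auto
qed

text \<open>The seminorms with weights 1 and \<open>x^2\<close> together give the decay
  \<open>1 / (1 + x^2)\<close>. The Taylor remainder of the flow thus has the form of the forcing in
  \<open>jost_system_stable\<close>.\<close>

lemma schwartz_derivative_uniform:
  assumes S: "\<And>t. schwartz (q t)" "schwartz g" and d: "has_schwartz_derivative q g t" and e: "e > 0"
  shows "\<exists>d>0. \<forall>h x. h \<noteq> 0 \<and> \<bar>h\<bar> < d \<longrightarrow> norm (q (t + h) x - q t x - of_real h * g x) \<le> \<bar>h\<bar> * e / (1 + x\<^sup>2)"
proof -
  define r where "r h x = (q (t + h) x - q t x) /\<^sub>R h - g x" for h x
  have bd: "bounded (range (\<lambda>x. x ^ m *\<^sub>R r h x))" for m h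
  proof -
    have b: "bounded (range (\<lambda>x. x ^ m *\<^sub>R f x))" if "schwartz f" for f
    proof -
      have "bounded (range (\<lambda>x. x ^ m *\<^sub>R (vderiv ^^ 0) f x))" using that unfolding schwartz_def by blast
      then show ?thesis by simp
    qed
    have eq: "(\<lambda>x. x ^ m *\<^sub>R r h x) = (\<lambda>x. inverse h *\<^sub>R (x ^ m *\<^sub>R q (t + h) x - x ^ m *\<^sub>R q t x) - x ^ m *\<^sub>R g x)"
      by (simp add: r_def fun_eq_iff algebra_simps)
    show ?thesis unfolding eq
      by (intro bounded_minus_comp bounded_scaleR_comp b S)
  qed
  have "\<forall>\<^sub>F h in at 0. schwartz_seminorm m 0 (r h) < e / 2" for m
    using d e unfolding has_schwartz_derivative_def r_def[symmetric] by (intro order_tendstoD(2)[of _ 0]) (auto simp: r_def[abs_def])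
  then have "\<forall>\<^sub>F h in at 0. schwartz_seminorm 0 0 (r h) < e / 2 \<and> schwartz_seminorm 2 0 (r h) < e / 2"
    by (intro eventually_conj)
  then obtain d where d: "d > 0" "\<And>h. h \<noteq> 0 \<Longrightarrow> \<bar>h\<bar> < d \<Longrightarrow> schwartz_seminorm 0 0 (r h) < e / 2 \<and> schwartz_seminorm 2 0 (r h) < e / 2"
    by (auto simp: eventually_at dist_real_def)
  have "norm (q (t + h) x - q t x - of_real h * g x) \<le> \<bar>h\<bar> * e / (1 + x\<^sup>2)" if h: "h \<noteq> 0" "\<bar>h\<bar> < d" for h x
  proof -
    have "norm (r h x) \<le> e / 2" "x\<^sup>2 * norm (r h x) \<le> e / 2"
      using schwartz_seminorm_bound[OF bd[of 0 h], of x] schwartz_seminorm_bound[OF bd[of 2 h], of x] d(2)[OF h] by auto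
    then have "norm (r h x) \<le> e / (1 + x\<^sup>2)" by (simp add: pos_le_divide_eq algebra_simps)
    then have "\<bar>h\<bar> * norm (r h x) \<le> \<bar>h\<bar> * (e / (1 + x\<^sup>2))" by (intro mult_left_mono) auto
    moreover have "q (t + h) x - q t x - of_real h * g x = of_real h * r h x"
    proof -
      have "of_real h * r h x = h *\<^sub>R r h x" by (simp add: scaleR_conv_of_real)
      also have "\<dots> = q (t + h) x - q t x - h *\<^sub>R g x" using h(1) by (simp add: r_def scaleR_diff_right)
      finally show ?thesis by (simp add: scaleR_conv_of_real)
    qed
    ultimately show ?thesis by (simp add: norm_mult)
  qed
  with d(1) show ?thesis by blast
qed

text \<open>The equation is stated with the pointwise time derivative. Here that derivative is
  identified with the one in the Schwartz topology, which has uniform remainder bounds, and the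
  equation is solved for it.\<close>

lemma schwartz_solutionD:
  assumes "schwartz_solution q"
  obtains g where "\<And>t. schwartz (q t)" "\<And>t. schwartz (g t)" "\<And>t. has_schwartz_derivative q (g t) t"
    "\<And>t x. g t x = \<i> / sqrt 3 * vderiv (vderiv (q t)) x - 2 * cnj (q t x) * cnj (vderiv (q t) x)"
proof -
  obtain D where D: "D 0 = q" "\<And>j t. schwartz (D j t)" "\<And>j t. has_schwartz_derivative (D j) (D (Suc j) t) t"
    using assms unfolding schwartz_solution_def smooth_schwartz_curve_def by blast
  define g where "g = D (Suc 0)"
  have g: "\<And>t. schwartz (q t)" "\<And>t. schwartz (g t)" "\<And>t. has_schwartz_derivative q (g t) t"
    using D(2)[of 0] D(2)[of "Suc 0"] D(3)[of 0] by (simp_all add: D(1) g_def)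
  have "g t x = \<i> / sqrt 3 * vderiv (vderiv (q t)) x - 2 * cnj (q t x) * cnj (vderiv (q t) x)" for t x
  proof -
    have "((\<lambda>\<tau>. q \<tau> x) has_vector_derivative g t x) (at t)"
      unfolding has_vector_derivative_def has_derivative_at
    proof (intro conjI bounded_linear_scaleR_left)
      have "((\<lambda>h. (q (t + h) x - q t x - h *\<^sub>R g t x) /\<^sub>R \<bar>h\<bar>) \<longlongrightarrow> 0) (at 0)"
      proof (rule tendstoI)
        fix e :: real assume e: "e > 0"
        obtain d where d: "d > 0" "\<And>h x. h \<noteq> 0 \<Longrightarrow> \<bar>h\<bar> < d \<Longrightarrow> norm (q (t + h) x - q t x - of_real h * g t x) \<le> \<bar>h\<bar> * (e/2) / (1 + x\<^sup>2)"
          using schwartz_derivative_uniform[OF g(1,2,3), of "e/2" t] e by auto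
        have "norm ((q (t + h) x - q t x - h *\<^sub>R g t x) /\<^sub>R \<bar>h\<bar>) < e" if h: "h \<noteq> 0" "\<bar>h\<bar> < d" for h
        proof -
          have "norm (q (t + h) x - q t x - of_real h * g t x) \<le> \<bar>h\<bar> * (e/2) / (1 + x\<^sup>2)" by (rule d(2)[OF h])
          also have "\<dots> \<le> \<bar>h\<bar> * (e/2) / 1" using e by (intro divide_left_mono) auto
          also have "\<dots> < \<bar>h\<bar> * e" using e h by simp
          finally show ?thesis using h by (simp add: scaleR_conv_of_real norm_mult norm_inverse inverse_eq_divide norm_divide pos_divide_less_eq mult.commute)
        qed
        then show "\<forall>\<^sub>F h in at 0. dist ((q (t + h) x - q t x - h *\<^sub>R g t x) /\<^sub>R \<bar>h\<bar>) 0 < e"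
          unfolding eventually_at using d(1) by (auto simp: dist_real_def)
      qed
      from tendsto_norm_zero[OF this]
      show "(\<lambda>h. norm (q (t + h) x - q t x - h *\<^sub>R g t x) / norm h) \<midarrow>0\<rightarrow> 0"
        by (simp add: divide_inverse mult.commute)
    qed
    then have 1: "vderiv (\<lambda>\<tau>. q \<tau> x) t = g t x" unfolding vderiv_def by (rule vector_derivative_at)
    have "(q t has_vector_derivative vderiv (q t) x) (at x)"
      using schwartz_deriv[OF g(1), of 0 t x] by simp
    then have "((\<lambda>y. cnj (q t y)) has_vector_derivative cnj (vderiv (q t) x)) (at x)"
      by (rule has_vector_derivative_cnj)
    then have 2: "vderiv (\<lambda>y. cnj (q t y)) x = cnj (vderiv (q t) x)" unfolding vderiv_def[of "\<lambda>y. cnj (q t y)"] by (rule vector_derivative_at)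
    have "\<i> * g t x + of_real (1 / sqrt 3) * vderiv (vderiv (q t)) x + 2 * \<i> * cnj (q t x) * cnj (vderiv (q t) x) = 0"
      using assms unfolding schwartz_solution_def 1[symmetric] 2[symmetric] by blast
    moreover have "G = \<i> * S - 2 * C" if "\<i> * G + S + 2 * \<i> * C = 0" for G S C :: complex
      using that by (auto simp: complex_eq_iff)
    ultimately have "g t x = \<i> * (of_real (1 / sqrt 3) * vderiv (vderiv (q t)) x) - 2 * (cnj (q t x) * cnj (vderiv (q t) x))"
      by (simp only: mult.assoc)
    then show ?thesis by simp
  qed
  with g that show thesis by blast
qed

lemma schwartz_solution_cdec: "schwartz_solution q \<Longrightarrow> cdec (q t)"
  using schwartz_cdec[of "q t" 0] by (auto elim: schwartz_solutionD)

lemma J_add: "cdec f \<Longrightarrow> cdec g \<Longrightarrow> J (\<lambda>y. f y + g y) x = J f x + J g x"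
  unfolding J_def by (rule set_integral_add(2)) (auto intro: cdec_set_integrable)

lemma duhamel_add:
  assumes k: "k > 0" and f: "cdec f" and g: "cdec g"
  shows "duhamel k (\<lambda>y. f y + g y) x = duhamel k f x + duhamel k g x"
proof -
  obtain B where B: "\<And>x. norm (duhamel k f x + duhamel k g x) \<le> B"
    using cdec_bounded[OF cdec_add[OF duhamel_cdec[OF k f] duhamel_cdec[OF k g]]] by blast
  show ?thesis
  proof (rule duhamel_unique[OF k cdec_add[OF f g] B, symmetric])
    fix x
    show "((\<lambda>x. duhamel k f x + duhamel k g x) has_vector_derivative of_real k * \<beta> * (duhamel k f x + duhamel k g x) + (f x + g x)) (at x)"
      by (rule has_vector_derivative_eq_rhs[OF has_vector_derivative_add[OF duhamel_deriv[OF k f] duhamel_deriv[OF k g]]])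
         (simp add: algebra_simps)
  qed
qed

lemma J_le_inv_sq:
  fixes g :: "real \<Rightarrow> 'a::euclidean_space"
  assumes g: "cdec g" and b: "\<And>x. norm (g x) \<le> a / (1 + x\<^sup>2)"
  shows "J (\<lambda>y. norm (g y)) x \<le> a * pi"
proof -
  have "J (\<lambda>y. norm (g y)) x \<le> (LINT x|lborel. norm (g x))"
    by (rule J_le_integral(1)[OF cdec_norm[OF g]]) simp
  also have "\<dots> \<le> (LINT x|lborel. a / (1 + x\<^sup>2))"
    by (rule integral_mono) (auto intro: b integrable_inv_sq cdec_integrable[OF cdec_norm[OF g]])
  also have "\<dots> = a * (LINT x|lborel. inverse (1 + x\<^sup>2))"
    by (subst integral_mult_right_zero[symmetric]) (simp add: divide_inverse)
  finally show ?thesis by (simp add: integral_inv_sq)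
qed

text \<open>In integrated form \<open>(zm, zc)\<close> is a fixed point of \<open>volt\<close> up to
  the residual \<open>(J gm, duhamel k gc)\<close>, whose components are each at most
  \<open>pi * e\<close>; then \<open>volt_fixpoint_stable\<close> applies.\<close>

lemma jost_system_stable:
  assumes k: "k > 0" and q: "cdec q"
    and zm: "\<And>x. (zm has_vector_derivative (- 2 * Re (q x * cnj (zc x)) + gm x)) (at x)"
    and zc: "\<And>x. (zc has_vector_derivative (of_real k * \<beta> * zc x + (- (q x * of_real (zm x) + cnj (q x) * cnj (zc x)) + gc x))) (at x)"
    and lim: "(zm \<longlongrightarrow> 0) at_bot" and bd: "\<And>x. norm (zm x) \<le> B1" "\<And>x. norm (zc x) \<le> B2"
    and g: "cdec gm" "cdec gc" and ge: "\<And>x. norm (gm x) \<le> e / (1 + x\<^sup>2)" "\<And>x. norm (gc x) \<le> e / (1 + x\<^sup>2)"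
  shows "norm (zm x) \<le> 4 * pi * e * exp (8 * (LINT y|lborel. norm (q y)))"
proof -
  let ?z = "\<lambda>x. (zm x, zc x)"
  have cont: "continuous_on UNIV ?z"
    by (intro continuous_on_Pair continuous_at_imp_continuous_on ballI
        has_vector_derivative_continuous[OF zm] has_vector_derivative_continuous[OF zc])
  have B: "norm (?z x) \<le> B1 + B2" for x
    by (rule order_trans[OF norm_Pair_le]) (intro add_mono bd)
  note cd = volt_cdec[OF q cont B, simplified fst_conv snd_conv]
  have "zm x = 0 + J (\<lambda>y. - 2 * Re (q y * cnj (zc y)) + gm y) x" for x
    by (rule J_unique(1)[OF zm cdec_add[OF cd(1) g(1)] lim])
  then have 1: "zm x = J (\<lambda>y. - 2 * Re (q y * cnj (zc y))) x + J gm x" for x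
    using J_add[OF cd(1) g(1), of x] by simp
  have zc': "zc x = duhamel k (\<lambda>y. - (q y * of_real (zm y) + cnj (q y) * cnj (zc y)) + gc y) x" for x
    by (rule duhamel_unique[OF k cdec_add[OF cd(2) g(2)] bd(2) zc])
  have 2: "zc x = duhamel k (\<lambda>y. - (q y * of_real (zm y) + cnj (q y) * cnj (zc y))) x + duhamel k gc x" for x
    by (rule trans[OF zc' duhamel_add[OF k cd(2) g(2)]])
  have "?z x - volt k q ?z x = (J gm x, duhamel k gc x)" for x
    using 1[of x] 2[of x] by (simp add: volt_def)
  moreover have "norm (J gm x, duhamel k gc x) \<le> e * pi + e * pi" for x
    by (rule order_trans[OF norm_Pair_le])
       (intro add_mono order_trans[OF J_norm_le[OF g(1)]] order_trans[OF duhamel_norm_J[OF k g(2)]] J_le_inv_sq g ge)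
  ultimately have "norm (?z x - volt k q ?z x) \<le> 2 * pi * e" for x by (simp add: mult_ac)
  then have "norm (?z x) \<le> 2 * (2 * pi * e) * exp (8 * (LINT y|lborel. norm (q y)))"
    by (rule volt_fixpoint_stable[OF k q cont B])
  moreover have "norm (zm x) \<le> norm (?z x)" using norm_prod_components(1)[of "?z x"] by simp
  ultimately show ?thesis by (simp add: mult_ac)
qed

text \<open>The infinitesimal time evolution of the Jost solution along the flow, normalised to vanish at
  \<open>- \<infinity>\<close>.\<close>

definition lax_B :: "complex \<Rightarrow> complex \<Rightarrow> complex" where
  "lax_B q q1 = - (\<i> / sqrt 3) * q1 + (cnj q)\<^sup>2"

definition lax_m :: "real \<Rightarrow> complex \<Rightarrow> complex \<Rightarrow> real \<Rightarrow> complex \<Rightarrow> real" where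
  "lax_m k q q1 m c = 2 * k * Re (cnj \<omega> * q * cnj c) + 2 * Re (lax_B q q1 * cnj c)"

text \<open>The coefficient \<open>\<omega> - 1\<close> is \<open>(cnj \<omega>)^2 - 1\<close>: to
  leading order in \<open>k\<close> the time evolution is the square of the cyclic shift minus the
  identity, just as the spatial system has the shift minus the identity, that is
  \<open>\<beta>\<close>.\<close>

definition lax_c :: "real \<Rightarrow> complex \<Rightarrow> complex \<Rightarrow> real \<Rightarrow> complex \<Rightarrow> complex" where
  "lax_c k q q1 m c = of_real (k\<^sup>2) * (\<omega> - 1) * c + of_real k * (\<omega> * q * of_real m + cnj q * cnj c)
     + lax_B q q1 * of_real m + cnj (lax_B q q1) * cnj c"

text \<open>The zero curvature identity with \<open>c = a + i b\<close> and
  \<open>q = u + i v\<close>. \<open>P\<close> is the first component of the time evolution,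
  \<open>R\<close> and \<open>I\<close> are the real and imaginary part of the second, and
  \<open>ut\<close>, \<open>vt\<close> those of the time derivative of \<open>q\<close>. In these
  coordinates all is polynomial, and \<open>r * r = 1 / 3\<close> for \<open>r = 1 / sqrt 3\<close>
  is the only algebraic relation.\<close>

lemma zero_curvature_real:
  fixes m a b u v u1 v1 :: "real \<Rightarrow> real"
  assumes M: "(m has_real_derivative (- 2 * (u x * a x + v x * b x))) (at x)"
    and A: "(a has_real_derivative (k * (- 3 / 2 * a x + 3 * r / 2 * b x) - (u x * m x + u x * a x - v x * b x))) (at x)"
    and B: "(b has_real_derivative (k * (- 3 / 2 * b x - 3 * r / 2 * a x) - (v x * m x - u x * b x - v x * a x))) (at x)"
    and U: "(u has_real_derivative u1 x) (at x)" and V: "(v has_real_derivative v1 x) (at x)"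
    and U1: "(u1 has_real_derivative u2) (at x)" and V1: "(v1 has_real_derivative v2) (at x)"
    and r: "r * r = 1 / 3"
  defines "P \<equiv> \<lambda>x. 2 * k * ((- 1 / 2) * (u x * a x + v x * b x) + (3 * r / 2) * (v x * a x - u x * b x))
     + 2 * ((r * v1 x + u x * u x - v x * v x) * a x + (- (r * u1 x) - 2 * (u x * v x)) * b x)"
    and "R \<equiv> \<lambda>x. k * k * (- 3 / 2 * a x - 3 * r / 2 * b x) + k * ((- 1 / 2 * u x - 3 * r / 2 * v x) * m x + u x * a x - v x * b x)
     + (r * v1 x + u x * u x - v x * v x) * (m x + a x) - (- (r * u1 x) - 2 * (u x * v x)) * b x"
    and "I \<equiv> \<lambda>x. k * k * (- 3 / 2 * b x + 3 * r / 2 * a x) + k * ((- 1 / 2 * v x + 3 * r / 2 * u x) * m x - u x * b x - v x * a x)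
     - (r * v1 x + u x * u x - v x * v x) * b x + (- (r * u1 x) - 2 * (u x * v x)) * (m x - a x)"
    and "ut \<equiv> - (r * v2) - 2 * (u x * u1 x - v x * v1 x)" and "vt \<equiv> r * u2 + 2 * (u x * v1 x + v x * u1 x)"
  shows "(P has_real_derivative (- 2 * (u x * R x + v x * I x) - 2 * (ut * a x + vt * b x))) (at x)"
    "(R has_real_derivative (k * (- 3 / 2 * R x + 3 * r / 2 * I x) - (u x * P x + u x * R x - v x * I x) - (ut * m x + ut * a x - vt * b x))) (at x)"
    "(I has_real_derivative (k * (- 3 / 2 * I x - 3 * r / 2 * R x) - (v x * P x - u x * I x - v x * R x) - (vt * m x - ut * b x - vt * a x))) (at x)"
proof -
  have rr: "r * (r * y) = y / 3" for y using r by (simp flip: mult.assoc)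
  show "(P has_real_derivative (- 2 * (u x * R x + v x * I x) - 2 * (ut * a x + vt * b x))) (at x)"
    unfolding P_def R_def I_def ut_def vt_def
    by (rule DERIV_cong, (rule derivative_intros M A B U V U1 V1)+) (simp add: rr field_simps)
  show "(R has_real_derivative (k * (- 3 / 2 * R x + 3 * r / 2 * I x) - (u x * P x + u x * R x - v x * I x) - (ut * m x + ut * a x - vt * b x))) (at x)"
    unfolding P_def R_def I_def ut_def vt_def
    by (rule DERIV_cong, (rule derivative_intros M A B U V U1 V1)+) (simp add: rr field_simps)
  show "(I has_real_derivative (k * (- 3 / 2 * I x - 3 * r / 2 * R x) - (v x * P x - u x * I x - v x * R x) - (vt * m x - ut * b x - vt * a x))) (at x)"
    unfolding P_def R_def I_def ut_def vt_def
    by (rule DERIV_cong, (rule derivative_intros M A B U V U1 V1)+) (simp add: rr field_simps)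
qed

text \<open>The conclusion is the Jost system differentiated formally in time, with
  \<open>qt\<close> for the time derivative of the potential. Hence
  \<open>(\<Phi>m, \<Phi>c)\<close> is the candidate for the time derivative of the Jost
  solution.\<close>

lemma zero_curvature:
  fixes q :: "real \<Rightarrow> complex"
  assumes m: "(m has_vector_derivative (- 2 * Re (q x * cnj (c x)))) (at x)"
    and c: "(c has_vector_derivative (of_real k * \<beta> * c x + - (q x * of_real (m x) + cnj (q x) * cnj (c x)))) (at x)"
    and q: "(q has_vector_derivative q1 x) (at x)" and q1: "(q1 has_vector_derivative q2) (at x)"
    and qt: "qt = \<i> / sqrt 3 * q2 - 2 * cnj (q x) * cnj (q1 x)"
  defines "\<Phi>m \<equiv> \<lambda>x. lax_m k (q x) (q1 x) (m x) (c x)" and "\<Phi>c \<equiv> \<lambda>x. lax_c k (q x) (q1 x) (m x) (c x)"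
  shows "(\<Phi>m has_vector_derivative (- 2 * Re (q x * cnj (\<Phi>c x)) - 2 * Re (qt * cnj (c x)))) (at x)"
    "(\<Phi>c has_vector_derivative (of_real k * \<beta> * \<Phi>c x + - (q x * of_real (\<Phi>m x) + cnj (q x) * cnj (\<Phi>c x))
        - (qt * of_real (m x) + cnj qt * cnj (c x)))) (at x)"
proof -
  define r where "r = sqrt (3::real) / 3"
  have rr: "r * r = 1 / 3" by (simp add: r_def)
  have s: "sqrt 3 = 3 * r" by (simp add: r_def)
  have ir: "\<i> / complex_of_real (sqrt 3) = \<i> * of_real r"
    by (simp add: complex_eq_iff r_def Re_divide Im_divide power2_eq_square)
  have M: "(m has_real_derivative (- 2 * (Re (q x) * Re (c x) + Im (q x) * Im (c x)))) (at x)"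
    using m by (simp add: has_real_derivative_iff_has_vector_derivative)
  have A: "((\<lambda>x. Re (c x)) has_real_derivative (k * (- 3 / 2 * Re (c x) + 3 * r / 2 * Im (c x)) - (Re (q x) * m x + Re (q x) * Re (c x) - Im (q x) * Im (c x)))) (at x)"
    and B: "((\<lambda>x. Im (c x)) has_real_derivative (k * (- 3 / 2 * Im (c x) - 3 * r / 2 * Re (c x)) - (Im (q x) * m x - Re (q x) * Im (c x) - Im (q x) * Re (c x)))) (at x)"
    using c unfolding has_vector_derivative_complex_iff by (auto simp: s algebra_simps)
  have Q: "((\<lambda>x. Re (q x)) has_real_derivative Re (q1 x)) (at x)" "((\<lambda>x. Im (q x)) has_real_derivative Im (q1 x)) (at x)"
    "((\<lambda>x. Re (q1 x)) has_real_derivative Re q2) (at x)" "((\<lambda>x. Im (q1 x)) has_real_derivative Im q2) (at x)"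
    using q q1 unfolding has_vector_derivative_complex_iff by auto
  have bB: "lax_B (q x) (q1 x) = Complex (r * Im (q1 x) + Re (q x) * Re (q x) - Im (q x) * Im (q x)) (- (r * Re (q1 x)) - 2 * (Re (q x) * Im (q x)))" for x
    unfolding lax_B_def ir by (simp add: complex_eq_iff power2_eq_square algebra_simps)
  have om: "Re \<omega> = - 1 / 2" "Im \<omega> = 3 * r / 2" by (simp_all add: s)
  have P': "\<Phi>m = (\<lambda>x. 2 * k * ((- 1 / 2) * (Re (q x) * Re (c x) + Im (q x) * Im (c x)) + (3 * r / 2) * (Im (q x) * Re (c x) - Re (q x) * Im (c x)))
     + 2 * ((r * Im (q1 x) + Re (q x) * Re (q x) - Im (q x) * Im (q x)) * Re (c x) + (- (r * Re (q1 x)) - 2 * (Re (q x) * Im (q x))) * Im (c x)))"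
    unfolding \<Phi>m_def lax_m_def bB by (simp add: s fun_eq_iff field_simps)
  have R': "(\<lambda>x. Re (\<Phi>c x)) = (\<lambda>x. k * k * (- 3 / 2 * Re (c x) - 3 * r / 2 * Im (c x)) + k * ((- 1 / 2 * Re (q x) - 3 * r / 2 * Im (q x)) * m x + Re (q x) * Re (c x) - Im (q x) * Im (c x))
     + (r * Im (q1 x) + Re (q x) * Re (q x) - Im (q x) * Im (q x)) * (m x + Re (c x)) - (- (r * Re (q1 x)) - 2 * (Re (q x) * Im (q x))) * Im (c x))"
    unfolding \<Phi>c_def lax_c_def bB by (simp add: s power2_eq_square fun_eq_iff field_simps)
  have I': "(\<lambda>x. Im (\<Phi>c x)) = (\<lambda>x. k * k * (- 3 / 2 * Im (c x) + 3 * r / 2 * Re (c x)) + k * ((- 1 / 2 * Im (q x) + 3 * r / 2 * Re (q x)) * m x - Re (q x) * Im (c x) - Im (q x) * Re (c x))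
     - (r * Im (q1 x) + Re (q x) * Re (q x) - Im (q x) * Im (q x)) * Im (c x) + (- (r * Re (q1 x)) - 2 * (Re (q x) * Im (q x))) * (m x - Re (c x)))"
    unfolding \<Phi>c_def lax_c_def bB by (simp add: s power2_eq_square fun_eq_iff field_simps)
  have T: "Re qt = - (r * Im q2) - 2 * (Re (q x) * Re (q1 x) - Im (q x) * Im (q1 x))"
    "Im qt = r * Re q2 + 2 * (Re (q x) * Im (q1 x) + Im (q x) * Re (q1 x))"
    unfolding qt ir by (simp_all add: algebra_simps)
  note Z = zero_curvature_real[OF M A B Q rr, folded P' R' I' T, unfolded fun_cong[OF P', symmetric] fun_cong[OF R', symmetric] fun_cong[OF I', symmetric]]
  show "(\<Phi>m has_vector_derivative (- 2 * Re (q x * cnj (\<Phi>c x)) - 2 * Re (qt * cnj (c x)))) (at x)"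
    using Z(1) by (simp add: has_real_derivative_iff_has_vector_derivative)
  show "(\<Phi>c has_vector_derivative (of_real k * \<beta> * \<Phi>c x + - (q x * of_real (\<Phi>m x) + cnj (q x) * cnj (\<Phi>c x))
        - (qt * of_real (m x) + cnj qt * cnj (c x)))) (at x)"
    unfolding has_vector_derivative_complex_iff
    by (intro conjI; rule DERIV_cong[OF Z(2)] DERIV_cong[OF Z(3)]; simp add: s algebra_simps)
qed

text \<open>Differentiability of the Jost solution in time is not assumed. The solution at
  \<open>t + h\<close> is compared with \<open>m + h * \<Phi>m\<close> and
  \<open>c + h * \<Phi>c\<close>: the difference solves the Jost system for the potential
  \<open>q (t + h)\<close> with a forcing of size o(h), so it is o(h) uniformly in \<open>x\<close>.
  Since \<open>\<Phi>m\<close> vanishes at infinity, \<open>A (t + h) - A t\<close> is o(h) as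
  well.\<close>

theorem jost_conserved:
  assumes sol: "schwartz_solution q" and k: "k > 0"
    and j: "\<And>t. jost k (q t) (M t) (C t)" and A: "\<And>t. (M t \<longlongrightarrow> A t) at_top"
  shows "A t = A 0"
proof -
  obtain g where S: "\<And>t. schwartz (q t)" "\<And>t. schwartz (g t)" "\<And>t. has_schwartz_derivative q (g t) t"
    "\<And>t x. g t x = \<i> / sqrt 3 * vderiv (vderiv (q t)) x - 2 * cnj (q t x) * cnj (vderiv (q t) x)"
    using schwartz_solutionD[OF sol] by blast
  have j': "(M t has_vector_derivative (- 2 * Re (q t x * cnj (C t x)))) (at x)"
    "(C t has_vector_derivative (of_real k * \<beta> * C t x + - (q t x * of_real (M t x) + cnj (q t x) * cnj (C t x)))) (at x)"
    "(M t \<longlongrightarrow> 1) at_bot" "bounded (range (M t))" "cdec (C t)" for t x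
    using j[of t] unfolding jost_def by auto
  have qd: "cdec (q t)" "cdec (vderiv (q t))" "cdec (g t)" for t
    using schwartz_cdec[OF S(1), of 0 t] schwartz_cdec[OF S(1), of 1 t] schwartz_cdec[OF S(2), of 0 t] by simp_all
  have dq: "(q t has_vector_derivative vderiv (q t) x) (at x)" "(vderiv (q t) has_vector_derivative vderiv (vderiv (q t)) x) (at x)" for t x
    using schwartz_deriv[OF S(1), of 0 t x] schwartz_deriv[OF S(1), of 1 t x] by simp_all
  have "(A has_real_derivative 0) (at t)" for t
  proof -
    define m where "m = M t"
    define c where "c = C t"
    define \<Phi>m where "\<Phi>m x = lax_m k (q t x) (vderiv (q t) x) (m x) (c x)" for x
    define \<Phi>c where "\<Phi>c x = lax_c k (q t x) (vderiv (q t) x) (m x) (c x)" for x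
    note Z = zero_curvature[OF j'(1)[of t] j'(2)[of t] dq S(4), folded m_def c_def, folded \<Phi>m_def \<Phi>c_def]
    obtain K0 where K0: "\<And>x. norm (m x) \<le> K0" using j'(4)[of t] by (auto simp: bounded_iff m_def)
    have mc: "continuous_on UNIV (\<lambda>x. complex_of_real (m x))"
      unfolding m_def by (intro continuous_on_of_real continuous_at_imp_continuous_on ballI has_vector_derivative_continuous[OF j'(1)])
    have cc: "cdec c" unfolding c_def by (rule j')
    have mult_m: "cdec (\<lambda>x. f x * of_real (m x))" if "cdec f" for f :: "real \<Rightarrow> complex"
      using K0 by (intro cdec_mult_bounded(1)[OF that mc]) auto
    have cB: "cdec (\<lambda>x. lax_B (q t x) (vderiv (q t) x))"
      unfolding lax_B_def power2_eq_square by (intro cdec_add cdec_cmult(1) cdec_mult cdec_cnj qd)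
    have \<Phi>: "cdec \<Phi>m" "cdec \<Phi>c"
      unfolding \<Phi>m_def[abs_def] lax_m_def \<Phi>c_def[abs_def] lax_c_def
      by (intro cdec_add cdec_cmult(1) cdec_Re cdec_mult mult_m cB cc qd cdec_cnj)+
    obtain K1 where K1: "\<And>x. norm (c x) \<le> K1" using cdec_bounded[OF cc] by blast
    obtain K2 where K2: "\<And>x. norm (\<Phi>m x) \<le> K2" using cdec_bounded[OF \<Phi>(1)] by blast
    obtain K3 where K3: "\<And>x. norm (\<Phi>c x) \<le> K3" using cdec_bounded[OF \<Phi>(2)] by blast
    define K where "K = max (max K0 K1) (max K2 K3) + 1"
    have K: "norm (m x) \<le> K" "norm (c x) \<le> K" "norm (\<Phi>m x) \<le> K" "norm (\<Phi>c x) \<le> K" for x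
      unfolding K_def using K0[of x] K1[of x] K2[of x] K3[of x] by linarith+
    have Kp: "K > 0" using K0[of 0] norm_ge_zero[of "m 0"] unfolding K_def by linarith
    obtain G where G: "G > 0" "\<And>x. norm (g t x) \<le> G / (1 + x\<^sup>2)" using cdec_bound[OF qd(3)] by blast
    \<comment> \<open>A common bound for the exponential factor of \<open>jost_system_stable\<close>
      at the potentials \<open>q (t + h)\<close> with small \<open>h\<close>.\<close>
    define W where "W = exp (8 * ((LINT y|lborel. norm (q t y)) + (1 + G) * pi))"
    have key: "\<exists>d>0. \<forall>h. h \<noteq> 0 \<and> \<bar>h\<bar> < d \<longrightarrow> \<bar>A (t + h) - A t\<bar> \<le> e * \<bar>h\<bar>" if e: "e > 0" for e
    proof -
      \<comment> \<open>The stability estimate will give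
        \<open>4 * pi * (4 * K * (\<bar>h\<bar> * e1)) * W\<close>, which this choice makes at most
        \<open>e * \<bar>h\<bar>\<close>.\<close>
      define e1 where "e1 = min 1 (e / (16 * pi * K * W))"
      have e1: "e1 > 0" "e1 \<le> 1" "16 * pi * K * W * e1 \<le> e"
      proof -
        define X where "X = 16 * pi * K * W"
        have p: "X > 0" using Kp by (simp add: X_def W_def)
        then show "e1 > 0" "e1 \<le> 1" using e by (auto simp: e1_def X_def[symmetric])
        have "X * e1 \<le> X * (e / X)" using p by (intro mult_left_mono) (auto simp: e1_def X_def[symmetric])
        then show "16 * pi * K * W * e1 \<le> e" using p by (simp add: X_def[symmetric])
      qed
      obtain d1 where d1: "d1 > 0" "\<And>h x. h \<noteq> 0 \<Longrightarrow> \<bar>h\<bar> < d1 \<Longrightarrow> norm (q (t + h) x - q t x - of_real h * g t x) \<le> \<bar>h\<bar> * e1 / (1 + x\<^sup>2)"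
        using schwartz_derivative_uniform[OF S(1,2,3) e1(1), of t] by auto
      \<comment> \<open>The bound \<open>e1 / (1 + G)\<close> makes the second order quantity
        \<open>R\<close> below as small as the Taylor remainder \<open>P\<close>.\<close>
      define d where "d = min d1 (min 1 (e1 / (1 + G)))"
      have d: "d > 0" "d \<le> d1" "d \<le> 1" "d * (1 + G) \<le> e1"
      proof -
        show "d > 0" "d \<le> d1" using d1 e1 G by (auto simp: d_def)
        show "d \<le> 1" unfolding d_def by (rule min.coboundedI2, rule min.cobounded1)
        have "d * (1 + G) \<le> e1 / (1 + G) * (1 + G)" using G by (intro mult_right_mono) (auto simp: d_def)
        then show "d * (1 + G) \<le> e1" using G by simp
      qed
      have "\<bar>A (t + h) - A t\<bar> \<le> e * \<bar>h\<bar>" if h: "h \<noteq> 0" "\<bar>h\<bar> < d" for h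
      proof -
        define Q where "Q = q (t + h)"
        define P where "P x = Q x - q t x - of_real h * g t x" for x
        have Pb: "norm (P x) \<le> \<bar>h\<bar> * e1 / (1 + x\<^sup>2)" for x unfolding P_def Q_def using d1(2)[of h x] h d by simp
        have Qb: "norm (Q x - q t x) \<le> \<bar>h\<bar> * (1 + G) / (1 + x\<^sup>2)" for x
        proof -
          have "norm (Q x - q t x) \<le> norm (P x) + norm (of_real h * g t x)"
            using norm_triangle_ineq[of "P x" "of_real h * g t x"] by (simp add: P_def)
          also have "\<dots> \<le> \<bar>h\<bar> * e1 / (1 + x\<^sup>2) + \<bar>h\<bar> * (G / (1 + x\<^sup>2))"
            unfolding norm_mult norm_of_real by (intro add_mono mult_left_mono Pb G) simp
          also have "\<dots> = \<bar>h\<bar> * (e1 + G) / (1 + x\<^sup>2)" by (simp add: add_divide_distrib distrib_left)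
          also have "\<dots> \<le> \<bar>h\<bar> * (1 + G) / (1 + x\<^sup>2)" using e1 by (intro divide_right_mono mult_left_mono) auto
          finally show ?thesis .
        qed
        have hG: "\<bar>h\<bar> * (1 + G) \<le> e1"
        proof -
          have "\<bar>h\<bar> * (1 + G) \<le> d * (1 + G)" using h G by (intro mult_right_mono) auto
          then show ?thesis using d(4) by linarith
        qed
        define R where "R x = of_real h * (Q x - q t x)" for x
        have Rb: "norm (R x) \<le> \<bar>h\<bar> * e1 / (1 + x\<^sup>2)" for x
        proof -
          have "norm (R x) \<le> \<bar>h\<bar> * (\<bar>h\<bar> * (1 + G) / (1 + x\<^sup>2))"
            unfolding R_def norm_mult norm_of_real by (intro mult_left_mono Qb) simp
          also have "\<dots> \<le> \<bar>h\<bar> * (e1 / (1 + x\<^sup>2))" using hG by (intro mult_left_mono divide_right_mono) auto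
          finally show ?thesis by simp
        qed
        define zm where "zm x = M (t + h) x - m x - h * \<Phi>m x" for x
        define zc where "zc x = C (t + h) x - c x - of_real h * \<Phi>c x" for x
        \<comment> \<open>The forcing has two sources: the Taylor remainder \<open>P\<close> of the
          potential acting on the Jost solution, and the change of the potential between
          \<open>t\<close> and \<open>t + h\<close>, collected in \<open>R\<close>, acting on
          \<open>\<Phi>m\<close> and \<open>\<Phi>c\<close>.\<close>
        define gm where "gm x = - 2 * (Re (P x * cnj (c x)) + Re (R x * cnj (\<Phi>c x)))" for x
        define gc where "gc x = - ((P x * of_real (m x) + cnj (P x) * cnj (c x)) + (R x * of_real (\<Phi>m x) + cnj (R x) * cnj (\<Phi>c x)))" for x
        have cQ: "cdec Q" "cdec P" "cdec R"
          unfolding Q_def P_def[abs_def] R_def[abs_def] by (intro cdec_diff cdec_cmult(1) qd)+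
        have g: "cdec gm" "cdec gc"
          unfolding gm_def[abs_def] gc_def[abs_def]
          by (intro cdec_uminus cdec_cmult(1) cdec_add cdec_Re cdec_mult mult_m cdec_of_real \<Phi> cQ cdec_cnj cc)+
        have prod: "norm (p * y) \<le> K * (\<bar>h\<bar> * e1 / (1 + x\<^sup>2))" if "norm p \<le> \<bar>h\<bar> * e1 / (1 + x\<^sup>2)" "norm y \<le> K" for p y :: complex and x
          unfolding norm_mult mult.commute[of K] using that e1 by (intro mult_mono) auto
        have "norm (gm x) \<le> (4 * K * (\<bar>h\<bar> * e1)) / (1 + x\<^sup>2)" for x
        proof -
          have "norm (gm x) \<le> 2 * (norm (P x * cnj (c x)) + norm (R x * cnj (\<Phi>c x)))"
          proof -
            have "\<bar>Re (P x * cnj (c x)) + Re (R x * cnj (\<Phi>c x))\<bar> \<le> norm (P x * cnj (c x)) + norm (R x * cnj (\<Phi>c x))"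
              by (rule order_trans[OF abs_triangle_ineq add_mono[OF abs_Re_le_cmod abs_Re_le_cmod]])
            from mult_left_mono[OF this, of 2]
            show ?thesis unfolding gm_def real_norm_def abs_mult by simp
          qed
          also have "\<dots> \<le> 2 * (K * (\<bar>h\<bar> * e1 / (1 + x\<^sup>2)) + K * (\<bar>h\<bar> * e1 / (1 + x\<^sup>2)))"
            by (intro mult_left_mono add_mono prod Pb Rb) (simp_all add: K)
          finally show ?thesis by (simp add: mult_ac)
        qed
        moreover have "norm (gc x) \<le> (4 * K * (\<bar>h\<bar> * e1)) / (1 + x\<^sup>2)" for x
        proof -
          have "norm (gc x) \<le> (norm (P x * of_real (m x)) + norm (cnj (P x) * cnj (c x))) + (norm (R x * of_real (\<Phi>m x)) + norm (cnj (R x) * cnj (\<Phi>c x)))"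
            unfolding gc_def norm_minus_cancel by (intro order_trans[OF norm_triangle_ineq] add_mono norm_triangle_ineq)
          also have "\<dots> \<le> (K * (\<bar>h\<bar> * e1 / (1 + x\<^sup>2)) + K * (\<bar>h\<bar> * e1 / (1 + x\<^sup>2))) + (K * (\<bar>h\<bar> * e1 / (1 + x\<^sup>2)) + K * (\<bar>h\<bar> * e1 / (1 + x\<^sup>2)))"
            by (intro add_mono prod) (simp_all add: Pb Rb K K[unfolded real_norm_def])
          finally show ?thesis by (simp add: mult_ac)
        qed
        moreover have dzm: "(zm has_vector_derivative (- 2 * Re (Q x * cnj (zc x)) + gm x)) (at x)" for x
          unfolding zm_def[abs_def] m_def
          by (rule has_vector_derivative_eq_rhs[OF has_vector_derivative_diff[OF has_vector_derivative_diff[OF j'(1) j'(1)] has_vector_derivative_mult_right[OF Z(1)]]])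
             (simp add: gm_def zc_def P_def R_def Q_def c_def algebra_simps)
        moreover have dzc: "(zc has_vector_derivative (of_real k * \<beta> * zc x + (- (Q x * of_real (zm x) + cnj (Q x) * cnj (zc x)) + gc x))) (at x)" for x
          unfolding zc_def[abs_def] c_def
          by (rule has_vector_derivative_eq_rhs[OF has_vector_derivative_diff[OF has_vector_derivative_diff[OF j'(2) j'(2)] has_vector_derivative_mult_right[OF Z(2)]]])
             (simp add: gc_def zm_def P_def R_def Q_def c_def m_def algebra_simps)
        moreover have "(zm \<longlongrightarrow> 1 - 1 - h * 0) at_bot"
          unfolding zm_def[abs_def] m_def by (intro tendsto_intros j' cdec_tendsto_0[OF \<Phi>(1)])
        then have "(zm \<longlongrightarrow> 0) at_bot" by simp
        moreover obtain B1 where "\<And>x. norm (zm x) \<le> B1"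
        proof -
          obtain K0' where K0': "\<And>x. norm (M (t + h) x) \<le> K0'" using j'(4)[of "t + h"] by (auto simp: bounded_iff)
          have "norm (zm x) \<le> K0' + K + \<bar>h\<bar> * K" for x
            unfolding zm_def using K0'[of x] K(1)[of x] mult_left_mono[OF K(3)[of x], of "\<bar>h\<bar>"]
            by (intro order_trans[OF norm_triangle_ineq4] add_mono) (auto simp: abs_mult)
          then show ?thesis using that by blast
        qed
        moreover obtain B2 where "\<And>x. norm (zc x) \<le> B2"
          using cdec_bounded[OF cdec_diff[OF cdec_diff[OF j'(5)[of "t + h"] cc] cdec_cmult(1)[OF \<Phi>(2), of "of_real h"]]] unfolding zc_def by blast
        ultimately have zb: "norm (zm x) \<le> 4 * pi * (4 * K * (\<bar>h\<bar> * e1)) * exp (8 * (LINT y|lborel. norm (Q y)))" for x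
          by (intro jost_system_stable[OF k cQ(1) _ _ _ _ _ g]) blast+
        have "(LINT y|lborel. norm (Q y)) \<le> (LINT y|lborel. norm (q t y) + (1 + G) / (1 + y\<^sup>2))"
        proof (rule integral_mono)
          fix x
          have "norm (Q x) \<le> norm (q t x) + norm (Q x - q t x)" using norm_triangle_ineq[of "q t x" "Q x - q t x"] by simp
          also have "norm (Q x - q t x) \<le> (1 + G) / (1 + x\<^sup>2)"
          proof -
            have "\<bar>h\<bar> * (1 + G) \<le> 1 * (1 + G)" using h d G by (intro mult_right_mono) auto
            then have "\<bar>h\<bar> * (1 + G) / (1 + x\<^sup>2) \<le> 1 * (1 + G) / (1 + x\<^sup>2)" by (intro divide_right_mono) auto
            then show ?thesis using Qb[of x] by simp
          qed
          finally show "norm (Q x) \<le> norm (q t x) + (1 + G) / (1 + x\<^sup>2)" by simp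
        qed (intro Bochner_Integration.integrable_add cdec_integrable[OF cdec_norm] cQ qd integrable_inv_sq)+
        also have "\<dots> = (LINT y|lborel. norm (q t y)) + (1 + G) * pi"
        proof -
          have "(LINT y|lborel. (1 + G) / (1 + y\<^sup>2)) = (1 + G) * (LINT x|lborel. inverse (1 + x\<^sup>2))"
            by (subst integral_mult_right_zero[symmetric]) (simp add: divide_inverse)
          then show ?thesis
            by (subst Bochner_Integration.integral_add[OF cdec_integrable[OF cdec_norm[OF qd(1)]] integrable_inv_sq]) (simp add: integral_inv_sq)
        qed
        finally have "exp (8 * (LINT y|lborel. norm (Q y))) \<le> W" unfolding W_def by simp
        then have "4 * pi * (4 * K * (\<bar>h\<bar> * e1)) * exp (8 * (LINT y|lborel. norm (Q y))) \<le> 4 * pi * (4 * K * (\<bar>h\<bar> * e1)) * W"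
          using Kp e1 by (intro mult_left_mono) auto
        also have "\<dots> = \<bar>h\<bar> * (16 * pi * K * W * e1)" by simp
        also have "\<dots> \<le> \<bar>h\<bar> * e" using e1(3) by (intro mult_left_mono) auto
        finally have zb': "norm (zm x) \<le> e * \<bar>h\<bar>" for x using zb[of x] by (simp add: mult.commute)
        have "((\<lambda>x. norm (zm x)) \<longlongrightarrow> norm (A (t + h) - A t - h * 0)) at_top"
          unfolding zm_def m_def by (intro tendsto_intros A cdec_tendsto_0[OF \<Phi>(1)])
        then have "norm (A (t + h) - A t - h * 0) \<le> e * \<bar>h\<bar>"
          by (rule tendsto_upperbound) (intro always_eventually allI zb', rule trivial_limit_at_top_linorder)
        then show ?thesis by simp
      qed
      with d(1) show ?thesis by blast
    qed
    have "(\<lambda>h. (A (t + h) - A t) / h) \<midarrow>0\<rightarrow> 0"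
    proof (rule tendstoI)
      fix e :: real assume e: "e > 0"
      obtain d where d: "d > 0" "\<And>h. h \<noteq> 0 \<Longrightarrow> \<bar>h\<bar> < d \<Longrightarrow> \<bar>A (t + h) - A t\<bar> \<le> e / 2 * \<bar>h\<bar>"
        using key[of "e / 2"] e by auto
      have "\<bar>(A (t + h) - A t) / h\<bar> < e" if "h \<noteq> 0" "\<bar>h\<bar> < d" for h
      proof -
        have "\<bar>(A (t + h) - A t) / h\<bar> \<le> e / 2" using d(2)[OF that] that by (simp add: abs_divide pos_divide_le_eq)
        then show ?thesis using e by linarith
      qed
      then show "\<forall>\<^sub>F h in at 0. dist ((A (t + h) - A t) / h) 0 < e"
        unfolding eventually_at using d(1) by (auto simp: dist_real_def)
    qed
    then show ?thesis by (simp add: DERIV_def)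
  qed
  then show ?thesis using DERIV_const_ratio_const[of 0 t A 0] DERIV_isconst_all by blast
qed

section \<open>Lower bounds for the growth\<close>

lemma cdec_sq_integrable: "cdec f \<Longrightarrow> integrable lborel (\<lambda>x. (norm (f x))\<^sup>2)"
  unfolding power2_eq_square by (intro cdec_integrable cdec_mult cdec_norm)

text \<open>Here the weight of the microlocal norms meets the spectral problem: the squared symbol
  is \<open>\<xi>^2 + sqrt 3 * k * \<xi> + 3 * k^2\<close>.\<close>

lemma norm_k_beta_sq: "(norm (of_real k * \<beta> - \<i> * of_real \<xi>))\<^sup>2 \<le> 2 * (\<xi>\<^sup>2 + 3 * k\<^sup>2)"
proof -
  define s where "s = sqrt 3 * k"
  have "(norm (of_real k * \<beta> - \<i> * of_real \<xi>))\<^sup>2 = \<xi>\<^sup>2 + s\<^sup>2 + s * \<xi>"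
    unfolding cmod_power2 s_def by (simp add: power2_eq_square field_simps)
  also have "\<dots> \<le> 2 * (\<xi>\<^sup>2 + s\<^sup>2)"
  proof -
    have "s * \<xi> \<le> (s\<^sup>2 + \<xi>\<^sup>2) / 2" using sum_squares_bound[of s \<xi>] by simp
    moreover have "0 \<le> s\<^sup>2 + \<xi>\<^sup>2" by simp
    ultimately show ?thesis by argo
  qed
  also have "s\<^sup>2 = 3 * k\<^sup>2" by (simp add: s_def power_mult_distrib)
  finally show ?thesis .
qed

text \<open>The equation for \<open>w\<close>, solved for \<open>q\<close> on the Fourier side,
  gives the symbol times \<open>fourier w\<close> plus \<open>k * fourier n\<close>. The latter is
  at most \<open>E / sqrt (2 * pi)\<close> at every frequency, since the L1 norm of \<open>n\<close>
  is at most \<open>E / k\<close>.\<close>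

lemma fourier_lower_pointwise:
  assumes k: "k > 0" and q: "cdec q" and w: "cdec w" and n: "cdec n" and \<rho>: "cdec \<rho>" "\<And>x. norm (n x) \<le> \<rho> x"
    and E: "k * (LINT x|lborel. \<rho> x) = E"
    and d: "\<And>x. (w has_vector_derivative (of_real k * \<beta> * w x - q x + of_real k * n x)) (at x)"
  shows "(norm (fourier q \<xi>))\<^sup>2 \<le> 4 * (\<xi>\<^sup>2 + 3 * k\<^sup>2) * (norm (fourier w \<xi>))\<^sup>2 + E\<^sup>2 / pi"
proof -
  have cs: "cdec (\<lambda>x. of_real k * \<beta> * w x - q x)" "cdec (\<lambda>x. of_real k * \<beta> * w x)" "cdec (\<lambda>x. of_real k * n x)"
    by (intro cdec_diff cdec_cmult(1) w q n)+
  have "\<i> * of_real \<xi> * fourier w \<xi> = of_real k * \<beta> * fourier w \<xi> - fourier q \<xi> + of_real k * fourier n \<xi>"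
    unfolding fourier_deriv[OF d w cdec_add[OF cs(1,3)], symmetric]
    by (simp only: fourier_add[OF cs(1,3)] fourier_diff[OF cs(2) q] fourier_cmult)
  then have eq: "fourier q \<xi> = (of_real k * \<beta> - \<i> * of_real \<xi>) * fourier w \<xi> + of_real k * fourier n \<xi>"
    by (simp add: algebra_simps)
  have "norm (fourier n \<xi>) \<le> (LINT x|lborel. norm (n x)) / sqrt (2 * pi)"
    by (rule fourier_le[OF cdec_integrable[OF n]])
  also have "\<dots> \<le> (LINT x|lborel. \<rho> x) / sqrt (2 * pi)"
    by (intro divide_right_mono integral_mono cdec_integrable cdec_norm n \<rho>) simp
  finally have "k * norm (fourier n \<xi>) \<le> k * ((LINT x|lborel. \<rho> x) / sqrt (2 * pi))" using k by (intro mult_left_mono) auto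
  then have "norm (of_real k * fourier n \<xi>) \<le> E / sqrt (2 * pi)" using k by (simp add: norm_mult E[symmetric])
  then have "(norm (of_real k * fourier n \<xi>))\<^sup>2 \<le> (E / sqrt (2 * pi))\<^sup>2" by (intro power_mono) auto
  also have "\<dots> = E\<^sup>2 / (2 * pi)" by (simp add: power_divide)
  finally have 1: "(norm (of_real k * fourier n \<xi>))\<^sup>2 \<le> E\<^sup>2 / (2 * pi)" .
  have 2: "(norm ((of_real k * \<beta> - \<i> * of_real \<xi>) * fourier w \<xi>))\<^sup>2 \<le> 2 * (\<xi>\<^sup>2 + 3 * k\<^sup>2) * (norm (fourier w \<xi>))\<^sup>2"
    unfolding norm_mult power_mult_distrib by (intro mult_right_mono norm_k_beta_sq) simp
  have sq: "(norm (a + b))\<^sup>2 \<le> 2 * (norm a)\<^sup>2 + 2 * (norm b)\<^sup>2" for a b :: complex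
  proof -
    have "(norm (a + b))\<^sup>2 \<le> (norm a + norm b)\<^sup>2" by (intro power_mono norm_triangle_ineq) simp
    also have "\<dots> = (norm a)\<^sup>2 + (norm b)\<^sup>2 + 2 * norm a * norm b" by (rule power2_sum)
    also have "\<dots> \<le> 2 * (norm a)\<^sup>2 + 2 * (norm b)\<^sup>2" using sum_squares_bound[of "norm a" "norm b"] by linarith
    finally show ?thesis .
  qed
  have "(norm (fourier q \<xi>))\<^sup>2 \<le> 2 * (2 * (\<xi>\<^sup>2 + 3 * k\<^sup>2) * (norm (fourier w \<xi>))\<^sup>2) + 2 * (E\<^sup>2 / (2 * pi))"
    unfolding eq by (rule order_trans[OF sq]) (intro add_mono mult_left_mono 1 2, simp_all)
  also have "\<dots> = 4 * (\<xi>\<^sup>2 + 3 * k\<^sup>2) * (norm (fourier w \<xi>))\<^sup>2 + E\<^sup>2 / pi"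
    by (simp only: mult.assoc[symmetric])
  finally show ?thesis .
qed

lemma integral_lorentz_le:
  assumes "k > 0"
  shows "integrable lborel (\<lambda>\<xi>. k / (\<xi>\<^sup>2 + 3 * k\<^sup>2))" "(LINT \<xi>|lborel. k / (\<xi>\<^sup>2 + 3 * k\<^sup>2)) \<le> pi"
proof -
  have i: "integrable lborel (\<lambda>\<xi>. (1 / k) * inverse (1 + (0 + (1 / k) * \<xi>)\<^sup>2))"
    using integrable_inv_sq[of 1] assms
    by (intro integrable_mult_right, subst lborel_integrable_real_affine_iff) (auto simp: divide_inverse)
  have le: "k / (\<xi>\<^sup>2 + 3 * k\<^sup>2) \<le> (1 / k) * inverse (1 + (0 + (1 / k) * \<xi>)\<^sup>2)" for \<xi>
  proof -
    have p: "\<xi>\<^sup>2 + k\<^sup>2 > 0" using assms by (simp add: add_nonneg_pos)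
    have "k / (\<xi>\<^sup>2 + 3 * k\<^sup>2) \<le> k / (\<xi>\<^sup>2 + k\<^sup>2)" using assms p by (intro divide_left_mono mult_pos_pos) (auto simp: add_nonneg_pos)
    also have "\<dots> = (1 / k) * inverse (1 + (0 + (1 / k) * \<xi>)\<^sup>2)"
      using assms p by (simp add: field_simps power2_eq_square)
    finally show ?thesis .
  qed
  have nn: "k / (\<xi>\<^sup>2 + 3 * k\<^sup>2) \<ge> 0" for \<xi> using assms by (intro divide_nonneg_nonneg add_nonneg_nonneg) auto
  show i': "integrable lborel (\<lambda>\<xi>. k / (\<xi>\<^sup>2 + 3 * k\<^sup>2))"
  proof (rule Bochner_Integration.integrable_bound[OF i])
    show "AE \<xi> in lborel. norm (k / (\<xi>\<^sup>2 + 3 * k\<^sup>2)) \<le> norm ((1 / k) * inverse (1 + (0 + (1 / k) * \<xi>)\<^sup>2))"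
      unfolding real_norm_def abs_of_nonneg[OF nn] by (intro AE_I2 order_trans[OF le abs_ge_self])
  qed measurable
  have "(LINT \<xi>|lborel. k / (\<xi>\<^sup>2 + 3 * k\<^sup>2)) \<le> (LINT \<xi>|lborel. (1 / k) * inverse (1 + (0 + (1 / k) * \<xi>)\<^sup>2))"
    by (intro integral_mono i i' le)
  also have "\<dots> = (1 / k) * (LINT \<xi>|lborel. inverse (1 + (0 + (1 / k) * \<xi>)\<^sup>2))" by simp
  also have "\<dots> = pi"
    using lborel_integral_real_affine[of "1/k" "\<lambda>\<xi>. inverse (1 + \<xi>\<^sup>2)" 0] assms integral_inv_sq by simp
  finally show "(LINT \<xi>|lborel. k / (\<xi>\<^sup>2 + 3 * k\<^sup>2)) \<le> pi" .
qed

text \<open>The Lorentzian weight cancels the symbol in \<open>fourier_lower_pointwise\<close>,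
  after which Plancherel and \<open>norm (w x)^2 \<le> \<rho> x\<close> give the linear term; its
  own integral is at most \<open>pi\<close>, which handles the constant
  \<open>(ln A)^2 / pi\<close>. For \<open>\<bar>\<xi>\<bar> \<le> \<eta> \<le> k\<close> the factor
  \<open>4 * (\<xi>^2 + 3 * k^2)\<close> is at most \<open>16 * k^2\<close>, and the short interval
  gives the quadratic term its factor \<open>\<eta>\<close>.\<close>

lemma jost_lower:
  assumes k: "k > 0" and q: "cdec q" and j: "jost k q m c" and A: "(m \<longlongrightarrow> A) at_top"
  shows "A \<ge> 1"
    "(\<integral>\<^sup>+\<xi>. ennreal ((norm (fourier q \<xi>))\<^sup>2 * (k / (\<xi>\<^sup>2 + 3 * k\<^sup>2))) \<partial>lborel) \<le> ennreal (4 * ln A + (ln A)\<^sup>2)"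
    "\<And>\<eta>. 0 < \<eta> \<Longrightarrow> \<eta> \<le> k \<Longrightarrow>
      (\<integral>\<^sup>+\<xi>. ennreal ((norm (fourier q \<xi>))\<^sup>2) * indicator {-\<eta>..\<eta>} \<xi> \<partial>lborel) \<le> ennreal (16 * k * ln A + \<eta> * (ln A)\<^sup>2)"
proof -
  obtain A' w y n \<rho> where S: "(m \<longlongrightarrow> A') at_top" "A' \<ge> 1" "cdec w" "cdec n" "cdec \<rho>" "\<And>x. \<rho> x \<ge> 0"
    "k * (LINT x|lborel. \<rho> x) = ln A'"
    "\<And>x. (w has_vector_derivative (of_real k * \<beta> * w x - q x + of_real k * n x)) (at x)"
    "\<And>x. norm (n x) \<le> \<rho> x" "\<And>x. (norm (w x))\<^sup>2 \<le> \<rho> x"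
    by (rule jost_structure[OF k q j]) (rule that; assumption)
  have AA: "A' = A" using tendsto_unique[OF trivial_limit_at_top_linorder S(1) A] .
  show "A \<ge> 1" using S(2) AA by simp
  define E where "E = ln A"
  have E0: "E \<ge> 0" using S(2) AA by (simp add: E_def)
  have \<rho>E: "(LINT x|lborel. \<rho> x) = E / k" using S(7) k AA by (simp add: E_def field_simps)
  have wE: "(LINT \<xi>|lborel. (norm (fourier w \<xi>))\<^sup>2) \<le> E / k"
    unfolding plancherel[OF S(3)] \<rho>E[symmetric]
    by (intro integral_mono cdec_sq_integrable S cdec_integrable)
  note wi = fourier_L2[OF S(3)]
  note P = fourier_lower_pointwise[OF k q S(3,4,5,9) S(7) S(8), unfolded AA, folded E_def]
  have pos: "\<xi>\<^sup>2 + 3 * k\<^sup>2 > 0" for \<xi> using k by (simp add: add_nonneg_pos)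
  have "(\<integral>\<^sup>+\<xi>. ennreal ((norm (fourier q \<xi>))\<^sup>2 * (k / (\<xi>\<^sup>2 + 3 * k\<^sup>2))) \<partial>lborel)
    \<le> (\<integral>\<^sup>+\<xi>. ennreal (4 * k * (norm (fourier w \<xi>))\<^sup>2 + E\<^sup>2 / pi * (k / (\<xi>\<^sup>2 + 3 * k\<^sup>2))) \<partial>lborel)"
  proof (intro nn_integral_mono ennreal_leI)
    fix \<xi>
    have "(norm (fourier q \<xi>))\<^sup>2 * (k / (\<xi>\<^sup>2 + 3 * k\<^sup>2)) \<le> (4 * (\<xi>\<^sup>2 + 3 * k\<^sup>2) * (norm (fourier w \<xi>))\<^sup>2 + E\<^sup>2 / pi) * (k / (\<xi>\<^sup>2 + 3 * k\<^sup>2))"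
      using k pos[of \<xi>] by (intro mult_right_mono P) auto
    also have "\<dots> = 4 * k * (norm (fourier w \<xi>))\<^sup>2 + E\<^sup>2 / pi * (k / (\<xi>\<^sup>2 + 3 * k\<^sup>2))"
    proof -
      have "(4 * D * X + Y) * (k / D) = 4 * k * X + Y * (k / D)" if "D > 0" for D X Y
        using that by (simp add: distrib_right add_divide_distrib)
      from this[OF pos] show ?thesis .
    qed
    finally show "(norm (fourier q \<xi>))\<^sup>2 * (k / (\<xi>\<^sup>2 + 3 * k\<^sup>2)) \<le> \<dots>" .
  qed
  also have "\<dots> = ennreal (LINT \<xi>|lborel. 4 * k * (norm (fourier w \<xi>))\<^sup>2 + E\<^sup>2 / pi * (k / (\<xi>\<^sup>2 + 3 * k\<^sup>2)))"
    using k pos by (intro nn_integral_eq_integral Bochner_Integration.integrable_add integrable_mult_right wi integral_lorentz_le AE_I2)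
      (auto intro!: add_nonneg_nonneg mult_nonneg_nonneg divide_nonneg_nonneg)
  also have "\<dots> \<le> ennreal (4 * E + E\<^sup>2)"
  proof (rule ennreal_leI)
    have "(LINT \<xi>|lborel. 4 * k * (norm (fourier w \<xi>))\<^sup>2 + E\<^sup>2 / pi * (k / (\<xi>\<^sup>2 + 3 * k\<^sup>2)))
      = 4 * k * (LINT \<xi>|lborel. (norm (fourier w \<xi>))\<^sup>2) + E\<^sup>2 / pi * (LINT \<xi>|lborel. k / (\<xi>\<^sup>2 + 3 * k\<^sup>2))"
      by (subst Bochner_Integration.integral_add) (intro integrable_mult_right wi integral_lorentz_le k, intro integrable_mult_right wi integral_lorentz_le k, simp only: integral_mult_right_zero)
    also have "\<dots> \<le> 4 * k * (E / k) + E\<^sup>2 / pi * pi"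
      using k by (intro add_mono mult_left_mono wE integral_lorentz_le) auto
    finally show "(LINT \<xi>|lborel. 4 * k * (norm (fourier w \<xi>))\<^sup>2 + E\<^sup>2 / pi * (k / (\<xi>\<^sup>2 + 3 * k\<^sup>2))) \<le> 4 * E + E\<^sup>2"
      using k by simp
  qed
  finally show "(\<integral>\<^sup>+\<xi>. ennreal ((norm (fourier q \<xi>))\<^sup>2 * (k / (\<xi>\<^sup>2 + 3 * k\<^sup>2))) \<partial>lborel) \<le> ennreal (4 * ln A + (ln A)\<^sup>2)"
    by (simp only: E_def)
  fix \<eta> :: real assume \<eta>: "0 < \<eta>" "\<eta> \<le> k"
  have ii: "integrable lborel (\<lambda>\<xi>. indicator {-\<eta>..\<eta>} \<xi> * (E\<^sup>2 / pi))" "(LINT \<xi>|lborel. indicator {-\<eta>..\<eta>} \<xi> * (E\<^sup>2 / pi)) = 2 * \<eta> * (E\<^sup>2 / pi)"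
    using \<eta> by simp_all
  have "(\<integral>\<^sup>+\<xi>. ennreal ((norm (fourier q \<xi>))\<^sup>2) * indicator {-\<eta>..\<eta>} \<xi> \<partial>lborel)
    \<le> (\<integral>\<^sup>+\<xi>. ennreal (16 * k\<^sup>2 * (norm (fourier w \<xi>))\<^sup>2 + indicator {-\<eta>..\<eta>} \<xi> * (E\<^sup>2 / pi)) \<partial>lborel)"
  proof (rule nn_integral_mono)
    fix \<xi> :: real
    show "ennreal ((norm (fourier q \<xi>))\<^sup>2) * indicator {-\<eta>..\<eta>} \<xi> \<le> ennreal (16 * k\<^sup>2 * (norm (fourier w \<xi>))\<^sup>2 + indicator {-\<eta>..\<eta>} \<xi> * (E\<^sup>2 / pi))"
    proof (cases "\<xi> \<in> {-\<eta>..\<eta>}")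
      case True
      then have "\<bar>\<xi>\<bar> \<le> k" using \<eta> by auto
      then have "\<xi>\<^sup>2 \<le> k\<^sup>2" using k abs_le_square_iff[of \<xi> k] by simp
      then have "4 * (\<xi>\<^sup>2 + 3 * k\<^sup>2) * (norm (fourier w \<xi>))\<^sup>2 \<le> 16 * k\<^sup>2 * (norm (fourier w \<xi>))\<^sup>2"
        by (intro mult_right_mono) auto
      then have "(norm (fourier q \<xi>))\<^sup>2 \<le> 16 * k\<^sup>2 * (norm (fourier w \<xi>))\<^sup>2 + E\<^sup>2 / pi"
        using P[of \<xi>] by linarith
      then show ?thesis using True by (auto intro!: ennreal_leI simp del: ennreal_plus)
    qed simp
  qed
  also have "\<dots> = ennreal (LINT \<xi>|lborel. 16 * k\<^sup>2 * (norm (fourier w \<xi>))\<^sup>2 + indicator {-\<eta>..\<eta>} \<xi> * (E\<^sup>2 / pi))"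
    by (intro nn_integral_eq_integral Bochner_Integration.integrable_add integrable_mult_right wi ii AE_I2) auto
  also have "\<dots> \<le> ennreal (16 * k * E + \<eta> * E\<^sup>2)"
  proof (rule ennreal_leI)
    have "(LINT \<xi>|lborel. 16 * k\<^sup>2 * (norm (fourier w \<xi>))\<^sup>2 + indicator {-\<eta>..\<eta>} \<xi> * (E\<^sup>2 / pi))
      = 16 * k\<^sup>2 * (LINT \<xi>|lborel. (norm (fourier w \<xi>))\<^sup>2) + 2 * \<eta> * (E\<^sup>2 / pi)"
      unfolding ii(2)[symmetric] by (subst Bochner_Integration.integral_add) (intro integrable_mult_right wi, rule ii, simp only: integral_mult_right_zero)
    also have "\<dots> \<le> 16 * k\<^sup>2 * (E / k) + \<eta> * E\<^sup>2"
    proof (intro add_mono mult_left_mono wE)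
      have "2 * \<eta> * (E\<^sup>2 / pi) = \<eta> * E\<^sup>2 * (2 / pi)" by simp
      also have "\<dots> \<le> \<eta> * E\<^sup>2 * 1" using \<eta> pi_ge_two by (intro mult_left_mono) auto
      finally show "2 * \<eta> * (E\<^sup>2 / pi) \<le> \<eta> * E\<^sup>2" by simp
    qed simp
    also have "\<dots> = 16 * k * E + \<eta> * E\<^sup>2" using k by (simp add: power2_eq_square)
    finally show "(LINT \<xi>|lborel. 16 * k\<^sup>2 * (norm (fourier w \<xi>))\<^sup>2 + indicator {-\<eta>..\<eta>} \<xi> * (E\<^sup>2 / pi)) \<le> 16 * k * E + \<eta> * E\<^sup>2" .
  qed
  finally show "(\<integral>\<^sup>+\<xi>. ennreal ((norm (fourier q \<xi>))\<^sup>2) * indicator {-\<eta>..\<eta>} \<xi> \<partial>lborel) \<le> ennreal (16 * k * ln A + \<eta> * (ln A)\<^sup>2)"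
    by (simp only: E_def)
qed

section \<open>The upper bound for the growth\<close>

text \<open>The integral of \<open>g\<close> over the interval from \<open>x\<close> to
  \<open>x + h\<close>. Integrating the equation for \<open>w\<close> expresses its differences
  through \<open>tdiff\<close> of \<open>w\<close>, \<open>q\<close> and \<open>n\<close>; this
  smooths \<open>q\<close>, which is to be measured in a negative Sobolev norm.\<close>

definition tdiff :: "real \<Rightarrow> (real \<Rightarrow> 'a::euclidean_space) \<Rightarrow> real \<Rightarrow> 'a" where
  "tdiff h g x = J g (x + h) - J g x"

lemma tdiff_deriv:
  assumes "cdec g" shows "(tdiff h g has_vector_derivative (g (x + h) - g x)) (at x)"
proof -
  have "((\<lambda>x. x + h) has_vector_derivative 1) (at x)" by (auto intro!: derivative_eq_intros)
  from vector_diff_chain_at[OF this J_deriv[OF assms]]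
  have "((\<lambda>x. J g (x + h)) has_vector_derivative g (x + h)) (at x)" by (simp add: o_def)
  then show ?thesis unfolding tdiff_def[abs_def] by (intro has_vector_derivative_diff J_deriv assms)
qed

lemma tdiff_cdec:
  assumes g: "cdec g" and h: "h > 0" shows "cdec (tdiff h g)"
proof -
  obtain C where C: "C > 0" "\<And>x. norm (g x) \<le> C / (1 + x\<^sup>2)" using cdec_bound[OF g] by blast
  have "norm (tdiff h g x) \<le> (h * (2 * C * (1 + h\<^sup>2))) / (1 + x\<^sup>2)" for x
  proof -
    let ?B = "2 * C * (1 + h\<^sup>2) / (1 + x\<^sup>2)"
    have b: "norm (g y) \<le> ?B" if "y \<in> {x..x + h}" for y
    proof -
      have "1 + x\<^sup>2 \<le> 2 * (1 + y\<^sup>2) * (1 + (x - y)\<^sup>2)" by (rule weight_shift)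
      also have "\<dots> \<le> 2 * (1 + y\<^sup>2) * (1 + h\<^sup>2)"
        using that by (intro mult_left_mono add_mono order_refl) (auto simp: abs_le_square_iff[symmetric])
      finally have "C * (1 + x\<^sup>2) \<le> C * (2 * (1 + y\<^sup>2) * (1 + h\<^sup>2))" using C(1) by (intro mult_left_mono) auto
      then have "C / (1 + y\<^sup>2) \<le> ?B" by (simp add: field_simps)
      then show ?thesis using C(2)[of y] by linarith
    qed
    have "norm (J g (x + h) - J g x) \<le> ?B * norm (x + h - x)"
    proof (rule differentiable_bound[where f'="\<lambda>y t. t *\<^sub>R g y" and S="{x..x+h}"])
      show "(J g has_derivative (\<lambda>t. t *\<^sub>R g y)) (at y within {x..x+h})" for y
        using J_deriv[OF g, of y] unfolding has_vector_derivative_def by (rule has_derivative_at_withinI)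
      show "onorm (\<lambda>t. t *\<^sub>R g y) \<le> ?B" if "y \<in> {x..x+h}" for y
      proof (rule onorm_le)
        fix t :: real
        have "\<bar>t\<bar> * norm (g y) \<le> \<bar>t\<bar> * ?B" by (intro mult_left_mono b that) simp
        then show "norm (t *\<^sub>R g y) \<le> ?B * norm t" by (simp only: norm_scaleR real_norm_def mult.commute)
      qed
    qed (use h in auto)
    then show ?thesis using h by (simp add: tdiff_def mult_ac)
  qed
  moreover have "continuous_on UNIV (tdiff h g)"
    by (intro continuous_at_imp_continuous_on ballI has_vector_derivative_continuous[OF tdiff_deriv[OF g]])
  ultimately show ?thesis unfolding cdec_def by blast
qed

lemma fourier_tdiff:
  fixes g :: "real \<Rightarrow> complex"
  assumes g: "cdec g" and h: "h > 0"
  shows "\<i> * of_real \<xi> * fourier (tdiff h g) \<xi> = (exp (\<i> * of_real (\<xi> * h)) - 1) * fourier g \<xi>"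
  unfolding fourier_deriv[OF tdiff_deriv[OF g] tdiff_cdec[OF g h] cdec_diff[OF cdec_shift[OF g] g], symmetric]
    fourier_diff[OF cdec_shift[OF g] g] fourier_shift by (simp add: algebra_simps)

lemma norm_exp_minus_1:
  "norm (exp (\<i> * complex_of_real r) - 1) \<le> \<bar>r\<bar>" "norm (exp (\<i> * complex_of_real r) - 1) \<le> 2"
proof -
  have "norm (exp (\<i> * complex_of_real r) - 1) = 2 * \<bar>sin (r / 2)\<bar>"
    using dist_exp_i_1[of r] by (simp add: mult.commute)
  then show "norm (exp (\<i> * complex_of_real r) - 1) \<le> \<bar>r\<bar>" "norm (exp (\<i> * complex_of_real r) - 1) \<le> 2"
    using abs_sin_x_le_abs_x[of "r / 2"] abs_sin_le_one[of "r / 2"] by auto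
qed

lemma fourier_tdiff_le:
  fixes g :: "real \<Rightarrow> complex"
  assumes g: "cdec g" and h: "h > 0" and \<xi>: "\<xi> \<noteq> 0"
  shows "norm (fourier (tdiff h g) \<xi>) \<le> h * norm (fourier g \<xi>)"
    "\<bar>\<xi>\<bar> * norm (fourier (tdiff h g) \<xi>) \<le> 2 * norm (fourier g \<xi>)"
proof -
  have eq: "\<bar>\<xi>\<bar> * norm (fourier (tdiff h g) \<xi>) = norm (exp (\<i> * of_real (\<xi> * h)) - 1) * norm (fourier g \<xi>)"
    using arg_cong[OF fourier_tdiff[OF g h, of \<xi>], of norm] by (simp only: norm_mult) simp
  have "\<bar>\<xi>\<bar> * norm (fourier (tdiff h g) \<xi>) \<le> \<bar>\<xi> * h\<bar> * norm (fourier g \<xi>)"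
    unfolding eq by (intro mult_right_mono norm_exp_minus_1) simp
  then have "\<bar>\<xi>\<bar> * norm (fourier (tdiff h g) \<xi>) \<le> \<bar>\<xi>\<bar> * (h * norm (fourier g \<xi>))"
    using h by (simp add: abs_mult mult_ac)
  then show "norm (fourier (tdiff h g) \<xi>) \<le> h * norm (fourier g \<xi>)" using \<xi> by simp
  show "\<bar>\<xi>\<bar> * norm (fourier (tdiff h g) \<xi>) \<le> 2 * norm (fourier g \<xi>)"
    unfolding eq by (intro mult_right_mono norm_exp_minus_1) simp
qed

lemma tdiff_L2:
  fixes g :: "real \<Rightarrow> complex"
  assumes g: "cdec g" and h: "h > 0"
  shows "(LINT x|lborel. (norm (tdiff h g x))\<^sup>2) \<le> h\<^sup>2 * (LINT x|lborel. (norm (g x))\<^sup>2)"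
proof -
  have "(LINT x|lborel. (norm (tdiff h g x))\<^sup>2) = (LINT \<xi>|lborel. (norm (fourier (tdiff h g) \<xi>))\<^sup>2)"
    by (rule plancherel[OF tdiff_cdec[OF g h], symmetric])
  also have "\<dots> \<le> (LINT \<xi>|lborel. h\<^sup>2 * (norm (fourier g \<xi>))\<^sup>2)"
  proof (rule integral_mono_AE)
    show "AE \<xi> in lborel. (norm (fourier (tdiff h g) \<xi>))\<^sup>2 \<le> h\<^sup>2 * (norm (fourier g \<xi>))\<^sup>2"
      using AE_lborel_singleton[of 0]
    proof eventually_elim
      case (elim \<xi>)
      then show ?case unfolding power_mult_distrib[symmetric]
        by (intro power_mono fourier_tdiff_le g h) auto
    qed
  qed (intro integrable_mult_right fourier_L2 g tdiff_cdec h)+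
  also have "\<dots> = h\<^sup>2 * (LINT x|lborel. (norm (g x))\<^sup>2)" using plancherel[OF g] by simp
  finally show ?thesis .
qed

section \<open>Integrated differences in negative Sobolev norms\<close>

definition sobolev_sq :: "real \<Rightarrow> real \<Rightarrow> (real \<Rightarrow> complex) \<Rightarrow> real" where
  "sobolev_sq s k f = (LINT \<xi>|lborel. (norm (fourier f \<xi>))\<^sup>2 * (\<xi>\<^sup>2 + 3 * k\<^sup>2) powr s)"

lemma weight_pos: "k > 0 \<Longrightarrow> (\<xi>::real)\<^sup>2 + 3 * k\<^sup>2 > 0"
  by (simp add: add_nonneg_pos)

lemma sobolev_sq_integrable:
  assumes f: "cdec f" and k: "k > 0" and s: "s < 0"
  shows "integrable lborel (\<lambda>\<xi>. (norm (fourier f \<xi>))\<^sup>2 * (\<xi>\<^sup>2 + 3 * k\<^sup>2) powr s)"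
proof (rule Bochner_Integration.integrable_bound[OF integrable_mult_left[OF fourier_L2[OF f], of "(3 * k\<^sup>2) powr s"]])
  note fourier_measurable[OF cdec_integrable[OF f], measurable]
  show "(\<lambda>\<xi>. (norm (fourier f \<xi>))\<^sup>2 * (\<xi>\<^sup>2 + 3 * k\<^sup>2) powr s) \<in> borel_measurable lborel" by measurable
  have "(\<xi>\<^sup>2 + 3 * k\<^sup>2) powr s \<le> (3 * k\<^sup>2) powr s" for \<xi> :: real
    using k s by (intro powr_mono2') auto
  then show "AE \<xi> in lborel. norm ((norm (fourier f \<xi>))\<^sup>2 * (\<xi>\<^sup>2 + 3 * k\<^sup>2) powr s) \<le> norm ((norm (fourier f \<xi>))\<^sup>2 * (3 * k\<^sup>2) powr s)"
    by (intro AE_I2) (simp add: mult_left_mono)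
qed

lemma sobolev_sq_nonneg: "sobolev_sq s k f \<ge> 0"
  unfolding sobolev_sq_def by simp

text \<open>The multiplier of \<open>tdiff\<close> is at most
  \<open>min h (2 / \<bar>\<xi>\<bar>)\<close>, and this is compared with the Sobolev weight. As
  \<open>k \<le> 1 / h\<close>, the weight \<open>\<xi>^2 + 3 * k^2\<close> is at most
  \<open>4 * (1 / h)^2\<close> when \<open>\<bar>\<xi>\<bar> * h \<le> 1\<close> and at most
  \<open>4 * \<xi>^2\<close> otherwise; the factor \<open>4 powr s\<close> is at least 1/2 because
  \<open>- 1 / 2 < s\<close>.\<close>

lemma tdiff_multiplier:
  fixes \<xi> h k s X Y :: real
  assumes s: "- 1 / 2 < s" "s < 0" and k: "k > 0" and h: "0 < h" "h \<le> 1 / k" and \<xi>: "\<xi> \<noteq> 0"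
    and X: "0 \<le> X" "X \<le> h * Y" "\<bar>\<xi>\<bar> * X \<le> 2 * Y" and Y: "Y \<ge> 0"
  shows "X\<^sup>2 \<le> 8 * h powr (2 + 2 * s) * (Y\<^sup>2 * (\<xi>\<^sup>2 + 3 * k\<^sup>2) powr s)"
proof -
  let ?W = "\<xi>\<^sup>2 + 3 * k\<^sup>2"
  have W: "?W > 0" by (rule weight_pos[OF k])
  have kh: "k\<^sup>2 \<le> 1 / h\<^sup>2"
  proof -
    have "k \<le> 1 / h" using h k by (simp add: field_simps)
    then have "k\<^sup>2 \<le> (1 / h)\<^sup>2" using k by (intro power_mono) auto
    then show ?thesis by (simp add: power_divide)
  qed
  have four: "(4::real) powr s \<ge> 1 / 2"
  proof -
    have "(4::real) powr (- 1 / 2) \<le> 4 powr s" using s by (intro powr_mono) auto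
    moreover have "(4::real) powr (- 1 / 2) = (2 powr 2) powr (- 1 / 2)" by simp
    moreover have "((2::real) powr 2) powr (- 1 / 2) = 1 / 2" unfolding powr_powr by (simp add: powr_minus_divide)
    ultimately show ?thesis by (simp only:)
  qed
  have sq: "z\<^sup>2 powr s = z powr (2 * s)" if "z > 0" for z :: real
    using that by (simp add: powr_powr flip: powr_numeral)
  have inv: "(1 / h) powr a = h powr (- a)" for a
    unfolding powr_minus_divide using powr_divide[of 1 h a] h by simp
  show ?thesis
  proof (cases "\<bar>\<xi>\<bar> * h \<le> 1")
    case True
    have "\<xi>\<^sup>2 \<le> 1 / h\<^sup>2"
    proof -
      have "\<bar>\<xi>\<bar> \<le> 1 / h" using True h by (simp add: field_simps)
      then have "\<bar>\<xi>\<bar>\<^sup>2 \<le> (1 / h)\<^sup>2" by (intro power_mono) auto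
      then show ?thesis by (simp add: power_divide)
    qed
    then have "?W \<le> 4 * (1 / h)\<^sup>2" using kh by (simp add: power_divide)
    then have W4: "(4 * (1 / h)\<^sup>2) powr s \<le> ?W powr s" using W s by (intro powr_mono2') auto
    have "1 / 2 * h powr (- 2 * s) \<le> 4 powr s * h powr (- 2 * s)" by (intro mult_right_mono four) simp
    also have "\<dots> = 4 powr s * (1 / h) powr (2 * s)" unfolding inv by simp
    also have "\<dots> = (4 * (1 / h)\<^sup>2) powr s"
      using h by (subst powr_mult) (auto simp: sq)
    also note W4
    finally have lower: "1 / 2 * h powr (- 2 * s) \<le> ?W powr s" .
    have "X\<^sup>2 \<le> (h * Y)\<^sup>2" using X by (intro power_mono) auto
    also have "\<dots> = h\<^sup>2 * Y\<^sup>2" by (rule power_mult_distrib)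
    also have "h\<^sup>2 = 2 * h powr (2 + 2 * s) * (1 / 2 * h powr (- 2 * s))"
      using h by (simp flip: powr_add powr_numeral)
    also have "\<dots> \<le> 2 * h powr (2 + 2 * s) * ?W powr s" by (intro mult_left_mono lower) simp
    finally have "X\<^sup>2 \<le> 2 * h powr (2 + 2 * s) * ?W powr s * Y\<^sup>2" by (simp add: mult_right_mono)
    also have "\<dots> \<le> 8 * h powr (2 + 2 * s) * ?W powr s * Y\<^sup>2" by (intro mult_right_mono) auto
    finally show ?thesis by (simp add: mult_ac)
  next
    case False
    define x where "x = \<bar>\<xi>\<bar>"
    have x: "x > 0" "1 < x * h" using \<xi> False by (auto simp: x_def)
    have hx: "1 / h \<le> x" using x h by (simp add: field_simps)
    have "1 / h\<^sup>2 \<le> x\<^sup>2"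
    proof -
      have "(1 / h)\<^sup>2 \<le> x\<^sup>2" using hx h by (intro power_mono) auto
      then show ?thesis by (simp add: power_divide)
    qed
    then have "?W \<le> 4 * x\<^sup>2" using kh by (simp add: x_def)
    then have W4: "(4 * x\<^sup>2) powr s \<le> ?W powr s" using W s by (intro powr_mono2') auto
    have "1 / 2 * x powr (2 * s) \<le> 4 powr s * x powr (2 * s)" by (intro mult_right_mono four) simp
    also have "\<dots> = (4 * x\<^sup>2) powr s"
      using x by (subst powr_mult) (auto simp: sq)
    also note W4
    finally have lower: "1 / 2 * x powr (2 * s) \<le> ?W powr s" .
    have xp: "x powr (- 2 - 2 * s) \<le> h powr (2 + 2 * s)"
    proof -
      have "x powr (- 2 - 2 * s) \<le> (1 / h) powr (- 2 - 2 * s)" using hx h s by (intro powr_mono2') auto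
      also have "\<dots> = h powr (2 + 2 * s)" unfolding inv by (simp add: add.commute)
      finally show ?thesis .
    qed
    have "(x * X)\<^sup>2 \<le> (2 * Y)\<^sup>2" using X x by (intro power_mono) (auto simp: x_def)
    then have "X\<^sup>2 \<le> 4 * Y\<^sup>2 / x\<^sup>2" using x by (simp add: power_mult_distrib pos_le_divide_eq mult.commute)
    also have "\<dots> = 8 * (1 / 2 * x powr (2 * s)) * x powr (- 2 - 2 * s) * Y\<^sup>2"
    proof -
      have "x powr (2 * s) * x powr (- 2 - 2 * s) = 1 / x\<^sup>2"
        using x by (simp flip: powr_add add: powr_minus divide_inverse)
      moreover have "8 * (1 / 2 * a) * b * Z = 4 * (a * b) * Z" for a b Z :: real by simp
      ultimately show ?thesis by (simp only: times_divide_eq_right times_divide_eq_left mult_1_right)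
    qed
    also have "\<dots> \<le> 8 * ?W powr s * h powr (2 + 2 * s) * Y\<^sup>2"
      using xp lower by (intro mult_right_mono mult_mono) auto
    finally show ?thesis by (simp add: mult_ac)
  qed
qed

lemma tdiff_L2_sobolev:
  assumes s: "- 1 / 2 < s" "s < 0" and k: "k > 0" and h: "0 < h" "h \<le> 1 / k" and q: "cdec q"
  shows "(LINT x|lborel. (norm (tdiff h q x))\<^sup>2) \<le> 8 * h powr (2 + 2 * s) * sobolev_sq s k q"
proof -
  have "(LINT x|lborel. (norm (tdiff h q x))\<^sup>2) = (LINT \<xi>|lborel. (norm (fourier (tdiff h q) \<xi>))\<^sup>2)"
    by (rule plancherel[OF tdiff_cdec[OF q h(1)], symmetric])
  also have "\<dots> \<le> (LINT \<xi>|lborel. 8 * h powr (2 + 2 * s) * ((norm (fourier q \<xi>))\<^sup>2 * (\<xi>\<^sup>2 + 3 * k\<^sup>2) powr s))"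
  proof (rule integral_mono_AE)
    show "AE \<xi> in lborel. (norm (fourier (tdiff h q) \<xi>))\<^sup>2 \<le> 8 * h powr (2 + 2 * s) * ((norm (fourier q \<xi>))\<^sup>2 * (\<xi>\<^sup>2 + 3 * k\<^sup>2) powr s)"
      using AE_lborel_singleton[of 0]
      by eventually_elim (intro tdiff_multiplier[OF s k h] fourier_tdiff_le q h, simp_all)
  qed (intro integrable_mult_right fourier_L2 q tdiff_cdec h sobolev_sq_integrable k s)+
  finally show ?thesis by (simp add: sobolev_sq_def)
qed

text \<open>Tonelli: each \<open>y\<close> lies in \<open>{x<..x+h}\<close> for a set of
  \<open>x\<close> of length \<open>h\<close>. For \<open>\<rho>\<close> this turns the L1 part of a
  difference of \<open>w\<close> into exactly \<open>h * E\<close>.\<close>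

lemma tdiff_integral:
  fixes r :: "real \<Rightarrow> real"
  assumes r: "cdec r" "\<And>x. r x \<ge> 0" and h: "h > 0"
  shows "(LINT x|lborel. tdiff h r x) = h * (LINT x|lborel. r x)"
proof -
  have t: "tdiff h r x = (LINT y|lborel. indicator {x<..x+h} y * r y)" for x
  proof -
    have "(LINT y|lborel. indicator {..x+h} y *\<^sub>R r y) - (LINT y|lborel. indicator {..x} y *\<^sub>R r y) = (LINT y|lborel. indicator {..x+h} y *\<^sub>R r y - indicator {..x} y *\<^sub>R r y)"
      using cdec_set_integrable[OF r(1), of "{..x+h}"] cdec_set_integrable[OF r(1), of "{..x}"]
      by (intro Bochner_Integration.integral_diff[symmetric]) (simp_all add: set_integrable_def)
    also have "\<dots> = (LINT y|lborel. indicator {x<..x+h} y * r y)"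
      using h by (intro Bochner_Integration.integral_cong) (auto simp: indicator_def)
    finally show ?thesis by (simp add: tdiff_def J_def set_lebesgue_integral_def)
  qed
  have [measurable]: "r \<in> borel_measurable borel" by (rule cdec_measurable[OF r(1)])
  have nn: "tdiff h r x \<ge> 0" for x unfolding t by (intro Bochner_Integration.integral_nonneg) (simp add: r)
  have te: "ennreal (tdiff h r x) = (\<integral>\<^sup>+y. ennreal (r y) * indicator {0<..h} (y - x) \<partial>lborel)" for x
    unfolding t using cdec_set_integrable[OF r(1), of "{x<..x+h}"] r(2)
    by (subst nn_integral_eq_integral[symmetric]) (auto simp: set_integrable_def intro!: nn_integral_cong split: split_indicator)
  have "ennreal (LINT x|lborel. tdiff h r x) = (\<integral>\<^sup>+x. ennreal (tdiff h r x) \<partial>lborel)"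
    by (intro nn_integral_eq_integral[symmetric] cdec_integrable tdiff_cdec r h AE_I2 nn)
  also have "\<dots> = (\<integral>\<^sup>+x. \<integral>\<^sup>+y. ennreal (r y) * indicator {0<..h} (y - x) \<partial>lborel \<partial>lborel)" by (simp only: te)
  also have "\<dots> = (\<integral>\<^sup>+y. \<integral>\<^sup>+x. ennreal (r y) * indicator {0<..h} (y - x) \<partial>lborel \<partial>lborel)"
    by (rule lborel_pair.Fubini') measurable
  also have "\<dots> = (\<integral>\<^sup>+y. ennreal (r y) * ennreal h \<partial>lborel)"
  proof (intro nn_integral_cong)
    fix y
    have "(\<integral>\<^sup>+x. ennreal (r y) * indicator {0<..h} (y - x) \<partial>lborel) = (\<integral>\<^sup>+x. ennreal (r y) * indicator {y-h..<y} x \<partial>lborel)"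
      by (intro nn_integral_cong) (auto split: split_indicator)
    also have "\<dots> = ennreal (r y) * ennreal h" using h by (simp add: nn_integral_cmult_indicator)
    finally show "(\<integral>\<^sup>+x. ennreal (r y) * indicator {0<..h} (y - x) \<partial>lborel) = ennreal (r y) * ennreal h" .
  qed
  also have "\<dots> = (\<integral>\<^sup>+y. ennreal (h * r y) \<partial>lborel)"
    using h r(2) by (intro nn_integral_cong) (simp add: ennreal_mult' mult.commute)
  also have "\<dots> = ennreal (LINT y|lborel. h * r y)"
    using h r by (intro nn_integral_eq_integral integrable_mult_right cdec_integrable AE_I2) auto
  finally have "ennreal (LINT x|lborel. tdiff h r x) = ennreal (h * (LINT y|lborel. r y))" by simp
  then show ?thesis
    using h by (subst (asm) ennreal_inj) (auto intro!: Bochner_Integration.integral_nonneg nn r mult_nonneg_nonneg)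
qed

text \<open>Here the bounded range of \<open>y\<close> pays off. In the application \<open>a\<close>
  is square integrable and \<open>b\<close> only integrable, so where \<open>b\<close> dominates,
  one of the two factors \<open>z\<close> is replaced by its bound 2.\<close>

lemma min_sq_split:
  fixes z a b :: real
  assumes "0 \<le> z" "z \<le> 2" "z \<le> 8 * (a + b)" "0 \<le> a" "0 \<le> b"
  shows "z\<^sup>2 \<le> 256 * a\<^sup>2 + 32 * b"
proof (cases "z \<le> 16 * a")
  case True
  then have "z\<^sup>2 \<le> (16 * a)\<^sup>2" using assms by (intro power_mono) auto
  then show ?thesis using assms by (simp add: power_mult_distrib)
next
  case False
  then have "z \<le> 16 * b" using assms by argo
  then have "z * z \<le> 2 * (16 * b)" using assms by (intro mult_mono) auto
  then have "z\<^sup>2 \<le> 32 * b" by (simp add: power2_eq_square)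
  then show ?thesis using zero_le_power2[of a] by argo
qed

text \<open>In the difference of \<open>w\<close> the term with \<open>n\<close> is the integrable
  part \<open>b\<close> of \<open>min_sq_split\<close>, and the terms with \<open>w\<close> and
  \<open>q\<close> form the square integrable part \<open>a\<close>. With
  \<open>k * h \<le> 1\<close> the energy terms collapse to \<open>(2048 + 32) * (h * E)\<close>;
  the term with \<open>q\<close> has the factor \<open>512 * 8 = 4096\<close>.\<close>

lemma shift_difference_L2:
  assumes s: "- 1 / 2 < s" "s < 0" and k: "k > 0" and h: "0 < h" "h \<le> 1 / k" and q: "cdec q"
    and S: "cdec w" "cdec y" "cdec n" "cdec \<rho>" "\<And>x. \<rho> x \<ge> 0" "k * (LINT x|lborel. \<rho> x) = E"
    "\<And>x. (w has_vector_derivative (of_real k * \<beta> * w x - q x + of_real k * n x)) (at x)"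
    "\<And>x. norm (n x) \<le> \<rho> x" "\<And>x. (norm (w x))\<^sup>2 \<le> \<rho> x"
    "\<And>x x'. norm (y x - y x') \<le> 2" "\<And>x x'. norm (y x - y x') \<le> 8 * norm (w x - w x')"
  shows "(LINT x|lborel. (norm (y (x + h) - y x))\<^sup>2) \<le> 4096 * (h * E + h powr (2 + 2 * s) * sobolev_sq s k q)"
proof -
  have cw': "cdec (\<lambda>x. of_real k * \<beta> * w x - q x + of_real k * n x)"
    by (intro cdec_add cdec_diff cdec_cmult(1) S q)
  have wJ: "w x = 0 + J (\<lambda>x. of_real k * \<beta> * w x - q x + of_real k * n x) x" for x
    by (rule J_unique(1)[OF S(7) cw' cdec_tendsto_0(2)[OF S(1)]])
  have c1: "cdec (\<lambda>x. of_real k * \<beta> * w x)" "cdec (\<lambda>x. - q x)" "cdec (\<lambda>x. of_real k * n x)"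
    by (intro cdec_cmult(1) cdec_uminus S q)+
  have Jw: "w x = of_real k * \<beta> * J w x - J q x + of_real k * J n x" for x
  proof -
    have "J (\<lambda>x. of_real k * \<beta> * w x - q x + of_real k * n x) x = J (\<lambda>x. of_real k * \<beta> * w x) x + J (\<lambda>x. - q x) x + J (\<lambda>x. of_real k * n x) x"
      using J_add[OF cdec_add[OF c1(1,2)] c1(3), of x] J_add[OF c1(1,2), of x] by simp
    also have "\<dots> = of_real k * \<beta> * J w x - J q x + of_real k * J n x"
      using set_integral_uminus[OF cdec_set_integrable[OF q], of "{..x}"] unfolding J_def by simp
    finally show ?thesis using wJ[of x] by simp
  qed
  have dw: "w (x + h) - w x = of_real k * \<beta> * tdiff h w x - tdiff h q x + of_real k * tdiff h n x" for x
    unfolding tdiff_def by (subst (1 2) Jw) (simp add: algebra_simps)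
  have nb: "norm \<beta> \<le> 2" by (simp add: cmod_def power2_eq_square real_le_lsqrt)
  have tn: "norm (tdiff h n x) \<le> tdiff h \<rho> x" for x
  proof -
    have "norm (tdiff h n x) = norm (LINT y|lborel. indicator {..x+h} y *\<^sub>R n y - indicator {..x} y *\<^sub>R n y)"
      unfolding tdiff_def J_def set_lebesgue_integral_def
      using cdec_set_integrable[OF S(3), of "{..x+h}"] cdec_set_integrable[OF S(3), of "{..x}"]
      by (subst Bochner_Integration.integral_diff) (simp_all add: set_integrable_def)
    also have "\<dots> \<le> (LINT y|lborel. indicator {..x+h} y *\<^sub>R \<rho> y - indicator {..x} y *\<^sub>R \<rho> y)"
    proof (rule Bochner_Integration.integral_norm_bound_integral)
      show "integrable lborel (\<lambda>y. indicator {..x+h} y *\<^sub>R n y - indicator {..x} y *\<^sub>R n y)"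
        "integrable lborel (\<lambda>y. indicator {..x+h} y *\<^sub>R \<rho> y - indicator {..x} y *\<^sub>R \<rho> y)"
        using cdec_set_integrable[OF S(3), of "{..x+h}"] cdec_set_integrable[OF S(3), of "{..x}"]
          cdec_set_integrable[OF S(4), of "{..x+h}"] cdec_set_integrable[OF S(4), of "{..x}"]
        by (auto simp: set_integrable_def)
    qed (use h S(8) in \<open>auto simp: indicator_def\<close>)
    also have "\<dots> = tdiff h \<rho> x"
      unfolding tdiff_def J_def set_lebesgue_integral_def
      using cdec_set_integrable[OF S(4), of "{..x+h}"] cdec_set_integrable[OF S(4), of "{..x}"]
      by (subst Bochner_Integration.integral_diff) (simp_all add: set_integrable_def)
    finally show ?thesis .
  qed
  note ct = tdiff_cdec[OF S(1) h(1)] tdiff_cdec[OF q h(1)] tdiff_cdec[OF S(4) h(1)]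
  have pw: "(norm (y (x + h) - y x))\<^sup>2 \<le> 2048 * k\<^sup>2 * (norm (tdiff h w x))\<^sup>2 + 512 * (norm (tdiff h q x))\<^sup>2 + 32 * k * tdiff h \<rho> x" for x
  proof -
    define a where "a = 2 * k * norm (tdiff h w x) + norm (tdiff h q x)"
    have "norm (w (x + h) - w x) \<le> norm (of_real k * \<beta> * tdiff h w x) + norm (tdiff h q x) + norm (of_real k * tdiff h n x)"
      unfolding dw by (rule order_trans[OF norm_triangle_ineq add_right_mono[OF norm_triangle_ineq4]])
    also have "\<dots> \<le> a + k * tdiff h \<rho> x"
    proof -
      have "norm (of_real k * \<beta> * tdiff h w x) \<le> 2 * k * norm (tdiff h w x)"
        using k nb by (simp add: norm_mult mult_right_mono)
      moreover have "norm (of_real k * tdiff h n x) \<le> k * tdiff h \<rho> x"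
        using k tn[of x] by (simp add: norm_mult)
      ultimately show ?thesis by (simp add: a_def)
    qed
    finally have wa: "norm (w (x + h) - w x) \<le> a + k * tdiff h \<rho> x" .
    have b0: "k * tdiff h \<rho> x \<ge> 0" using k order_trans[OF norm_ge_zero tn[of x]] by simp
    have a0: "a \<ge> 0" using k by (simp add: a_def)
    have "norm (y (x + h) - y x) \<le> 8 * (a + k * tdiff h \<rho> x)" using wa S(11)[of "x + h" x] by argo
    then have "(norm (y (x + h) - y x))\<^sup>2 \<le> 256 * a\<^sup>2 + 32 * (k * tdiff h \<rho> x)"
      using S(10) a0 b0 by (intro min_sq_split) auto
    moreover have "a\<^sup>2 \<le> 8 * k\<^sup>2 * (norm (tdiff h w x))\<^sup>2 + 2 * (norm (tdiff h q x))\<^sup>2"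
    proof -
      have "(u + v)\<^sup>2 \<le> 2 * u\<^sup>2 + 2 * v\<^sup>2" for u v :: real
        using sum_squares_bound[of u v] by (simp add: power2_sum)
      from this[of "2 * k * norm (tdiff h w x)" "norm (tdiff h q x)"] show ?thesis
        by (simp add: a_def power_mult_distrib)
    qed
    ultimately show ?thesis by simp
  qed
  have i1: "integrable lborel (\<lambda>x. 2048 * k\<^sup>2 * (norm (tdiff h w x))\<^sup>2)" "integrable lborel (\<lambda>x. 512 * (norm (tdiff h q x))\<^sup>2)"
    "integrable lborel (\<lambda>x. 32 * k * tdiff h \<rho> x)"
    by (intro integrable_mult_right cdec_sq_integrable cdec_integrable ct)+
  have "(LINT x|lborel. (norm (y (x + h) - y x))\<^sup>2) \<le> (LINT x|lborel. 2048 * k\<^sup>2 * (norm (tdiff h w x))\<^sup>2 + 512 * (norm (tdiff h q x))\<^sup>2 + 32 * k * tdiff h \<rho> x)"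
    by (intro integral_mono cdec_sq_integrable cdec_diff cdec_shift S Bochner_Integration.integrable_add i1 pw)
  also have "\<dots> = 2048 * k\<^sup>2 * (LINT x|lborel. (norm (tdiff h w x))\<^sup>2) + 512 * (LINT x|lborel. (norm (tdiff h q x))\<^sup>2) + 32 * k * (LINT x|lborel. tdiff h \<rho> x)"
    using i1 by simp
  also have "\<dots> \<le> 2048 * k\<^sup>2 * (h\<^sup>2 * (E / k)) + 512 * (8 * h powr (2 + 2 * s) * sobolev_sq s k q) + 32 * (h * E)"
  proof (intro add_mono mult_left_mono)
    have "(LINT x|lborel. (norm (tdiff h w x))\<^sup>2) \<le> h\<^sup>2 * (LINT x|lborel. (norm (w x))\<^sup>2)" by (rule tdiff_L2[OF S(1) h(1)])
    also have "\<dots> \<le> h\<^sup>2 * (LINT x|lborel. \<rho> x)" by (intro mult_left_mono integral_mono cdec_sq_integrable S cdec_integrable) simp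
    also have "(LINT x|lborel. \<rho> x) = E / k" using S(6) k by (simp add: field_simps)
    finally show "(LINT x|lborel. (norm (tdiff h w x))\<^sup>2) \<le> h\<^sup>2 * (E / k)" .
    show "(LINT x|lborel. (norm (tdiff h q x))\<^sup>2) \<le> 8 * h powr (2 + 2 * s) * sobolev_sq s k q" by (rule tdiff_L2_sobolev[OF s k h q])
    show "32 * k * (LINT x|lborel. tdiff h \<rho> x) \<le> 32 * (h * E)"
      unfolding tdiff_integral[OF S(4,5) h(1)] S(6)[symmetric] by simp
  qed auto
  also have "2048 * k\<^sup>2 * (h\<^sup>2 * (E / k)) \<le> 2048 * (h * E)"
  proof -
    have E0: "E \<ge> 0" unfolding S(6)[symmetric] using k S(5) by (intro mult_nonneg_nonneg Bochner_Integration.integral_nonneg) auto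
    have "k\<^sup>2 * (h\<^sup>2 * (E / k)) = (k * h) * (h * E)" using k by (simp add: power2_eq_square)
    also have "\<dots> \<le> 1 * (h * E)" using h k E0 by (intro mult_right_mono) (auto simp: field_simps)
    finally show ?thesis by simp
  qed
  finally have "(LINT x|lborel. (norm (y (x + h) - y x))\<^sup>2) \<le> 2048 * (h * E) + 512 * (8 * h powr (2 + 2 * s) * sobolev_sq s k q) + 32 * (h * E)"
    by simp
  moreover have "h * E \<ge> 0" unfolding S(6)[symmetric] using k h S(5) by (intro mult_nonneg_nonneg Bochner_Integration.integral_nonneg) auto
  ultimately show ?thesis by argo
qed

section \<open>Fractional norms through finite differences\<close>

lemma nn_integral_powr_from_0:
  assumes "a > -1" "c > 0"
  shows "(\<integral>\<^sup>+h. ennreal (h powr a) * indicator {0<..c} h \<partial>lborel) = ennreal (c powr (a + 1) / (a + 1))"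
proof -
  have "((\<lambda>h. h powr a) has_integral (c powr (a + 1) / (a + 1))) {0..c}"
    using has_integral_powr_from_0[OF assms(1), of c] assms(2) by simp
  then have "integral\<^sup>N lborel (\<lambda>h. ennreal (indicator {0..c} h * (h powr a))) = ennreal (c powr (a + 1) / (a + 1))"
    by (rule nn_integral_has_integral_lebesgue[rotated]) simp
  moreover have "(\<integral>\<^sup>+h. ennreal (h powr a) * indicator {0<..c} h \<partial>lborel) = integral\<^sup>N lborel (\<lambda>h. ennreal (indicator {0..c} h * (h powr a)))"
    by (intro nn_integral_cong) (auto split: split_indicator)
  ultimately show ?thesis by simp
qed

lemma norm_exp_minus_1_lower:
  assumes "1 / 2 \<le> \<bar>r\<bar>" "\<bar>r\<bar> \<le> 1"
  shows "4 * (sin (1 / 4))\<^sup>2 \<le> (norm (exp (\<i> * complex_of_real r) - 1))\<^sup>2"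
proof -
  have n: "norm (exp (\<i> * complex_of_real r) - 1) = 2 * \<bar>sin (r / 2)\<bar>"
    using dist_exp_i_1[of r] by (simp add: mult.commute)
  have "\<bar>sin (r / 2)\<bar> = \<bar>sin (\<bar>r\<bar> / 2)\<bar>" by (cases "r \<ge> 0") auto
  moreover have "sin (1 / 4) \<le> sin (\<bar>r\<bar> / 2)"
    using assms pi_ge_two by (intro sin_monotone_2pi_le) auto
  moreover have "0 \<le> sin (1 / 4 :: real)" using pi_ge_two by (intro sin_ge_zero) auto
  ultimately have "(sin (1 / 4))\<^sup>2 \<le> (sin (r / 2))\<^sup>2"
    by (metis abs_ge_self order_trans power_mono power2_abs)
  then show ?thesis unfolding n by (simp add: power_mult_distrib)
qed

text \<open>The Gagliardo seminorm of order \<open>- s\<close> on the Fourier side, with steps up to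
  \<open>1 / k\<close>. For \<open>\<bar>\<xi>\<bar> > k\<close> the steps between
  \<open>1 / (2 * \<bar>\<xi>\<bar>)\<close> and \<open>1 / \<bar>\<xi>\<bar>\<close> suffice: there
  the phase \<open>\<xi> * h\<close> has modulus between 1/2 and 1, and the exponential stays away
  from 1. Lower frequencies are left to the first term.\<close>

lemma weight_le_gagliardo:
  assumes s: "- 1 / 2 < s" "s < 0"
  shows "\<exists>C>0. \<forall>k \<xi>. k > 0 \<longrightarrow> ennreal ((\<xi>\<^sup>2 + 3 * k\<^sup>2) powr (- s)) \<le>
    ennreal (C * k powr (- 2 * s)) + ennreal C *
      (\<integral>\<^sup>+h. ennreal ((norm (exp (\<i> * complex_of_real (\<xi> * h)) - 1))\<^sup>2 * h powr (- 1 + 2 * s)) * indicator {0<..1/k} h \<partial>lborel)"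
proof -
  define c0 where "c0 = 4 * (sin (1 / 4 :: real))\<^sup>2"
  have c0: "c0 > 0"
  proof -
    have "0 < sin (1 / 4 :: real)" using pi_ge_two by (intro sin_gt_zero) auto
    then show ?thesis by (simp add: c0_def)
  qed
  have four: "(4::real) powr (- s) \<le> 4"
  proof -
    have "(4::real) powr (- s) \<le> 4 powr 1" using s by (intro powr_mono) auto
    then show ?thesis by simp
  qed
  have sq: "z\<^sup>2 powr (- s) = z powr (- 2 * s)" if "z > 0" for z :: real
    using that by (simp add: powr_powr flip: powr_numeral)
  \<comment> \<open>The summand 4 serves \<open>\<bar>\<xi>\<bar> \<le> k\<close>; the summand
    \<open>8 / c0\<close> gives \<open>C * c0 / 2 \<ge> 4\<close>, which serves the other
    case.\<close>
  define C where "C = 4 + 8 / c0"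
  have C: "C \<ge> 4" "C > 0" "C * c0 / 2 \<ge> 4" using c0 by (auto simp: C_def field_simps add_pos_nonneg)
  have "ennreal ((\<xi>\<^sup>2 + 3 * k\<^sup>2) powr (- s)) \<le> ennreal (C * k powr (- 2 * s)) + ennreal C *
      (\<integral>\<^sup>+h. ennreal ((norm (exp (\<i> * complex_of_real (\<xi> * h)) - 1))\<^sup>2 * h powr (- 1 + 2 * s)) * indicator {0<..1/k} h \<partial>lborel)"
    (is "_ \<le> _ + _ * ?I") if k: "k > 0" for k \<xi> :: real
  proof -
    have up: "(\<xi>\<^sup>2 + 3 * k\<^sup>2) powr (- s) \<le> 4 * z powr (- 2 * s)" if "z > 0" "\<xi>\<^sup>2 \<le> z\<^sup>2" "k\<^sup>2 \<le> z\<^sup>2" for z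
    proof -
      have "(\<xi>\<^sup>2 + 3 * k\<^sup>2) powr (- s) \<le> (4 * z\<^sup>2) powr (- s)" using that s weight_pos[OF k, of \<xi>] by (intro powr_mono2) auto
      also have "\<dots> = 4 powr (- s) * z powr (- 2 * s)" using that by (subst powr_mult) (auto simp: sq)
      also have "\<dots> \<le> 4 * z powr (- 2 * s)" by (intro mult_right_mono four) simp
      finally show ?thesis .
    qed
    show ?thesis
    proof (cases "\<bar>\<xi>\<bar> \<le> k")
      case True
      then have "(\<xi>\<^sup>2 + 3 * k\<^sup>2) powr (- s) \<le> 4 * k powr (- 2 * s)"
        using k by (intro up) (auto simp: abs_le_square_iff[symmetric])
      also have "\<dots> \<le> C * k powr (- 2 * s)" by (intro mult_right_mono C) simp
      finally have "ennreal ((\<xi>\<^sup>2 + 3 * k\<^sup>2) powr (- s)) \<le> ennreal (C * k powr (- 2 * s))" by (rule ennreal_leI)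
      then show ?thesis by (rule order_trans) simp
    next
      case False
      define x where "x = \<bar>\<xi>\<bar>"
      have x: "x > 0" "k < x" using False k by (auto simp: x_def)
      have inv: "(1 / x) powr a = x powr (- a)" for a
        unfolding powr_minus_divide using powr_divide[of 1 x a] x by simp
      have "ennreal (c0 / 2 * x powr (- 2 * s)) = ennreal (c0 * x powr (1 - 2 * s)) * ennreal (1 / x - 1 / (2 * x))"
      proof -
        have "x powr (1 - 2 * s) = x * x powr (- 2 * s)" using x by (simp add: powr_add[of x 1 "- 2 * s", simplified])
        then have "c0 * x powr (1 - 2 * s) * (1 / x - 1 / (2 * x)) = c0 / 2 * x powr (- 2 * s)" using x by (simp add: field_simps)
        then show ?thesis using x c0 by (subst ennreal_mult'[symmetric]) auto
      qed
      also have "\<dots> = (\<integral>\<^sup>+h. ennreal (c0 * x powr (1 - 2 * s)) * indicator {1/(2*x)..1/x} h \<partial>lborel)"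
        using x by (subst nn_integral_cmult_indicator) (auto simp: field_simps)
      also have "\<dots> \<le> ?I"
      proof (rule nn_integral_mono)
        fix h :: real
        show "ennreal (c0 * x powr (1 - 2 * s)) * indicator {1/(2*x)..1/x} h \<le> ennreal ((norm (exp (\<i> * complex_of_real (\<xi> * h)) - 1))\<^sup>2 * h powr (- 1 + 2 * s)) * indicator {0<..1/k} h"
        proof (cases "h \<in> {1/(2*x)..1/x}")
          case True
          have "0 < 1 / (2 * x)" using x by simp
          then have h: "h > 0" using atLeastAtMost_iff[THEN iffD1, OF True] by (meson less_le_trans)
          have "1 / x \<le> 1 / k" using x k by (simp add: field_simps)
          then have hk: "h \<le> 1 / k" using True by auto
          have r: "\<bar>\<xi> * h\<bar> = x * h" using h by (simp add: x_def abs_mult)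
          have "1 / 2 \<le> \<bar>\<xi> * h\<bar>" "\<bar>\<xi> * h\<bar> \<le> 1" unfolding r using True x by (auto simp: field_simps)
          then have 1: "c0 \<le> (norm (exp (\<i> * complex_of_real (\<xi> * h)) - 1))\<^sup>2" unfolding c0_def by (rule norm_exp_minus_1_lower)
          have "(1 / x) powr (- 1 + 2 * s) \<le> h powr (- 1 + 2 * s)" using h True s by (intro powr_mono2') auto
          then have 2: "x powr (1 - 2 * s) \<le> h powr (- 1 + 2 * s)" unfolding inv by simp
          have "c0 * x powr (1 - 2 * s) \<le> (norm (exp (\<i> * complex_of_real (\<xi> * h)) - 1))\<^sup>2 * h powr (- 1 + 2 * s)"
            using c0 by (intro mult_mono 1 2) auto
          then show ?thesis using True h hk by (auto intro!: ennreal_leI)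
        qed simp
      qed
      finally have I: "ennreal (c0 / 2 * x powr (- 2 * s)) \<le> ?I" .
      have "(\<xi>\<^sup>2 + 3 * k\<^sup>2) powr (- s) \<le> 4 * x powr (- 2 * s)"
      proof (rule up[OF x(1)])
        show "\<xi>\<^sup>2 \<le> x\<^sup>2" by (simp add: x_def)
        show "k\<^sup>2 \<le> x\<^sup>2" using x k by (intro power_mono) auto
      qed
      also have "\<dots> \<le> C * c0 / 2 * x powr (- 2 * s)" by (intro mult_right_mono C) simp
      finally have "(\<xi>\<^sup>2 + 3 * k\<^sup>2) powr (- s) \<le> C * (c0 / 2 * x powr (- 2 * s))" by simp
      then have "ennreal ((\<xi>\<^sup>2 + 3 * k\<^sup>2) powr (- s)) \<le> ennreal C * ennreal (c0 / 2 * x powr (- 2 * s))"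
        using C by (subst ennreal_mult'[symmetric]) (auto intro: ennreal_leI)
      also have "\<dots> \<le> ennreal C * ?I" by (intro mult_left_mono I) simp
      finally show ?thesis by (rule order_trans) simp
    qed
  qed
  with C(2) show ?thesis by blast
qed

lemma nn_integral_lincomb:
  fixes a b :: ennreal
  assumes "f \<in> borel_measurable M" "g \<in> borel_measurable M"
  shows "(\<integral>\<^sup>+x. a * f x + b * g x \<partial>M) = a * (\<integral>\<^sup>+x. f x \<partial>M) + b * (\<integral>\<^sup>+x. g x \<partial>M)"
  using assms by (simp add: nn_integral_add nn_integral_cmult)

text \<open>Integrating the bound on differences against \<open>h powr (- 1 + 2 * s)\<close> leaves
  \<open>h powr (2 * s)\<close> and \<open>h powr (1 + 4 * s)\<close>. Each is integrable at 0
  precisely for \<open>s > - 1 / 2\<close>.\<close>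

lemma fractional_norm_bound:
  assumes s: "- 1 / 2 < s" "s < 0"
  obtains C where "C > 0" "\<And>k y E N. k > 0 \<Longrightarrow> cdec y \<Longrightarrow> E \<ge> 0 \<Longrightarrow> N \<ge> 0 \<Longrightarrow>
      (LINT x|lborel. (norm (y x))\<^sup>2) \<le> 64 * E / k \<Longrightarrow>
      (\<And>h. 0 < h \<Longrightarrow> h \<le> 1 / k \<Longrightarrow> (LINT x|lborel. (norm (y (x + h) - y x))\<^sup>2) \<le> 4096 * (h * E + h powr (2 + 2 * s) * N))
     \<Longrightarrow> (\<integral>\<^sup>+\<xi>. ennreal ((norm (fourier y \<xi>))\<^sup>2 * (\<xi>\<^sup>2 + 3 * k\<^sup>2) powr (- s)) \<partial>lborel)
        \<le> ennreal (C * (k powr (- 1 - 2 * s) * E + k powr (- 2 - 4 * s) * N))"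
proof -
  obtain C1 where C1: "C1 > 0" "\<And>k \<xi>. k > 0 \<Longrightarrow> ennreal ((\<xi>\<^sup>2 + 3 * k\<^sup>2) powr (- s)) \<le>
    ennreal (C1 * k powr (- 2 * s)) + ennreal C1 *
      (\<integral>\<^sup>+h. ennreal ((norm (exp (\<i> * complex_of_real (\<xi> * h)) - 1))\<^sup>2 * h powr (- 1 + 2 * s)) * indicator {0<..1/k} h \<partial>lborel)"
    using weight_le_gagliardo[OF s] by blast
  define C where "C = 64 * C1 + 4096 * C1 / (1 + 2 * s)"
  have s1: "1 + 2 * s > 0" using s by simp
  have Cp: "C > 0" using C1 s1 by (simp add: C_def add_pos_pos)
  have "(\<integral>\<^sup>+\<xi>. ennreal ((norm (fourier y \<xi>))\<^sup>2 * (\<xi>\<^sup>2 + 3 * k\<^sup>2) powr (- s)) \<partial>lborel)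
        \<le> ennreal (C * (k powr (- 1 - 2 * s) * E + k powr (- 2 - 4 * s) * N))"
    if k: "k > 0" and y: "cdec y" and E: "E \<ge> 0" and N: "N \<ge> 0"
      and yE: "(LINT x|lborel. (norm (y x))\<^sup>2) \<le> 64 * E / k"
      and yh: "\<And>h. 0 < h \<Longrightarrow> h \<le> 1 / k \<Longrightarrow> (LINT x|lborel. (norm (y (x + h) - y x))\<^sup>2) \<le> 4096 * (h * E + h powr (2 + 2 * s) * N)"
    for k y E N
  proof -
    note fourier_measurable[OF cdec_integrable[OF y], measurable]
    let ?F = "\<lambda>\<xi>. ennreal ((norm (fourier y \<xi>))\<^sup>2)"
    let ?e = "\<lambda>\<xi> h. (norm (exp (\<i> * complex_of_real (\<xi> * h)) - 1))\<^sup>2"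
    let ?g = "\<lambda>\<xi> h. ennreal (?e \<xi> h * h powr (- 1 + 2 * s)) * indicator {0<..1/k} h"
    have F2: "(\<integral>\<^sup>+\<xi>. ?F \<xi> \<partial>lborel) \<le> ennreal (64 * E / k)"
      using plancherel[OF y] yE by (subst nn_integral_eq_integral[OF fourier_L2[OF y]]) (auto intro: ennreal_leI)
    have inner: "(\<integral>\<^sup>+\<xi>. ?F \<xi> * ennreal (?e \<xi> h) \<partial>lborel) \<le> ennreal (4096 * (h * E + h powr (2 + 2 * s) * N))"
      if h: "0 < h" "h \<le> 1 / k" for h
    proof -
      have cd: "cdec (\<lambda>x. y (x + h) - y x)" by (intro cdec_diff cdec_shift y)
      have eq: "(norm (fourier (\<lambda>x. y (x + h) - y x) \<xi>))\<^sup>2 = (norm (fourier y \<xi>))\<^sup>2 * ?e \<xi> h" for \<xi>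
      proof -
        have "fourier (\<lambda>x. y (x + h) - y x) \<xi> = (exp (\<i> * complex_of_real (\<xi> * h)) - 1) * fourier y \<xi>"
          unfolding fourier_diff[OF cdec_shift[OF y] y] fourier_shift by (simp add: algebra_simps)
        then show ?thesis by (simp add: norm_mult power_mult_distrib mult.commute)
      qed
      have "(\<integral>\<^sup>+\<xi>. ?F \<xi> * ennreal (?e \<xi> h) \<partial>lborel) = (\<integral>\<^sup>+\<xi>. ennreal ((norm (fourier (\<lambda>x. y (x + h) - y x) \<xi>))\<^sup>2) \<partial>lborel)"
        unfolding eq by (intro nn_integral_cong) (simp add: ennreal_mult')
      also have "\<dots> = ennreal (LINT x|lborel. (norm (y (x + h) - y x))\<^sup>2)"
        unfolding plancherel[OF cd, symmetric] by (rule nn_integral_eq_integral[OF fourier_L2[OF cd]]) simp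
      also have "\<dots> \<le> ennreal (4096 * (h * E + h powr (2 + 2 * s) * N))" by (intro ennreal_leI yh h)
      finally show ?thesis .
    qed
    have "(\<integral>\<^sup>+\<xi>. ?F \<xi> * (\<integral>\<^sup>+h. ?g \<xi> h \<partial>lborel) \<partial>lborel) = (\<integral>\<^sup>+\<xi>. \<integral>\<^sup>+h. ?F \<xi> * ?g \<xi> h \<partial>lborel \<partial>lborel)"
      by (intro nn_integral_cong nn_integral_cmult[symmetric]) measurable
    also have "\<dots> = (\<integral>\<^sup>+h. \<integral>\<^sup>+\<xi>. ?F \<xi> * ?g \<xi> h \<partial>lborel \<partial>lborel)"
      by (rule lborel_pair.Fubini') measurable
    also have "\<dots> \<le> (\<integral>\<^sup>+h. ennreal (4096 * E) * (ennreal (h powr (2 * s)) * indicator {0<..1/k} h) + ennreal (4096 * N) * (ennreal (h powr (1 + 4 * s)) * indicator {0<..1/k} h) \<partial>lborel)"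
    proof (rule nn_integral_mono)
      fix h :: real
      show "(\<integral>\<^sup>+\<xi>. ?F \<xi> * ?g \<xi> h \<partial>lborel) \<le> ennreal (4096 * E) * (ennreal (h powr (2 * s)) * indicator {0<..1/k} h) + ennreal (4096 * N) * (ennreal (h powr (1 + 4 * s)) * indicator {0<..1/k} h)"
      proof (cases "h \<in> {0<..1/k}")
        case True
        then have h: "0 < h" "h \<le> 1 / k" by auto
        have "(\<integral>\<^sup>+\<xi>. ?F \<xi> * ?g \<xi> h \<partial>lborel) = (\<integral>\<^sup>+\<xi>. ennreal (h powr (- 1 + 2 * s)) * (?F \<xi> * ennreal (?e \<xi> h)) \<partial>lborel)"
          using True by (intro nn_integral_cong) (simp add: ennreal_mult' mult_ac)
        also have "\<dots> = ennreal (h powr (- 1 + 2 * s)) * (\<integral>\<^sup>+\<xi>. ?F \<xi> * ennreal (?e \<xi> h) \<partial>lborel)"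
          by (rule nn_integral_cmult) measurable
        also have "\<dots> \<le> ennreal (h powr (- 1 + 2 * s)) * ennreal (4096 * (h * E + h powr (2 + 2 * s) * N))"
          by (intro mult_left_mono inner h) simp
        also have "\<dots> = ennreal (4096 * E * h powr (2 * s) + 4096 * N * h powr (1 + 4 * s))"
        proof -
          have "h powr (- 1 + 2 * s) * h = h powr (2 * s)" using h powr_add[of h "- 1 + 2 * s" 1] by simp
          moreover have "h powr (- 1 + 2 * s) * h powr (2 + 2 * s) = h powr (1 + 4 * s)" by (simp flip: powr_add)
          moreover have "a * (4096 * (h * E + b * N)) = 4096 * E * (a * h) + 4096 * N * (a * b)" for a b by (simp add: algebra_simps)
          ultimately show ?thesis by (subst ennreal_mult'[symmetric]) simp_all
        qed
        finally show ?thesis using True E N by (simp add: ennreal_mult')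
      qed simp
    qed
    also have "\<dots> = ennreal (4096 * E) * (\<integral>\<^sup>+h. ennreal (h powr (2 * s)) * indicator {0<..1/k} h \<partial>lborel) + ennreal (4096 * N) * (\<integral>\<^sup>+h. ennreal (h powr (1 + 4 * s)) * indicator {0<..1/k} h \<partial>lborel)"
      by (rule nn_integral_lincomb) measurable
    also have "\<dots> = ennreal (4096 * E) * ennreal ((1/k) powr (2 * s + 1) / (2 * s + 1)) + ennreal (4096 * N) * ennreal ((1/k) powr (1 + 4 * s + 1) / (1 + 4 * s + 1))"
      using s k by (subst (1 2) nn_integral_powr_from_0) auto
    also have "\<dots> \<le> ennreal (4096 / (1 + 2 * s) * (k powr (- 1 - 2 * s) * E + k powr (- 2 - 4 * s) * N))"
    proof -
      have inv: "(1 / k) powr a = k powr (- a)" for a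
        unfolding powr_minus_divide using powr_divide[of 1 k a] k by simp
      have p: "(1/k) powr (2 * s + 1) = k powr (- 1 - 2 * s)" "(1/k) powr (1 + 4 * s + 1) = k powr (- 2 - 4 * s)"
        unfolding inv by (simp_all add: algebra_simps)
      have "4096 * N * (k powr (- 2 - 4 * s) / (1 + 4 * s + 1)) \<le> 4096 * N * (k powr (- 2 - 4 * s) / (1 + 2 * s))"
        using s1 N by (intro mult_left_mono divide_left_mono) auto
      then have "4096 * E * (k powr (- 1 - 2 * s) / (2 * s + 1)) + 4096 * N * (k powr (- 2 - 4 * s) / (1 + 4 * s + 1))
         \<le> 4096 / (1 + 2 * s) * (k powr (- 1 - 2 * s) * E + k powr (- 2 - 4 * s) * N)"
        by (simp add: add_divide_distrib distrib_left mult_ac add.commute[of 1])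
      then show ?thesis unfolding p using E N s1
        by (subst (1 2) ennreal_mult'[symmetric]) (auto simp flip: ennreal_plus intro!: ennreal_leI)
    qed
    finally have G: "(\<integral>\<^sup>+\<xi>. ?F \<xi> * (\<integral>\<^sup>+h. ?g \<xi> h \<partial>lborel) \<partial>lborel) \<le> ennreal (4096 / (1 + 2 * s) * (k powr (- 1 - 2 * s) * E + k powr (- 2 - 4 * s) * N))" .
    have "(\<integral>\<^sup>+\<xi>. ennreal ((norm (fourier y \<xi>))\<^sup>2 * (\<xi>\<^sup>2 + 3 * k\<^sup>2) powr (- s)) \<partial>lborel)
      \<le> (\<integral>\<^sup>+\<xi>. ennreal (C1 * k powr (- 2 * s)) * ?F \<xi> + ennreal C1 * (?F \<xi> * (\<integral>\<^sup>+h. ?g \<xi> h \<partial>lborel)) \<partial>lborel)"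
    proof (rule nn_integral_mono)
      fix \<xi>
      have "ennreal ((norm (fourier y \<xi>))\<^sup>2 * (\<xi>\<^sup>2 + 3 * k\<^sup>2) powr (- s)) = ?F \<xi> * ennreal ((\<xi>\<^sup>2 + 3 * k\<^sup>2) powr (- s))"
        by (simp add: ennreal_mult')
      also have "\<dots> \<le> ?F \<xi> * (ennreal (C1 * k powr (- 2 * s)) + ennreal C1 * (\<integral>\<^sup>+h. ?g \<xi> h \<partial>lborel))"
        by (intro mult_left_mono C1(2) k) simp
      finally show "ennreal ((norm (fourier y \<xi>))\<^sup>2 * (\<xi>\<^sup>2 + 3 * k\<^sup>2) powr (- s)) \<le> ennreal (C1 * k powr (- 2 * s)) * ?F \<xi> + ennreal C1 * (?F \<xi> * (\<integral>\<^sup>+h. ?g \<xi> h \<partial>lborel))"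
        by (simp add: distrib_left mult_ac)
    qed
    also have "\<dots> = ennreal (C1 * k powr (- 2 * s)) * (\<integral>\<^sup>+\<xi>. ?F \<xi> \<partial>lborel) + ennreal C1 * (\<integral>\<^sup>+\<xi>. ?F \<xi> * (\<integral>\<^sup>+h. ?g \<xi> h \<partial>lborel) \<partial>lborel)"
      by (rule nn_integral_lincomb) measurable
    also have "\<dots> \<le> ennreal (C1 * k powr (- 2 * s)) * ennreal (64 * E / k) + ennreal C1 * ennreal (4096 / (1 + 2 * s) * (k powr (- 1 - 2 * s) * E + k powr (- 2 - 4 * s) * N))"
      by (intro add_mono mult_left_mono F2 G) auto
    also have "\<dots> \<le> ennreal (C * (k powr (- 1 - 2 * s) * E + k powr (- 2 - 4 * s) * N))"
    proof -
      have kk: "k powr (- 2 * s) / k = k powr (- 1 - 2 * s)"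
      proof -
        have e: "- 1 - 2 * s = - 2 * s - 1" by simp
        show ?thesis unfolding e powr_diff using k by simp
      qed
      have "C1 * k powr (- 2 * s) * (64 * E / k) = 64 * C1 * (k powr (- 2 * s) / k * E)" by simp
      also have "\<dots> \<le> 64 * C1 * (k powr (- 1 - 2 * s) * E + k powr (- 2 - 4 * s) * N)"
        unfolding kk using C1 N by (intro mult_left_mono) auto
      finally have *: "C1 * k powr (- 2 * s) * (64 * E / k) \<le> 64 * C1 * (k powr (- 1 - 2 * s) * E + k powr (- 2 - 4 * s) * N)" .
      define X where "X = k powr (- 1 - 2 * s) * E + k powr (- 2 - 4 * s) * N"
      have "C1 * (4096 / (1 + 2 * s) * X) = 4096 * C1 / (1 + 2 * s) * X" by simp
      with * have "C1 * k powr (- 2 * s) * (64 * E / k) + C1 * (4096 / (1 + 2 * s) * (k powr (- 1 - 2 * s) * E + k powr (- 2 - 4 * s) * N))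
         \<le> C * (k powr (- 1 - 2 * s) * E + k powr (- 2 - 4 * s) * N)"
        unfolding C_def X_def[symmetric] distrib_right[of _ _ X] by linarith
      then show ?thesis using C1 E N s1 k
        by (subst (1 2) ennreal_mult'[symmetric]) (auto simp flip: ennreal_plus intro!: ennreal_leI)
    qed
    finally show ?thesis .
  qed
  with Cp show thesis by (rule that)
qed

text \<open>Duality of H^s and H^-s in the formula
  \<open>ln A = - 2 * \<integral> Re (q * cnj y)\<close>. The squared H^-s norm of \<open>y\<close>
  is bounded linearly in \<open>ln A\<close>, so that part of it can be absorbed on the left. The
  data may be arbitrarily large.\<close>

theorem jost_upper:
  assumes s: "- 1 / 2 < s" "s < 0"
  shows "\<exists>C>0. \<forall>k q m c A. k > 0 \<and> cdec q \<and> jost k q m c \<and> (m \<longlongrightarrow> A) at_top \<longrightarrow>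
    ln A \<le> C * k powr (- 1 - 2 * s) * sobolev_sq s k q"
proof (rule fractional_norm_bound[OF s])
  fix C :: real assume C: "C > 0" "\<And>k y E N. k > 0 \<Longrightarrow> cdec y \<Longrightarrow> E \<ge> 0 \<Longrightarrow> N \<ge> 0 \<Longrightarrow>
      (LINT x|lborel. (norm (y x))\<^sup>2) \<le> 64 * E / k \<Longrightarrow>
      (\<And>h. 0 < h \<Longrightarrow> h \<le> 1 / k \<Longrightarrow> (LINT x|lborel. (norm (y (x + h) - y x))\<^sup>2) \<le> 4096 * (h * E + h powr (2 + 2 * s) * N))
     \<Longrightarrow> (\<integral>\<^sup>+\<xi>. ennreal ((norm (fourier y \<xi>))\<^sup>2 * (\<xi>\<^sup>2 + 3 * k\<^sup>2) powr (- s)) \<partial>lborel)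
        \<le> ennreal (C * (k powr (- 1 - 2 * s) * E + k powr (- 2 - 4 * s) * N))"
  have "ln A \<le> (4 * C + 1) * k powr (- 1 - 2 * s) * sobolev_sq s k q"
    if k: "k > 0" and q: "cdec q" and j: "jost k q m c" and A: "(m \<longlongrightarrow> A) at_top" for k q m c A
  proof -
    obtain A' w y n \<rho> where S: "(m \<longlongrightarrow> A') at_top" "A' \<ge> 1" "cdec w" "cdec y" "cdec n" "cdec \<rho>" "\<And>x. \<rho> x \<ge> 0"
      "k * (LINT x|lborel. \<rho> x) = ln A'"
      "\<And>x. (w has_vector_derivative (of_real k * \<beta> * w x - q x + of_real k * n x)) (at x)"
      "\<And>x. norm (n x) \<le> \<rho> x" "\<And>x. (norm (w x))\<^sup>2 \<le> \<rho> x"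
      "\<And>x. norm (y x) \<le> 8 * norm (w x)" "\<And>x x'. norm (y x - y x') \<le> 2" "\<And>x x'. norm (y x - y x') \<le> 8 * norm (w x - w x')"
      "ln A' = - 2 * (LINT x|lborel. Re (q x * cnj (y x)))"
      by (rule jost_structure[OF k q j]) (rule that; assumption)
    have AA: "A' = A" using tendsto_unique[OF trivial_limit_at_top_linorder S(1) A] .
    define E where "E = ln A"
    have E0: "E \<ge> 0" using S(2) AA by (simp add: E_def)
    define N where "N = sobolev_sq s k q"
    have N0: "N \<ge> 0" by (simp add: N_def sobolev_sq_nonneg)
    define K where "K = k powr (- 1 - 2 * s)"
    have K: "K > 0" using k by (simp add: K_def)
    have K2: "k powr (- 2 - 4 * s) = K * K" unfolding K_def by (simp flip: powr_add)
    have yE: "(LINT x|lborel. (norm (y x))\<^sup>2) \<le> 64 * E / k"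
    proof -
      have "(LINT x|lborel. (norm (y x))\<^sup>2) \<le> (LINT x|lborel. 64 * \<rho> x)"
      proof (intro integral_mono cdec_sq_integrable S integrable_mult_right cdec_integrable)
        fix x
        have "(norm (y x))\<^sup>2 \<le> (8 * norm (w x))\<^sup>2" by (intro power_mono S) simp
        also have "\<dots> \<le> 64 * \<rho> x" using S(11)[of x] by (simp add: power_mult_distrib)
        finally show "(norm (y x))\<^sup>2 \<le> 64 * \<rho> x" .
      qed
      also have "\<dots> = 64 * E / k" using S(8) k AA by (simp add: E_def field_simps)
      finally show ?thesis .
    qed
    define Yb where "Yb = C * (K * E + K * K * N)"
    have "(\<integral>\<^sup>+\<xi>. ennreal ((norm (fourier y \<xi>))\<^sup>2 * (\<xi>\<^sup>2 + 3 * k\<^sup>2) powr (- s)) \<partial>lborel) \<le> ennreal Yb"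
      unfolding Yb_def K2[symmetric] unfolding K_def
      by (rule C(2)[OF k S(4) E0 N0 yE], unfold N_def E_def)
         (rule shift_difference_L2[OF s k _ _ q S(3-8)[unfolded AA] S(9-11) S(13,14)])
    moreover have Yb0: "Yb \<ge> 0" using C K E0 N0 by (simp add: Yb_def)
    ultimately have Y: "integrable lborel (\<lambda>\<xi>. (norm (fourier y \<xi>))\<^sup>2 * (\<xi>\<^sup>2 + 3 * k\<^sup>2) powr (- s))"
      "(LINT \<xi>|lborel. (norm (fourier y \<xi>))\<^sup>2 * (\<xi>\<^sup>2 + 3 * k\<^sup>2) powr (- s)) \<le> Yb"
    proof -
      assume le: "(\<integral>\<^sup>+\<xi>. ennreal ((norm (fourier y \<xi>))\<^sup>2 * (\<xi>\<^sup>2 + 3 * k\<^sup>2) powr (- s)) \<partial>lborel) \<le> ennreal Yb"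
      note fourier_measurable[OF cdec_integrable[OF S(4)], measurable]
      show i: "integrable lborel (\<lambda>\<xi>. (norm (fourier y \<xi>))\<^sup>2 * (\<xi>\<^sup>2 + 3 * k\<^sup>2) powr (- s))"
        using le by (intro integrableI_nonneg) (auto intro: le_less_trans)
      show "(LINT \<xi>|lborel. (norm (fourier y \<xi>))\<^sup>2 * (\<xi>\<^sup>2 + 3 * k\<^sup>2) powr (- s)) \<le> Yb"
        using le Yb0 by (subst (asm) nn_integral_eq_integral[OF i]) (auto simp: ennreal_le_iff)
    qed
    \<comment> \<open>The parameter of Young's inequality: it makes
      \<open>(1 / \<Lambda>) * Yb\<close> equal to \<open>(E + K * N) / 2\<close>, so exactly half
      of \<open>E\<close> stays on the right.\<close>
    define \<Lambda> where "\<Lambda> = 2 * C * K"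
    have \<Lambda>: "\<Lambda> > 0" using C K by (simp add: \<Lambda>_def)
    note Ni = sobolev_sq_integrable[OF q k s(2)]
    have "E = - 2 * (LINT x|lborel. Re (q x * cnj (y x)))" using S(15) AA by (simp add: E_def)
    also have "(LINT x|lborel. Re (q x * cnj (y x))) = Re (LINT x|lborel. q x * cnj (y x))"
      by (intro integral_Re cdec_integrable cdec_mult cdec_cnj q S)
    also have "(LINT x|lborel. q x * cnj (y x)) = (LINT \<xi>|lborel. fourier q \<xi> * cnj (fourier y \<xi>))"
      by (rule parseval[OF q S(4), symmetric])
    also have "- 2 * Re (LINT \<xi>|lborel. fourier q \<xi> * cnj (fourier y \<xi>)) \<le> 2 * norm (LINT \<xi>|lborel. fourier q \<xi> * cnj (fourier y \<xi>))"
      using abs_Re_le_cmod[of "LINT \<xi>|lborel. fourier q \<xi> * cnj (fourier y \<xi>)"] by simp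
    also have "\<dots> = norm (LINT \<xi>|lborel. 2 * (fourier q \<xi> * cnj (fourier y \<xi>)))" by (simp add: norm_mult)
    also have "\<dots> \<le> (LINT \<xi>|lborel. \<Lambda> * ((norm (fourier q \<xi>))\<^sup>2 * (\<xi>\<^sup>2 + 3 * k\<^sup>2) powr s) + (1 / \<Lambda>) * ((norm (fourier y \<xi>))\<^sup>2 * (\<xi>\<^sup>2 + 3 * k\<^sup>2) powr (- s)))"
    proof -
      note fourier_measurable[OF cdec_integrable[OF S(4)], measurable] fourier_measurable[OF cdec_integrable[OF q], measurable]
      have iR: "integrable lborel (\<lambda>\<xi>. \<Lambda> * ((norm (fourier q \<xi>))\<^sup>2 * (\<xi>\<^sup>2 + 3 * k\<^sup>2) powr s) + (1 / \<Lambda>) * ((norm (fourier y \<xi>))\<^sup>2 * (\<xi>\<^sup>2 + 3 * k\<^sup>2) powr (- s)))"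
        by (intro Bochner_Integration.integrable_add integrable_mult_right Ni Y)
      have le: "norm (2 * (fourier q \<xi> * cnj (fourier y \<xi>))) \<le> \<Lambda> * ((norm (fourier q \<xi>))\<^sup>2 * (\<xi>\<^sup>2 + 3 * k\<^sup>2) powr s) + (1 / \<Lambda>) * ((norm (fourier y \<xi>))\<^sup>2 * (\<xi>\<^sup>2 + 3 * k\<^sup>2) powr (- s))" for \<xi>
      proof -
        define p where "p = \<Lambda> * (\<xi>\<^sup>2 + 3 * k\<^sup>2) powr s"
        have p: "p > 0" using \<Lambda> weight_pos[OF k, of \<xi>] by (simp add: p_def)
        have pm: "(1 / \<Lambda>) * (\<xi>\<^sup>2 + 3 * k\<^sup>2) powr (- s) = 1 / p" by (simp add: p_def powr_minus_divide)
        have "2 * (a * b) \<le> p * a\<^sup>2 + 1 / p * b\<^sup>2" for a b :: real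
        proof -
          have "2 * (sqrt p * a) * (b / sqrt p) \<le> (sqrt p * a)\<^sup>2 + (b / sqrt p)\<^sup>2" by (rule sum_squares_bound)
          then show ?thesis using p by (simp add: power_mult_distrib power_divide)
        qed
        from this[of "norm (fourier q \<xi>)" "norm (fourier y \<xi>)"] show ?thesis
          unfolding pm[symmetric] unfolding p_def by (simp add: norm_mult mult_ac)
      qed
      have "integrable lborel (\<lambda>\<xi>. 2 * (fourier q \<xi> * cnj (fourier y \<xi>)))"
        by (rule Bochner_Integration.integrable_bound[OF iR]) (measurable, intro AE_I2 order_trans[OF le], simp)
      then show ?thesis by (rule Bochner_Integration.integral_norm_bound_integral[OF _ iR le])
    qed
    also have "\<dots> = \<Lambda> * N + (1 / \<Lambda>) * (LINT \<xi>|lborel. (norm (fourier y \<xi>))\<^sup>2 * (\<xi>\<^sup>2 + 3 * k\<^sup>2) powr (- s))"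
      unfolding N_def sobolev_sq_def
      by (subst Bochner_Integration.integral_add) (intro integrable_mult_right Ni Y, intro integrable_mult_right Ni Y, simp only: integral_mult_right_zero)
    also have "\<dots> \<le> \<Lambda> * N + (1 / \<Lambda>) * Yb" using \<Lambda> by (intro add_left_mono mult_left_mono Y) auto
    also have "(1 / \<Lambda>) * Yb = (E + K * N) / 2" using C K by (simp add: \<Lambda>_def Yb_def field_simps)
    finally have "E \<le> \<Lambda> * N + (E + K * N) / 2" .
    then have "E \<le> 2 * (\<Lambda> * N) + K * N" by argo
    also have "\<dots> = (4 * C + 1) * K * N" by (simp add: \<Lambda>_def algebra_simps)
    finally show ?thesis by (simp add: E_def K_def N_def)
  qed
  moreover have "4 * C + 1 > 0" using C by simp
  ultimately show ?thesis by blast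
qed

section \<open>Bounds for the Sobolev norms\<close>

text \<open>The conclusion of \<open>jost_upper\<close>, named because it will be used for one and
  the same energy at two regularities, \<open>s\<close> and a lower one.\<close>

definition growth_bound :: "real \<Rightarrow> real \<Rightarrow> bool" where
  "growth_bound s C \<longleftrightarrow> (\<forall>k q m c A. k > 0 \<and> cdec q \<and> jost k q m c \<and> (m \<longlongrightarrow> A) at_top \<longrightarrow>
     ln A \<le> C * k powr (- 1 - 2 * s) * sobolev_sq s k q)"

text \<open>\<open>E k\<close> is \<open>ln A\<close> at time 0. By conservation the lower bounds
  hold with it at every time, whereas the upper bound is evaluated at the initial data. Past this
  point only these inequalities are used, no longer the equation.\<close>

lemma conserved_energy:
  assumes q: "schwartz_solution q"
  shows "\<exists>E. (\<forall>k>0. E k \<ge> 0) \<and>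
    (\<forall>k>0. \<forall>t. (\<integral>\<^sup>+\<xi>. ennreal ((norm (fourier (q t) \<xi>))\<^sup>2 * (k / (\<xi>\<^sup>2 + 3 * k\<^sup>2))) \<partial>lborel) \<le> ennreal (4 * E k + (E k)\<^sup>2)) \<and>
    (\<forall>k>0. \<forall>t \<eta>. 0 < \<eta> \<longrightarrow> \<eta> \<le> k \<longrightarrow>
      (\<integral>\<^sup>+\<xi>. ennreal ((norm (fourier (q t) \<xi>))\<^sup>2) * indicator {-\<eta>..\<eta>} \<xi> \<partial>lborel) \<le> ennreal (16 * k * E k + \<eta> * (E k)\<^sup>2)) \<and>
    (\<forall>k>0. \<forall>s C. growth_bound s C \<longrightarrow> E k \<le> C * k powr (- 1 - 2 * s) * sobolev_sq s k (q 0))"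
proof -
  note cq = schwartz_solution_cdec[OF q]
  let ?P = "\<lambda>k e. e \<ge> 0 \<and>
    (\<forall>t. (\<integral>\<^sup>+\<xi>. ennreal ((norm (fourier (q t) \<xi>))\<^sup>2 * (k / (\<xi>\<^sup>2 + 3 * k\<^sup>2))) \<partial>lborel) \<le> ennreal (4 * e + e\<^sup>2)) \<and>
    (\<forall>t \<eta>. 0 < \<eta> \<longrightarrow> \<eta> \<le> k \<longrightarrow>
      (\<integral>\<^sup>+\<xi>. ennreal ((norm (fourier (q t) \<xi>))\<^sup>2) * indicator {-\<eta>..\<eta>} \<xi> \<partial>lborel) \<le> ennreal (16 * k * e + \<eta> * e\<^sup>2)) \<and>
    (\<forall>s C. growth_bound s C \<longrightarrow> e \<le> C * k powr (- 1 - 2 * s) * sobolev_sq s k (q 0))"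
  have ex: "\<exists>e. ?P k e" if k: "k > 0" for k
  proof -
    have "\<forall>t. \<exists>m c. jost k (q t) m c" using jost_exists[OF k cq] by blast
    then obtain M C where MC: "\<And>t. jost k (q t) (M t) (C t)" by metis
    have "\<exists>A. (M t \<longlongrightarrow> A) at_top" for t
      by (rule jost_structure[OF k cq MC]) blast
    then obtain A where A: "\<And>t. (M t \<longlongrightarrow> A t) at_top" by metis
    have "(M t \<longlongrightarrow> A 0) at_top" for t using A[of t] jost_conserved[OF q k MC A, of t] by metis
    note L = jost_lower[OF k cq MC this]
    have "ln (A 0) \<ge> 0" using L(1) by simp
    moreover have "ln (A 0) \<le> C' * k powr (- 1 - 2 * s) * sobolev_sq s k (q 0)" if "growth_bound s C'" for s C'
      using that k cq MC A unfolding growth_bound_def by blast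
    ultimately have "?P k (ln (A 0))" using L by blast
    then show ?thesis by blast
  qed
  have "\<exists>E. \<forall>k. k > 0 \<longrightarrow> ?P k (E k)"
    by (rule choice) (use ex in blast)
  then obtain E where E: "\<forall>k. k > 0 \<longrightarrow> ?P k (E k)" by (rule exE)
  have P: "?P k (E k)" if "k > 0" for k by (rule E[THEN spec, of k, THEN mp, OF that])
  show ?thesis
    by (intro exI[of _ E] conjI allI impI)
      (rule P[THEN conjunct1] P[THEN conjunct2, THEN conjunct1, rule_format] P[THEN conjunct2, THEN conjunct2, THEN conjunct1, rule_format]
        P[THEN conjunct2, THEN conjunct2, THEN conjunct2, rule_format]; assumption)+
qed

lemma sobolev_sq_nn:
  assumes "cdec f" "k > 0" "s < 0"
  shows "(\<integral>\<^sup>+\<xi>. ennreal ((norm (fourier f \<xi>))\<^sup>2 * (\<xi>\<^sup>2 + 3 * k\<^sup>2) powr s) \<partial>lborel) = ennreal (sobolev_sq s k f)"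
  unfolding sobolev_sq_def by (rule nn_integral_eq_integral[OF sobolev_sq_integrable[OF assms]]) simp

lemma sobolev_sq_antimono:
  assumes f: "cdec f" and k: "0 < k" "k \<le> l" and s: "s < 0"
  shows "sobolev_sq s l f \<le> sobolev_sq s k f"
proof -
  have l: "l > 0" using k by simp
  show ?thesis unfolding sobolev_sq_def
  proof (rule integral_mono[OF sobolev_sq_integrable[OF f l s] sobolev_sq_integrable[OF f k(1) s]])
    fix \<xi> :: real
    have "k\<^sup>2 \<le> l\<^sup>2" using k by (intro power_mono) auto
    then have "(\<xi>\<^sup>2 + 3 * l\<^sup>2) powr s \<le> (\<xi>\<^sup>2 + 3 * k\<^sup>2) powr s"
      using weight_pos[OF k(1), of \<xi>] s by (intro powr_mono2') auto
    then show "(norm (fourier f \<xi>))\<^sup>2 * (\<xi>\<^sup>2 + 3 * l\<^sup>2) powr s \<le> (norm (fourier f \<xi>))\<^sup>2 * (\<xi>\<^sup>2 + 3 * k\<^sup>2) powr s"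
      by (intro mult_left_mono) auto
  qed
qed

section \<open>Averages over the spectral parameter\<close>

lemma sq_powr: "(X::real) > 0 \<Longrightarrow> (X\<^sup>2) powr s = X powr (2 * s)"
  by (simp add: powr_powr flip: powr_numeral)

lemma powr_lower_half: "- 1 / 2 < s \<Longrightarrow> (1 / 2 :: real) \<le> 2 powr (2 * s)"
  using powr_mono[of "-1" "2 * s" 2] by (simp add: powr_minus)

lemma nn_integral_powr_to_inf:
  assumes "e < - 1" "a > 0"
  shows "(\<integral>\<^sup>+x. ennreal (x powr e) * indicator {a..} x \<partial>lborel) = ennreal (- (a powr (e + 1)) / (e + 1))"
  by (rule nn_integral_has_integral_lebesgue'[OF _ has_integral_powr_to_inf[OF assms]]) simp

text \<open>With \<open>X^2 = \<xi>^2 + 3 * k^2\<close>, only \<open>\<kappa>\<close> between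
  \<open>X\<close> and \<open>2 * X\<close> is kept. There \<open>\<kappa> powr (2 * s)\<close> is
  at least half of \<open>X powr (2 * s)\<close> and the Lorentzian is at least
  \<open>1 / (13 * X)\<close>, whence \<open>26 = 2 * 13\<close>.\<close>

lemma weight_le_nn_integral:
  assumes s: "- 1 / 2 < s" "s < 0" and k: "k > 0"
  shows "ennreal ((\<xi>\<^sup>2 + 3 * k\<^sup>2) powr s)
    \<le> ennreal 26 * (\<integral>\<^sup>+\<kappa>. ennreal (\<kappa> powr (2 * s) * (\<kappa> / (\<xi>\<^sup>2 + 3 * \<kappa>\<^sup>2))) * indicator {k..} \<kappa> \<partial>lborel)"
proof -
  define X where "X = sqrt (\<xi>\<^sup>2 + 3 * k\<^sup>2)"
  have X2: "X\<^sup>2 = \<xi>\<^sup>2 + 3 * k\<^sup>2" unfolding X_def using weight_pos[OF k, of \<xi>] by simp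
  have kX: "k \<le> X" unfolding X_def by (rule real_le_rsqrt) simp
  then have X: "X > 0" using k by simp
  have xiX: "\<xi>\<^sup>2 \<le> X\<^sup>2" unfolding X2 by simp
  have pt: "X powr (2 * s) / (26 * X) \<le> \<kappa> powr (2 * s) * (\<kappa> / (\<xi>\<^sup>2 + 3 * \<kappa>\<^sup>2))" if "X \<le> \<kappa>" "\<kappa> \<le> 2 * X" for \<kappa>
  proof -
    have kp: "\<kappa> > 0" using that X by simp
    have "(2 * X) powr (2 * s) \<le> \<kappa> powr (2 * s)" using that X s by (intro powr_mono2') auto
    moreover have "(2 * X) powr (2 * s) = 2 powr (2 * s) * X powr (2 * s)" using X by (simp add: powr_mult)
    moreover have "1 / 2 * X powr (2 * s) \<le> 2 powr (2 * s) * X powr (2 * s)"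
      using powr_lower_half[OF s(1)] by (intro mult_right_mono) auto
    ultimately have a: "1 / 2 * X powr (2 * s) \<le> \<kappa> powr (2 * s)" by simp
    have "\<kappa>\<^sup>2 \<le> (2 * X)\<^sup>2" using that kp by (intro power_mono) auto
    then have d: "\<xi>\<^sup>2 + 3 * \<kappa>\<^sup>2 \<le> 13 * X\<^sup>2" using xiX by (simp add: power_mult_distrib)
    have "1 / (13 * X) = X / (13 * X\<^sup>2)" using X by (simp add: power2_eq_square)
    also have "\<dots> \<le> \<kappa> / (\<xi>\<^sup>2 + 3 * \<kappa>\<^sup>2)" using that X d weight_pos[OF kp, of \<xi>] by (intro frac_le) auto
    finally have b: "1 / (13 * X) \<le> \<kappa> / (\<xi>\<^sup>2 + 3 * \<kappa>\<^sup>2)" .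
    have "X powr (2 * s) / (26 * X) = (1 / 2 * X powr (2 * s)) * (1 / (13 * X))" by simp
    also have "\<dots> \<le> \<kappa> powr (2 * s) * (\<kappa> / (\<xi>\<^sup>2 + 3 * \<kappa>\<^sup>2))" using a b X by (intro mult_mono) auto
    finally show ?thesis .
  qed
  have "ennreal ((\<xi>\<^sup>2 + 3 * k\<^sup>2) powr s) = ennreal 26 * (ennreal (X powr (2 * s) / (26 * X)) * ennreal X)"
  proof -
    have "ennreal (26 * (a * X)) = ennreal 26 * (ennreal a * ennreal X)" if "a \<ge> 0" for a
      using that X by (subst ennreal_mult, simp, simp) (subst ennreal_mult, auto)
    from this[of "X powr (2 * s) / (26 * X)"] show ?thesis
      using X sq_powr[OF X, of s] unfolding X2[symmetric] by simp
  qed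
  also have "\<dots> = ennreal 26 * (\<integral>\<^sup>+\<kappa>. ennreal (X powr (2 * s) / (26 * X)) * indicator {X..2 * X} \<kappa> \<partial>lborel)"
    using X by (simp add: nn_integral_cmult)
  also have "\<dots> \<le> ennreal 26 * (\<integral>\<^sup>+\<kappa>. ennreal (\<kappa> powr (2 * s) * (\<kappa> / (\<xi>\<^sup>2 + 3 * \<kappa>\<^sup>2))) * indicator {k..} \<kappa> \<partial>lborel)"
    using pt kX by (intro mult_left_mono nn_integral_mono) (auto simp: indicator_def intro!: ennreal_leI)
  finally show ?thesis .
qed

text \<open>The converse comparison, split at \<open>X = sqrt (\<xi>^2 + 3 * k^2)\<close>. Below
  \<open>X\<close> the weight is at most \<open>X powr (2 * r)\<close> and \<open>r < s\<close>
  gives integrability at 0; above, it is at most \<open>\<kappa> powr (2 * r)\<close> and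
  \<open>s < 0\<close> gives integrability at infinity. For \<open>r = s\<close> the lower part
  would be logarithmic.\<close>

lemma nn_integral_le_weight:
  assumes r: "r < s" "s < 0" and k: "k > 0"
  shows "(\<integral>\<^sup>+\<kappa>. ennreal (\<kappa> powr (2 * s - 1 - 2 * r) * (\<xi>\<^sup>2 + 3 * \<kappa>\<^sup>2) powr r) * indicator {k..} \<kappa> \<partial>lborel)
    \<le> ennreal ((1 / (2 * (s - r)) - 1 / (2 * s)) * (\<xi>\<^sup>2 + 3 * k\<^sup>2) powr s)"
proof -
  define X where "X = sqrt (\<xi>\<^sup>2 + 3 * k\<^sup>2)"
  have X2: "X\<^sup>2 = \<xi>\<^sup>2 + 3 * k\<^sup>2" unfolding X_def using weight_pos[OF k, of \<xi>] by simp
  have kX: "k \<le> X" unfolding X_def by (rule real_le_rsqrt) simp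
  then have X: "X > 0" using k by simp
  have low: "\<kappa> powr (2 * s - 1 - 2 * r) * (\<xi>\<^sup>2 + 3 * \<kappa>\<^sup>2) powr r \<le> X powr (2 * r) * \<kappa> powr (2 * s - 1 - 2 * r)" if "k \<le> \<kappa>" for \<kappa>
  proof -
    have "k\<^sup>2 \<le> \<kappa>\<^sup>2" using that k by (intro power_mono) auto
    then have "(\<xi>\<^sup>2 + 3 * \<kappa>\<^sup>2) powr r \<le> (X\<^sup>2) powr r" using X r X2 weight_pos[OF k, of \<xi>] by (intro powr_mono2') auto
    then have "\<kappa> powr (2 * s - 1 - 2 * r) * (\<xi>\<^sup>2 + 3 * \<kappa>\<^sup>2) powr r \<le> \<kappa> powr (2 * s - 1 - 2 * r) * X powr (2 * r)"
      unfolding sq_powr[OF X] by (intro mult_left_mono) auto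
    then show ?thesis by (simp only: mult.commute)
  qed
  have high: "\<kappa> powr (2 * s - 1 - 2 * r) * (\<xi>\<^sup>2 + 3 * \<kappa>\<^sup>2) powr r \<le> \<kappa> powr (2 * s - 1)" if "k \<le> \<kappa>" for \<kappa>
  proof -
    have kp: "\<kappa> > 0" using that k by simp
    have "(\<xi>\<^sup>2 + 3 * \<kappa>\<^sup>2) powr r \<le> (\<kappa>\<^sup>2) powr r" using kp r by (intro powr_mono2') auto
    then have "\<kappa> powr (2 * s - 1 - 2 * r) * (\<xi>\<^sup>2 + 3 * \<kappa>\<^sup>2) powr r \<le> \<kappa> powr (2 * s - 1 - 2 * r) * \<kappa> powr (2 * r)"
      unfolding sq_powr[OF kp] by (intro mult_left_mono) auto
    also have "\<dots> = \<kappa> powr (2 * s - 1)" by (simp flip: powr_add)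
    finally show ?thesis .
  qed
  have "(\<integral>\<^sup>+\<kappa>. ennreal (\<kappa> powr (2 * s - 1 - 2 * r) * (\<xi>\<^sup>2 + 3 * \<kappa>\<^sup>2) powr r) * indicator {k..} \<kappa> \<partial>lborel)
    \<le> (\<integral>\<^sup>+\<kappa>. ennreal (X powr (2 * r)) * (ennreal (\<kappa> powr (2 * s - 1 - 2 * r)) * indicator {0<..X} \<kappa>)
         + 1 * (ennreal (\<kappa> powr (2 * s - 1)) * indicator {X..} \<kappa>) \<partial>lborel)"
  proof (rule nn_integral_mono)
    fix \<kappa> :: real
    show "ennreal (\<kappa> powr (2 * s - 1 - 2 * r) * (\<xi>\<^sup>2 + 3 * \<kappa>\<^sup>2) powr r) * indicator {k..} \<kappa>
      \<le> ennreal (X powr (2 * r)) * (ennreal (\<kappa> powr (2 * s - 1 - 2 * r)) * indicator {0<..X} \<kappa>)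
         + 1 * (ennreal (\<kappa> powr (2 * s - 1)) * indicator {X..} \<kappa>)"
    proof (cases "k \<le> \<kappa>")
      case True
      show ?thesis
      proof (cases "\<kappa> \<le> X")
        case le: True
        have "ennreal (\<kappa> powr (2 * s - 1 - 2 * r) * (\<xi>\<^sup>2 + 3 * \<kappa>\<^sup>2) powr r) \<le> ennreal (X powr (2 * r)) * ennreal (\<kappa> powr (2 * s - 1 - 2 * r))"
          unfolding ennreal_mult'[symmetric, OF powr_ge_zero] by (rule ennreal_leI[OF low[OF True]])
        then show ?thesis using True le k by (simp add: indicator_def add_increasing2)
      next
        case False
        then show ?thesis using True high[OF True] by (simp add: indicator_def ennreal_leI)
      qed
    qed simp
  qed
  also have "\<dots> = ennreal (X powr (2 * r)) * (\<integral>\<^sup>+\<kappa>. ennreal (\<kappa> powr (2 * s - 1 - 2 * r)) * indicator {0<..X} \<kappa> \<partial>lborel)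
      + 1 * (\<integral>\<^sup>+\<kappa>. ennreal (\<kappa> powr (2 * s - 1)) * indicator {X..} \<kappa> \<partial>lborel)"
    by (rule nn_integral_lincomb) measurable
  also have "\<dots> = ennreal (X powr (2 * r)) * ennreal (X powr (2 * s - 2 * r) / (2 * s - 2 * r)) + ennreal (- (X powr (2 * s)) / (2 * s))"
    using nn_integral_powr_from_0[of "2 * s - 1 - 2 * r" X] nn_integral_powr_to_inf[of "2 * s - 1" X] r X by (simp add: algebra_simps)
  also have "\<dots> = ennreal (X powr (2 * s) / (2 * s - 2 * r) + - (X powr (2 * s)) / (2 * s))"
  proof -
    have e: "X powr (2 * r) * (X powr (2 * s - 2 * r) / (2 * s - 2 * r)) = X powr (2 * s) / (2 * s - 2 * r)"
      by (simp flip: powr_add)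
    have "ennreal (X powr (2 * r)) * ennreal (X powr (2 * s - 2 * r) / (2 * s - 2 * r)) = ennreal (X powr (2 * s) / (2 * s - 2 * r))"
      unfolding e[symmetric] by (rule ennreal_mult'[symmetric]) simp
    then show ?thesis using r by (simp add: divide_nonneg_neg divide_nonpos_neg flip: ennreal_plus)
  qed
  also have "\<dots> = ennreal ((1 / (2 * (s - r)) - 1 / (2 * s)) * (\<xi>\<^sup>2 + 3 * k\<^sup>2) powr s)"
    unfolding X2[symmetric] sq_powr[OF X] by (simp add: algebra_simps)
  finally show ?thesis .
qed

text \<open>The smallness at \<open>k\<close> persists for all \<open>\<kappa> \<ge> k\<close>,
  since both factors decrease in \<open>\<kappa>\<close>. It gives
  \<open>E \<kappa> \<le> 1\<close>, so
  \<open>4 * E \<kappa> + (E \<kappa>)^2 \<le> 5 * E \<kappa>\<close>, and the lower bound at time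
  \<open>t\<close> is linear in the energy. Averaging over \<open>\<kappa>\<close> with
  \<open>weight_le_nn_integral\<close> at time \<open>t\<close> and
  \<open>nn_integral_le_weight\<close> at time 0 yields the constant
  \<open>130 = 26 * 5\<close>.\<close>

lemma high_frequency_bound:
  assumes s: "- 1 / 2 < s" "s < 0" and C1: "growth_bound s C1" "C1 > 0"
  obtains C where "C > 0" "\<And>q k t. schwartz_solution q \<Longrightarrow> k > 0 \<Longrightarrow>
    C1 * k powr (- 1 - 2 * s) * sobolev_sq s k (q 0) \<le> 1 \<Longrightarrow> sobolev_sq s k (q t) \<le> C * sobolev_sq s k (q 0)"
proof -
  \<comment> \<open>The midpoint of \<open>- 1 / 2\<close> and \<open>s\<close>. Smallness of the
    energy is tested at \<open>s\<close>, but its size is then bounded by the data at regularity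
    \<open>r\<close>.\<close>
  define r where "r = (s - 1 / 2) / 2"
  have r: "- 1 / 2 < r" "r < s" "r < 0" using s unfolding r_def by auto
  obtain C2 where C2: "C2 > 0" "growth_bound r C2" using jost_upper[OF r(1,3)] unfolding growth_bound_def by blast
  define D where "D = 1 / (2 * (s - r)) - 1 / (2 * s)"
  have "1 / (2 * s) < 0" "1 / (2 * (s - r)) > 0" using r s by (auto simp: divide_pos_neg)
  then have D: "D > 0" unfolding D_def by linarith
  show ?thesis
  proof (rule that[of "130 * C2 * D"])
    show "130 * C2 * D > 0" using C2 D by simp
    fix q :: "real \<Rightarrow> real \<Rightarrow> complex" and k t :: real
    assume q: "schwartz_solution q" and k: "k > 0" and small: "C1 * k powr (- 1 - 2 * s) * sobolev_sq s k (q 0) \<le> 1"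
    note cq = schwartz_solution_cdec[OF q]
    note fourier_measurable[OF cdec_integrable[OF cq], measurable]
    define F where "F t \<xi> = (norm (fourier (q t) \<xi>))\<^sup>2" for t \<xi>
    have F0: "F t \<xi> \<ge> 0" for t \<xi> by (simp add: F_def)
    have [measurable]: "F t \<in> borel_measurable borel" for t unfolding F_def[abs_def] by measurable
    obtain E where E0: "\<forall>k>0. E k \<ge> 0"
      and E1: "\<forall>k>0. \<forall>t. (\<integral>\<^sup>+\<xi>. ennreal (F t \<xi> * (k / (\<xi>\<^sup>2 + 3 * k\<^sup>2))) \<partial>lborel) \<le> ennreal (4 * E k + (E k)\<^sup>2)"
      and E2: "\<forall>k>0. \<forall>s C. growth_bound s C \<longrightarrow> E k \<le> C * k powr (- 1 - 2 * s) * sobolev_sq s k (q 0)"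
      using conserved_energy[OF q] unfolding F_def by blast
    note E0 = E0[rule_format] and E1 = E1[rule_format] and E2 = E2[rule_format]
    have E3: "(\<integral>\<^sup>+\<xi>. ennreal (F t \<xi> * (\<kappa> / (\<xi>\<^sup>2 + 3 * \<kappa>\<^sup>2))) \<partial>lborel)
      \<le> ennreal (5 * C2 * \<kappa> powr (- 1 - 2 * r)) * (\<integral>\<^sup>+\<xi>. ennreal (F 0 \<xi> * (\<xi>\<^sup>2 + 3 * \<kappa>\<^sup>2) powr r) \<partial>lborel)" if l: "k \<le> \<kappa>" for \<kappa>
    proof -
      have p: "\<kappa> > 0" using l k by simp
      have "\<kappa> powr (- 1 - 2 * s) * sobolev_sq s \<kappa> (q 0) \<le> k powr (- 1 - 2 * s) * sobolev_sq s k (q 0)"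
        using s k l sobolev_sq_antimono[OF cq k l s(2)] by (intro mult_mono powr_mono2' sobolev_sq_nonneg) auto
      then have "C1 * (\<kappa> powr (- 1 - 2 * s) * sobolev_sq s \<kappa> (q 0)) \<le> C1 * (k powr (- 1 - 2 * s) * sobolev_sq s k (q 0))"
        using C1(2) by (intro mult_left_mono) auto
      then have "E \<kappa> \<le> 1" using E2[OF p C1(1)] small by (simp add: mult.assoc)
      then have "(E \<kappa>)\<^sup>2 \<le> E \<kappa>" using E0[OF p] by (simp add: power2_eq_square mult_left_le)
      then have "4 * E \<kappa> + (E \<kappa>)\<^sup>2 \<le> 5 * E \<kappa>" by simp
      also have "\<dots> \<le> (5 * C2 * \<kappa> powr (- 1 - 2 * r)) * sobolev_sq r \<kappa> (q 0)" using E2[OF p C2(2)] by simp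
      finally have "ennreal (4 * E \<kappa> + (E \<kappa>)\<^sup>2) \<le> ennreal ((5 * C2 * \<kappa> powr (- 1 - 2 * r)) * sobolev_sq r \<kappa> (q 0))"
        by (rule ennreal_leI)
      also have "\<dots> = ennreal (5 * C2 * \<kappa> powr (- 1 - 2 * r)) * ennreal (sobolev_sq r \<kappa> (q 0))"
        using C2 by (intro ennreal_mult' ) simp
      finally show ?thesis using E1[OF p, of t] unfolding F_def sobolev_sq_nn[OF cq p r(3)] by (rule order_trans[rotated])
    qed
    have "ennreal (sobolev_sq s k (q t)) = (\<integral>\<^sup>+\<xi>. ennreal (F t \<xi>) * ennreal ((\<xi>\<^sup>2 + 3 * k\<^sup>2) powr s) \<partial>lborel)"
      unfolding sobolev_sq_nn[OF cq k s(2), symmetric] F_def by (simp add: ennreal_mult)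
    also have "\<dots> \<le> (\<integral>\<^sup>+\<xi>. ennreal (F t \<xi>) * (ennreal 26 * (\<integral>\<^sup>+\<kappa>. ennreal (\<kappa> powr (2 * s) * (\<kappa> / (\<xi>\<^sup>2 + 3 * \<kappa>\<^sup>2))) * indicator {k..} \<kappa> \<partial>lborel)) \<partial>lborel)"
      by (intro nn_integral_mono mult_left_mono weight_le_nn_integral[OF s k]) simp
    also have "\<dots> = (\<integral>\<^sup>+\<xi>. (\<integral>\<^sup>+\<kappa>. ennreal 26 * ennreal (F t \<xi>) * (ennreal (\<kappa> powr (2 * s) * (\<kappa> / (\<xi>\<^sup>2 + 3 * \<kappa>\<^sup>2))) * indicator {k..} \<kappa>) \<partial>lborel) \<partial>lborel)"
      by (subst nn_integral_cmult) (auto simp: mult_ac)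
    also have "\<dots> = (\<integral>\<^sup>+\<kappa>. (\<integral>\<^sup>+\<xi>. ennreal 26 * ennreal (F t \<xi>) * (ennreal (\<kappa> powr (2 * s) * (\<kappa> / (\<xi>\<^sup>2 + 3 * \<kappa>\<^sup>2))) * indicator {k..} \<kappa>) \<partial>lborel) \<partial>lborel)"
      by (rule lborel_pair.Fubini'[symmetric]) measurable
    also have "\<dots> = (\<integral>\<^sup>+\<kappa>. ennreal (26 * \<kappa> powr (2 * s)) * indicator {k..} \<kappa> * (\<integral>\<^sup>+\<xi>. ennreal (F t \<xi> * (\<kappa> / (\<xi>\<^sup>2 + 3 * \<kappa>\<^sup>2))) \<partial>lborel) \<partial>lborel)"
    proof (rule nn_integral_cong)
      fix \<kappa> :: real
      have "ennreal 26 * ennreal (F t \<xi>) * (ennreal (\<kappa> powr (2 * s) * (\<kappa> / (\<xi>\<^sup>2 + 3 * \<kappa>\<^sup>2))) * indicator {k..} \<kappa>)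
        = (ennreal (26 * \<kappa> powr (2 * s)) * indicator {k..} \<kappa>) * ennreal (F t \<xi> * (\<kappa> / (\<xi>\<^sup>2 + 3 * \<kappa>\<^sup>2)))" for \<xi>
      proof (cases "k \<le> \<kappa>")
        case True
        then have "\<kappa> / (\<xi>\<^sup>2 + 3 * \<kappa>\<^sup>2) \<ge> 0" using k weight_pos[of \<kappa> \<xi>] by simp
        then show ?thesis using F0[of t \<xi>] True by (simp add: ennreal_mult mult_ac del: times_divide_eq_right)
      qed simp
      then show "(\<integral>\<^sup>+\<xi>. ennreal 26 * ennreal (F t \<xi>) * (ennreal (\<kappa> powr (2 * s) * (\<kappa> / (\<xi>\<^sup>2 + 3 * \<kappa>\<^sup>2))) * indicator {k..} \<kappa>) \<partial>lborel)
        = ennreal (26 * \<kappa> powr (2 * s)) * indicator {k..} \<kappa> * (\<integral>\<^sup>+\<xi>. ennreal (F t \<xi> * (\<kappa> / (\<xi>\<^sup>2 + 3 * \<kappa>\<^sup>2))) \<partial>lborel)"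
        by (simp add: nn_integral_cmult)
    qed
    also have "\<dots> \<le> (\<integral>\<^sup>+\<kappa>. ennreal (26 * \<kappa> powr (2 * s)) * indicator {k..} \<kappa> * (ennreal (5 * C2 * \<kappa> powr (- 1 - 2 * r)) * (\<integral>\<^sup>+\<xi>. ennreal (F 0 \<xi> * (\<xi>\<^sup>2 + 3 * \<kappa>\<^sup>2) powr r) \<partial>lborel)) \<partial>lborel)"
    proof (rule nn_integral_mono)
      fix \<kappa> :: real
      show "ennreal (26 * \<kappa> powr (2 * s)) * indicator {k..} \<kappa> * (\<integral>\<^sup>+\<xi>. ennreal (F t \<xi> * (\<kappa> / (\<xi>\<^sup>2 + 3 * \<kappa>\<^sup>2))) \<partial>lborel)
        \<le> ennreal (26 * \<kappa> powr (2 * s)) * indicator {k..} \<kappa> * (ennreal (5 * C2 * \<kappa> powr (- 1 - 2 * r)) * (\<integral>\<^sup>+\<xi>. ennreal (F 0 \<xi> * (\<xi>\<^sup>2 + 3 * \<kappa>\<^sup>2) powr r) \<partial>lborel))"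
      proof (cases "k \<le> \<kappa>")
        case True
        show ?thesis by (rule mult_left_mono[OF E3[OF True]]) simp
      qed simp
    qed
    also have "\<dots> = (\<integral>\<^sup>+\<kappa>. (\<integral>\<^sup>+\<xi>. ennreal (130 * C2) * ennreal (F 0 \<xi>) * (ennreal (\<kappa> powr (2 * s - 1 - 2 * r) * (\<xi>\<^sup>2 + 3 * \<kappa>\<^sup>2) powr r) * indicator {k..} \<kappa>) \<partial>lborel) \<partial>lborel)"
    proof (rule nn_integral_cong)
      fix \<kappa> :: real
      have e: "ennreal (130 * C2) * ennreal (F 0 \<xi>) * (ennreal (\<kappa> powr (2 * s - 1 - 2 * r) * (\<xi>\<^sup>2 + 3 * \<kappa>\<^sup>2) powr r) * indicator {k..} \<kappa>)
        = ennreal (26 * \<kappa> powr (2 * s)) * indicator {k..} \<kappa> * ennreal (5 * C2 * \<kappa> powr (- 1 - 2 * r)) * ennreal (F 0 \<xi> * (\<xi>\<^sup>2 + 3 * \<kappa>\<^sup>2) powr r)" for \<xi>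
      proof -
        have "\<kappa> powr (2 * s - 1 - 2 * r) = \<kappa> powr (2 * s) * \<kappa> powr (- 1 - 2 * r)"
          unfolding powr_add[symmetric] by (simp add: algebra_simps)
        then have "(130 * C2) * F 0 \<xi> * (\<kappa> powr (2 * s - 1 - 2 * r) * (\<xi>\<^sup>2 + 3 * \<kappa>\<^sup>2) powr r)
          = (26 * \<kappa> powr (2 * s)) * (5 * C2 * \<kappa> powr (- 1 - 2 * r)) * (F 0 \<xi> * (\<xi>\<^sup>2 + 3 * \<kappa>\<^sup>2) powr r)" by simp
        then have "ennreal (130 * C2) * ennreal (F 0 \<xi>) * ennreal (\<kappa> powr (2 * s - 1 - 2 * r) * (\<xi>\<^sup>2 + 3 * \<kappa>\<^sup>2) powr r)
          = ennreal (26 * \<kappa> powr (2 * s)) * ennreal (5 * C2 * \<kappa> powr (- 1 - 2 * r)) * ennreal (F 0 \<xi> * (\<xi>\<^sup>2 + 3 * \<kappa>\<^sup>2) powr r)"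
          using C2(1) F0[of 0 \<xi>] by (simp only: ennreal_mult[symmetric] mult_nonneg_nonneg powr_ge_zero less_imp_le zero_le_numeral)
        then show ?thesis by (cases "k \<le> \<kappa>") auto
      qed
      show "ennreal (26 * \<kappa> powr (2 * s)) * indicator {k..} \<kappa> * (ennreal (5 * C2 * \<kappa> powr (- 1 - 2 * r)) * (\<integral>\<^sup>+\<xi>. ennreal (F 0 \<xi> * (\<xi>\<^sup>2 + 3 * \<kappa>\<^sup>2) powr r) \<partial>lborel))
        = (\<integral>\<^sup>+\<xi>. ennreal (130 * C2) * ennreal (F 0 \<xi>) * (ennreal (\<kappa> powr (2 * s - 1 - 2 * r) * (\<xi>\<^sup>2 + 3 * \<kappa>\<^sup>2) powr r) * indicator {k..} \<kappa>) \<partial>lborel)"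
        unfolding e by (simp add: nn_integral_cmult mult.assoc)
    qed
    also have "\<dots> = (\<integral>\<^sup>+\<xi>. (\<integral>\<^sup>+\<kappa>. ennreal (130 * C2) * ennreal (F 0 \<xi>) * (ennreal (\<kappa> powr (2 * s - 1 - 2 * r) * (\<xi>\<^sup>2 + 3 * \<kappa>\<^sup>2) powr r) * indicator {k..} \<kappa>) \<partial>lborel) \<partial>lborel)"
      by (rule lborel_pair.Fubini') measurable
    also have "\<dots> = (\<integral>\<^sup>+\<xi>. ennreal (130 * C2) * ennreal (F 0 \<xi>) * (\<integral>\<^sup>+\<kappa>. ennreal (\<kappa> powr (2 * s - 1 - 2 * r) * (\<xi>\<^sup>2 + 3 * \<kappa>\<^sup>2) powr r) * indicator {k..} \<kappa> \<partial>lborel) \<partial>lborel)"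
      by (subst nn_integral_cmult) auto
    also have "\<dots> \<le> (\<integral>\<^sup>+\<xi>. ennreal (130 * C2) * ennreal (F 0 \<xi>) * ennreal (D * (\<xi>\<^sup>2 + 3 * k\<^sup>2) powr s) \<partial>lborel)"
      unfolding D_def by (intro nn_integral_mono mult_left_mono nn_integral_le_weight[OF r(2) s(2) k]) simp
    also have "\<dots> = (\<integral>\<^sup>+\<xi>. ennreal (130 * C2 * D) * ennreal (F 0 \<xi> * (\<xi>\<^sup>2 + 3 * k\<^sup>2) powr s) \<partial>lborel)"
      using C2(1) D F0[of 0] by (intro nn_integral_cong) (simp add: mult_ac flip: ennreal_mult)
    also have "\<dots> = ennreal (130 * C2 * D * sobolev_sq s k (q 0))"
      unfolding F_def by (subst nn_integral_cmult, measurable)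
        (use C2(1) D in \<open>simp only: sobolev_sq_nn[OF cq k s(2)] ennreal_mult sobolev_sq_nonneg mult_nonneg_nonneg less_imp_le zero_le_numeral\<close>)
    finally show "sobolev_sq s k (q t) \<le> 130 * C2 * D * sobolev_sq s k (q 0)"
      by (subst (asm) ennreal_le_iff) (use C2 D in \<open>auto intro!: mult_nonneg_nonneg sobolev_sq_nonneg\<close>)
  qed
qed

text \<open>Layer-cake formula. For \<open>\<bar>\<xi>\<bar> \<le> k\<close> and
  \<open>X = max 1 \<bar>\<xi>\<bar>\<close>, the difference
  \<open>X powr (2 * s) - k powr (2 * s)\<close> is the integral over \<open>\<eta>\<close> from
  \<open>X\<close> to \<open>k\<close>; the rest is comparable to the weight at parameter
  \<open>k\<close>. This makes the bounds on the single intervals \<open>{-\<eta>..\<eta>}\<close>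
  usable for a weighted norm.\<close>

lemma sobolev_weight_split:
  assumes s: "- 1 / 2 < s" "s < 0" and k: "k \<ge> 1"
  shows "ennreal ((\<xi>\<^sup>2 + 1) powr s)
    \<le> (\<integral>\<^sup>+\<eta>. ennreal (- (2 * s) * \<eta> powr (2 * s - 1)) * indicator {1..k} \<eta> * (if \<bar>\<xi>\<bar> \<le> \<eta> then 1 else 0) \<partial>lborel)
      + ennreal (2 * (\<xi>\<^sup>2 + 3 * k\<^sup>2) powr s)"
proof -
  have half: "X powr (2 * s) \<le> 2 * (2 * X) powr (2 * s)" if "X > 0" for X :: real
  proof -
    have "1 / 2 * X powr (2 * s) \<le> 2 powr (2 * s) * X powr (2 * s)"
      using powr_lower_half[OF s(1)] by (intro mult_right_mono) auto
    then show ?thesis using that by (simp add: powr_mult)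
  qed
  show ?thesis
  proof (cases "\<bar>\<xi>\<bar> \<le> k")
    case True
    define X where "X = max 1 \<bar>\<xi>\<bar>"
    have X: "1 \<le> X" "\<bar>\<xi>\<bar> \<le> X" "X \<le> k" unfolding X_def using True k by auto
    have "X\<^sup>2 \<le> \<xi>\<^sup>2 + 1" unfolding X_def max_def by simp
    then have "(\<xi>\<^sup>2 + 1) powr s \<le> (X\<^sup>2) powr s" using X s by (intro powr_mono2') auto
    also have "\<dots> = X powr (2 * s)" using X by (intro sq_powr) auto
    finally have a: "(\<xi>\<^sup>2 + 1) powr s \<le> X powr (2 * s)" .
    have "\<xi>\<^sup>2 \<le> k\<^sup>2" using True k by (intro abs_le_square_iff[THEN iffD1]) simp
    then have "((2 * k)\<^sup>2) powr s \<le> (\<xi>\<^sup>2 + 3 * k\<^sup>2) powr s"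
      using s k by (intro powr_mono2') (auto simp: power_mult_distrib add_nonneg_pos)
    then have b: "k powr (2 * s) \<le> 2 * (\<xi>\<^sup>2 + 3 * k\<^sup>2) powr s" using half[of k] sq_powr[of "2 * k" s] k by simp
    have I: "(\<integral>\<^sup>+\<eta>. ennreal (- (2 * s) * \<eta> powr (2 * s - 1)) * indicator {X..k} \<eta> \<partial>lborel) = ennreal (- (k powr (2 * s)) - - (X powr (2 * s)))"
    proof (rule nn_integral_FTC_Icc)
      fix \<eta> assume "\<eta> \<in> {X..k}"
      then have "\<eta> > 0" using X by simp
      then show "((\<lambda>\<eta>. - (\<eta> powr (2 * s))) has_real_derivative - (2 * s) * \<eta> powr (2 * s - 1)) (at \<eta>)"
        by (auto intro!: derivative_eq_intros)
      show "0 \<le> - (2 * s) * \<eta> powr (2 * s - 1)" using s by (intro mult_nonneg_nonneg) auto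
    qed (use X in auto)
    have "(\<integral>\<^sup>+\<eta>. ennreal (- (2 * s) * \<eta> powr (2 * s - 1)) * indicator {X..k} \<eta> \<partial>lborel)
      \<le> (\<integral>\<^sup>+\<eta>. ennreal (- (2 * s) * \<eta> powr (2 * s - 1)) * indicator {1..k} \<eta> * (if \<bar>\<xi>\<bar> \<le> \<eta> then 1 else 0) \<partial>lborel)"
      using X by (intro nn_integral_mono) (auto simp: indicator_def)
    then have c: "ennreal (X powr (2 * s) - k powr (2 * s)) \<le> (\<integral>\<^sup>+\<eta>. ennreal (- (2 * s) * \<eta> powr (2 * s - 1)) * indicator {1..k} \<eta> * (if \<bar>\<xi>\<bar> \<le> \<eta> then 1 else 0) \<partial>lborel)"
      unfolding I by simp
    have "k powr (2 * s) \<le> X powr (2 * s)" using X s by (intro powr_mono2') auto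
    then have "ennreal (X powr (2 * s)) = ennreal (X powr (2 * s) - k powr (2 * s)) + ennreal (k powr (2 * s))"
      by (subst ennreal_plus[symmetric]) auto
    then show ?thesis using ennreal_leI[OF a] add_mono[OF c ennreal_leI[OF b]] by simp
  next
    case False
    then have "k\<^sup>2 \<le> \<xi>\<^sup>2" using k by (simp flip: abs_le_square_iff)
    moreover have "\<xi>\<^sup>2 > 0" using False k by auto
    ultimately have "((2 * \<bar>\<xi>\<bar>)\<^sup>2) powr s \<le> (\<xi>\<^sup>2 + 3 * k\<^sup>2) powr s"
      using s k by (intro powr_mono2') (auto simp: power_mult_distrib add_pos_nonneg)
    moreover have "(\<xi>\<^sup>2 + 1) powr s \<le> (\<bar>\<xi>\<bar>\<^sup>2) powr s" using False k s by (intro powr_mono2') auto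
    ultimately have "(\<xi>\<^sup>2 + 1) powr s \<le> 2 * (\<xi>\<^sup>2 + 3 * k\<^sup>2) powr s"
      using half[of "\<bar>\<xi>\<bar>"] sq_powr[of "2 * \<bar>\<xi>\<bar>" s] sq_powr[of "\<bar>\<xi>\<bar>" s] False k by linarith
    then show ?thesis by (intro add_increasing ennreal_leI) auto
  qed
qed

lemma sobolev_sq_low_high:
  assumes s: "- 1 / 2 < s" "s < 0" and C: "growth_bound s C" "C > 0"
    and q: "schwartz_solution q" and k: "k \<ge> 1"
    and N: "N = sobolev_sq s (1 / sqrt 3) (q 0)" "C * N \<le> k powr (1 + 2 * s)"
  shows "sobolev_sq s (1 / sqrt 3) (q t) \<le> 34 * C * k powr (- s) * N + 2 * sobolev_sq s k (q t)"
proof -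
  note cq = schwartz_solution_cdec[OF q]
  note fourier_measurable[OF cdec_integrable[OF cq], measurable]
  define F where "F t \<xi> = (norm (fourier (q t) \<xi>))\<^sup>2" for t \<xi>
  have F0: "F t \<xi> \<ge> 0" for t \<xi> by (simp add: F_def)
  have [measurable]: "F t \<in> borel_measurable borel" for t unfolding F_def[abs_def] by measurable
  have k0: "k > 0" using k by simp
  have N0: "N \<ge> 0" unfolding N by (rule sobolev_sq_nonneg)
  obtain E where E0: "\<forall>k>0. E k \<ge> 0"
    and E1: "\<forall>k>0. \<forall>t \<eta>. 0 < \<eta> \<longrightarrow> \<eta> \<le> k \<longrightarrow>
      (\<integral>\<^sup>+\<xi>. ennreal (F t \<xi>) * indicator {-\<eta>..\<eta>} \<xi> \<partial>lborel) \<le> ennreal (16 * k * E k + \<eta> * (E k)\<^sup>2)"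
    and E2: "\<forall>k>0. \<forall>s C. growth_bound s C \<longrightarrow> E k \<le> C * k powr (- 1 - 2 * s) * sobolev_sq s k (q 0)"
    using conserved_energy[OF q] unfolding F_def by blast
  note E0 = E0[rule_format] and E1 = E1[rule_format] and E2 = E2[rule_format]
  have low: "(\<integral>\<^sup>+\<xi>. ennreal (F t \<xi>) * (if \<bar>\<xi>\<bar> \<le> \<eta> then 1 else 0) \<partial>lborel) \<le> ennreal (17 * C * N * k powr (- s) * \<eta> powr (- s))"
    if h: "1 \<le> \<eta>" "\<eta> \<le> k" for \<eta>
  proof -
    \<comment> \<open>The energy at \<open>\<kappa>\<close> is at most \<open>e\<close>. The linear
      term \<open>\<kappa> * e\<close> is proportional to \<open>\<kappa> powr (- 2 * s)\<close> and
      asks for small \<open>\<kappa>\<close>; absorbing the quadratic term needs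
      \<open>\<eta> * e \<le> \<kappa>\<close> and asks for large \<open>\<kappa>\<close>. With
      \<open>\<kappa> = k\<close> the power of \<open>k\<close> would be \<open>- 2 * s\<close> and
      not \<open>- s\<close>.\<close>
    define \<kappa> where "\<kappa> = sqrt (\<eta> * k)"
    have p: "\<kappa> > 0" unfolding \<kappa>_def using h by simp
    have k2: "\<kappa>\<^sup>2 = \<eta> * k" unfolding \<kappa>_def using h by simp
    have le: "\<eta> \<le> \<kappa>" unfolding \<kappa>_def using h by (intro real_le_rsqrt) (simp add: power2_eq_square)
    define e where "e = C * \<kappa> powr (- 1 - 2 * s) * N"
    have e0: "e \<ge> 0" unfolding e_def using C N0 by simp
    have "1 / sqrt 3 \<le> \<kappa>" using le h by (simp add: divide_le_eq order_trans[OF _ mult_mono[of 1 \<kappa> 1 "sqrt 3"]])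
    then have "sobolev_sq s \<kappa> (q 0) \<le> N" unfolding N(1) by (intro sobolev_sq_antimono[OF cq _ _ s(2)]) auto
    then have "C * \<kappa> powr (- 1 - 2 * s) * sobolev_sq s \<kappa> (q 0) \<le> e"
      unfolding e_def using C by (intro mult_left_mono) auto
    then have Ee: "E \<kappa> \<le> e" using E2[OF p C(1)] by simp
    have ke: "\<kappa> * e = C * N * k powr (- s) * \<eta> powr (- s)"
    proof -
      have "\<kappa> * \<kappa> powr (- 1 - 2 * s) = \<kappa> powr (2 * - s)"
        using p powr_add[of \<kappa> 1 "- 1 - 2 * s"] by simp
      also have "\<dots> = k powr (- s) * \<eta> powr (- s)"
        unfolding sq_powr[OF p, symmetric] k2 using h by (simp add: powr_mult)
      finally show ?thesis unfolding e_def by simp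
    qed
    have q: "\<kappa> / \<eta> = k / \<kappa>" using k2 p h by (simp add: field_simps power2_eq_square)
    \<comment> \<open>Since \<open>\<kappa> / \<eta> \<ge> 1\<close> and
      \<open>1 + 2 * s < 1\<close>. As \<open>\<kappa> / \<eta> = k / \<kappa>\<close> for the
      geometric mean, and \<open>e\<close> is at most
      \<open>(k / \<kappa>) powr (1 + 2 * s)\<close>, this yields
      \<open>\<eta> * e \<le> \<kappa>\<close>.\<close>
    have "(\<kappa> / \<eta>) powr (1 + 2 * s) \<le> (\<kappa> / \<eta>) powr 1" using le h s by (intro powr_mono) auto
    also have "\<dots> = \<kappa> / \<eta>" using p h by simp
    finally have kk: "(k / \<kappa>) powr (1 + 2 * s) \<le> \<kappa> / \<eta>" unfolding q .
    have "e = (C * N) * \<kappa> powr (- (1 + 2 * s))" unfolding e_def by simp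
    also have "\<dots> \<le> k powr (1 + 2 * s) * \<kappa> powr (- (1 + 2 * s))" using N(2) by (intro mult_right_mono) auto
    also have "\<dots> = k powr (1 + 2 * s) / \<kappa> powr (1 + 2 * s)" by (simp only: powr_minus divide_inverse)
    also have "\<dots> = (k / \<kappa>) powr (1 + 2 * s)" using k0 p by (simp add: powr_divide)
    also note kk
    finally have "\<eta> * e \<le> \<kappa>" using h by (simp add: field_simps)
    then have "\<eta> * e * e \<le> \<kappa> * e" using e0 by (intro mult_right_mono) auto
    moreover have "\<eta> * (E \<kappa>)\<^sup>2 \<le> \<eta> * e\<^sup>2" using Ee E0[OF p] h by (intro mult_left_mono power_mono) auto
    moreover have "\<kappa> * E \<kappa> \<le> \<kappa> * e" using Ee p by (intro mult_left_mono) auto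
    ultimately have "16 * \<kappa> * E \<kappa> + \<eta> * (E \<kappa>)\<^sup>2 \<le> 17 * (\<kappa> * e)" by (simp add: power2_eq_square mult.assoc)
    also have "\<dots> = 17 * C * N * k powr (- s) * \<eta> powr (- s)" unfolding ke by simp
    finally have "ennreal (16 * \<kappa> * E \<kappa> + \<eta> * (E \<kappa>)\<^sup>2) \<le> ennreal (17 * C * N * k powr (- s) * \<eta> powr (- s))" by (rule ennreal_leI)
    moreover have "(if \<bar>\<xi>\<bar> \<le> \<eta> then 1 else 0) = (indicator {-\<eta>..\<eta>} \<xi> :: ennreal)" for \<xi>
      by (auto simp: indicator_def)
    ultimately show ?thesis using E1[OF p _ le, of t] h by (simp only:) (meson less_le_trans order_trans zero_less_one)
  qed
  let ?g = "\<lambda>\<eta>. ennreal (- (2 * s) * \<eta> powr (2 * s - 1)) * indicator {1..k} \<eta>"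
  have w: "\<xi>\<^sup>2 + 3 * (1 / sqrt 3)\<^sup>2 = \<xi>\<^sup>2 + 1" for \<xi> :: real by (simp add: power_divide)
  have "ennreal (sobolev_sq s (1 / sqrt 3) (q t)) = (\<integral>\<^sup>+\<xi>. ennreal (F t \<xi>) * ennreal ((\<xi>\<^sup>2 + 1) powr s) \<partial>lborel)"
    using sobolev_sq_nn[OF cq, of "1 / sqrt 3" s t, symmetric] s unfolding w F_def by (simp add: ennreal_mult)
  also have "\<dots> \<le> (\<integral>\<^sup>+\<xi>. ennreal (F t \<xi>) * ((\<integral>\<^sup>+\<eta>. ?g \<eta> * (if \<bar>\<xi>\<bar> \<le> \<eta> then 1 else 0) \<partial>lborel) + ennreal (2 * (\<xi>\<^sup>2 + 3 * k\<^sup>2) powr s)) \<partial>lborel)"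
    by (intro nn_integral_mono mult_left_mono sobolev_weight_split[OF s k]) simp
  also have "\<dots> = (\<integral>\<^sup>+\<xi>. (\<integral>\<^sup>+\<eta>. ennreal (F t \<xi>) * (?g \<eta> * (if \<bar>\<xi>\<bar> \<le> \<eta> then 1 else 0)) \<partial>lborel) + ennreal (2 * (F t \<xi> * (\<xi>\<^sup>2 + 3 * k\<^sup>2) powr s)) \<partial>lborel)"
  proof (rule nn_integral_cong)
    fix \<xi> :: real
    have "ennreal (F t \<xi>) * ennreal (2 * (\<xi>\<^sup>2 + 3 * k\<^sup>2) powr s) = ennreal (2 * (F t \<xi> * (\<xi>\<^sup>2 + 3 * k\<^sup>2) powr s))"
      using F0[of t \<xi>] by (subst ennreal_mult[symmetric]) (auto simp: mult_ac)
    then show "ennreal (F t \<xi>) * ((\<integral>\<^sup>+\<eta>. ?g \<eta> * (if \<bar>\<xi>\<bar> \<le> \<eta> then 1 else 0) \<partial>lborel) + ennreal (2 * (\<xi>\<^sup>2 + 3 * k\<^sup>2) powr s))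
      = (\<integral>\<^sup>+\<eta>. ennreal (F t \<xi>) * (?g \<eta> * (if \<bar>\<xi>\<bar> \<le> \<eta> then 1 else 0)) \<partial>lborel) + ennreal (2 * (F t \<xi> * (\<xi>\<^sup>2 + 3 * k\<^sup>2) powr s))"
      by (subst nn_integral_cmult, measurable) (simp only: distrib_left)
  qed
  also have "\<dots> = (\<integral>\<^sup>+\<xi>. \<integral>\<^sup>+\<eta>. ennreal (F t \<xi>) * (?g \<eta> * (if \<bar>\<xi>\<bar> \<le> \<eta> then 1 else 0)) \<partial>lborel \<partial>lborel)
      + (\<integral>\<^sup>+\<xi>. ennreal (2 * (F t \<xi> * (\<xi>\<^sup>2 + 3 * k\<^sup>2) powr s)) \<partial>lborel)"
    by (rule nn_integral_add) measurable
  also have "(\<integral>\<^sup>+\<xi>. ennreal (2 * (F t \<xi> * (\<xi>\<^sup>2 + 3 * k\<^sup>2) powr s)) \<partial>lborel) = ennreal (2 * sobolev_sq s k (q t))"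
  proof -
    have "(\<integral>\<^sup>+\<xi>. ennreal (2 * (F t \<xi> * (\<xi>\<^sup>2 + 3 * k\<^sup>2) powr s)) \<partial>lborel) = ennreal 2 * (\<integral>\<^sup>+\<xi>. ennreal (F t \<xi> * (\<xi>\<^sup>2 + 3 * k\<^sup>2) powr s) \<partial>lborel)"
      by (subst nn_integral_cmult[symmetric], measurable) (simp only: ennreal_mult' zero_le_numeral)
    also have "\<dots> = ennreal (2 * sobolev_sq s k (q t))"
      unfolding F_def sobolev_sq_nn[OF cq k0 s(2)] by (simp only: ennreal_mult' zero_le_numeral)
    finally show ?thesis .
  qed
  also have "(\<integral>\<^sup>+\<xi>. \<integral>\<^sup>+\<eta>. ennreal (F t \<xi>) * (?g \<eta> * (if \<bar>\<xi>\<bar> \<le> \<eta> then 1 else 0)) \<partial>lborel \<partial>lborel)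
    = (\<integral>\<^sup>+\<eta>. \<integral>\<^sup>+\<xi>. ennreal (F t \<xi>) * (?g \<eta> * (if \<bar>\<xi>\<bar> \<le> \<eta> then 1 else 0)) \<partial>lborel \<partial>lborel)"
    by (rule lborel_pair.Fubini'[symmetric]) measurable
  \<comment> \<open>The low frequency bound contributes \<open>\<eta> powr (- s)\<close>, which
    leaves \<open>\<eta> powr (s - 1)\<close>. It is integrable up to infinity with value
    \<open>- 1 / s\<close>, cancelling the factor \<open>s\<close> and giving
    \<open>34 = 2 * 17\<close>.\<close>
  also have "\<dots> \<le> (\<integral>\<^sup>+\<eta>. ennreal (- (34 * s) * C * N * k powr (- s)) * (ennreal (\<eta> powr (s - 1)) * indicator {1..} \<eta>) \<partial>lborel)"
  proof (rule nn_integral_mono)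
    fix \<eta> :: real
    have "(\<integral>\<^sup>+\<xi>. ennreal (F t \<xi>) * (?g \<eta> * (if \<bar>\<xi>\<bar> \<le> \<eta> then 1 else 0)) \<partial>lborel) = (\<integral>\<^sup>+\<xi>. ?g \<eta> * (ennreal (F t \<xi>) * (if \<bar>\<xi>\<bar> \<le> \<eta> then 1 else 0)) \<partial>lborel)"
      by (simp only: mult_ac)
    also have "\<dots> = ?g \<eta> * (\<integral>\<^sup>+\<xi>. ennreal (F t \<xi>) * (if \<bar>\<xi>\<bar> \<le> \<eta> then 1 else 0) \<partial>lborel)"
      by (rule nn_integral_cmult) measurable
    also have "\<dots> \<le> ennreal (- (34 * s) * C * N * k powr (- s)) * (ennreal (\<eta> powr (s - 1)) * indicator {1..} \<eta>)"
    proof (cases "\<eta> \<in> {1..k}")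
      case True
      then have h: "1 \<le> \<eta>" "\<eta> \<le> k" by auto
      have e: "\<eta> powr (2 * s - 1) * \<eta> powr (- s) = \<eta> powr (s - 1)" unfolding powr_add[symmetric] by simp
      have "?g \<eta> * (\<integral>\<^sup>+\<xi>. ennreal (F t \<xi>) * (if \<bar>\<xi>\<bar> \<le> \<eta> then 1 else 0) \<partial>lborel) \<le> ?g \<eta> * ennreal (17 * C * N * k powr (- s) * \<eta> powr (- s))"
        by (rule mult_left_mono[OF low[OF h]]) simp
      also have "\<dots> = ennreal ((- (2 * s) * \<eta> powr (2 * s - 1)) * (17 * C * N * k powr (- s) * \<eta> powr (- s)))"
      proof -
        have g0: "0 \<le> - (2 * s) * \<eta> powr (2 * s - 1)" using s by (intro mult_nonneg_nonneg) auto
        have i1: "indicator {1..k} \<eta> = (1 :: ennreal)" using True by simp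
        show ?thesis unfolding i1 mult_1_right by (rule ennreal_mult'[OF g0, symmetric])
      qed
      also have "(- (2 * s) * \<eta> powr (2 * s - 1)) * (17 * C * N * k powr (- s) * \<eta> powr (- s)) = (- (34 * s) * C * N * k powr (- s)) * \<eta> powr (s - 1)"
        unfolding e[symmetric] by simp
      also have "ennreal \<dots> = ennreal (- (34 * s) * C * N * k powr (- s)) * ennreal (\<eta> powr (s - 1))"
        by (rule ennreal_mult'') simp
      finally show ?thesis using h by simp
    qed simp
    finally show "(\<integral>\<^sup>+\<xi>. ennreal (F t \<xi>) * (?g \<eta> * (if \<bar>\<xi>\<bar> \<le> \<eta> then 1 else 0)) \<partial>lborel)
      \<le> ennreal (- (34 * s) * C * N * k powr (- s)) * (ennreal (\<eta> powr (s - 1)) * indicator {1..} \<eta>)" .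
  qed
  also have "\<dots> = ennreal (- (34 * s) * C * N * k powr (- s)) * ennreal (- 1 / s)"
    using nn_integral_powr_to_inf[of "s - 1" 1] s by (simp add: nn_integral_cmult)
  also have "\<dots> = ennreal (34 * C * k powr (- s) * N)"
  proof -
    have "0 \<le> - 1 / s" using s by (simp add: divide_nonpos_neg)
    then have "ennreal (- (34 * s) * C * N * k powr (- s)) * ennreal (- 1 / s) = ennreal (- (34 * s) * C * N * k powr (- s) * (- 1 / s))"
      by (rule ennreal_mult''[symmetric])
    also have "- (34 * s) * C * N * k powr (- s) * (- 1 / s) = 34 * C * k powr (- s) * N" using s by (simp add: field_simps)
    finally show ?thesis .
  qed
  finally have "ennreal (sobolev_sq s (1 / sqrt 3) (q t)) \<le> ennreal (34 * C * k powr (- s) * N) + ennreal (2 * sobolev_sq s k (q t))"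
    by (simp add: add_right_mono)
  also have "\<dots> = ennreal (34 * C * k powr (- s) * N + 2 * sobolev_sq s k (q t))"
    using C N0 by (intro ennreal_plus[symmetric] mult_nonneg_nonneg sobolev_sq_nonneg) auto
  finally show ?thesis
    by (subst (asm) ennreal_le_iff) (use C N0 in \<open>auto intro!: add_nonneg_nonneg mult_nonneg_nonneg sobolev_sq_nonneg\<close>)
qed

theorem theorem14:
  fixes s :: real
  assumes "- 1 / 2 < s" and "s < 0"
  shows "\<exists>c>0. \<exists>K :: real \<Rightarrow> real. \<forall>q. schwartz_solution q \<longrightarrow>
           (\<forall>k\<ge>1. k \<ge> K (sobolev_norm s (q 0)) \<longrightarrow>
              (\<forall>t. microlocal_norm s k (q t) \<le> c * microlocal_norm s k (q 0))) \<and>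
           (\<forall>t. sobolev_norm s (q t)
              \<le> c * (1 + sobolev_norm s (q 0)) powr (- s / (1 + 2 * s)) * sobolev_norm s (q 0))"
proof -
  note s = assms
  obtain C0 where "C0 > 0" and C0: "growth_bound s C0" using jost_upper[OF s] unfolding growth_bound_def by blast
  \<comment> \<open>The maximum with 1 makes \<open>K N \<ge> 1\<close> below, so the threshold of
    part (i) can itself serve as the splitting frequency in part (ii).\<close>
  define C where "C = max C0 1"
  have C1: "C \<ge> 1" and Cp: "C > 0" unfolding C_def by auto
  have "C0 * k powr (- 1 - 2 * s) * sobolev_sq s k q \<le> C * k powr (- 1 - 2 * s) * sobolev_sq s k q" for k q
    unfolding C_def by (intro mult_right_mono sobolev_sq_nonneg) auto
  then have C: "growth_bound s C" using C0 unfolding growth_bound_def by (blast intro: order_trans)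
  obtain D where D: "D > 0" "\<And>q k t. schwartz_solution q \<Longrightarrow> k > 0 \<Longrightarrow>
    C * k powr (- 1 - 2 * s) * sobolev_sq s k (q 0) \<le> 1 \<Longrightarrow> sobolev_sq s k (q t) \<le> D * sobolev_sq s k (q 0)"
    by (rule high_frequency_bound[OF s C Cp]) blast
  \<comment> \<open>Solves \<open>K N powr (1 + 2 * s) = C * (1 + N)^2\<close>, which dominates
    \<open>C * N^2\<close> and so supplies the smallness needed in
    \<open>high_frequency_bound\<close> and in \<open>sobolev_sq_low_high\<close>. Up to a constant,
    \<open>K N powr (- s)\<close> is the square of the growth factor in part (ii).\<close>
  define K where "K N = (C * (1 + N)\<^sup>2) powr (1 / (1 + 2 * s))" for N
  define A where "A = (34 * C + 2 * D) * C powr (- s / (1 + 2 * s))"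
  have A: "A > 0" unfolding A_def using Cp D by simp
  define c where "c = sqrt (max D A)"
  have c: "c > 0" unfolding c_def using D by (simp add: less_max_iff_disj)
  have micro: "microlocal_norm s k f = sqrt (sobolev_sq s k f)" for k f
    unfolding microlocal_norm_def sobolev_sq_def ..
  have main: "(\<forall>k\<ge>1. k \<ge> K (sobolev_norm s (q 0)) \<longrightarrow> (\<forall>t. microlocal_norm s k (q t) \<le> c * microlocal_norm s k (q 0))) \<and>
    (\<forall>t. sobolev_norm s (q t) \<le> c * (1 + sobolev_norm s (q 0)) powr (- s / (1 + 2 * s)) * sobolev_norm s (q 0))"
    if q: "schwartz_solution q" for q
  proof -
    note cq = schwartz_solution_cdec[OF q]
    define N where "N = sobolev_norm s (q 0)"
    have N2: "N\<^sup>2 = sobolev_sq s (1 / sqrt 3) (q 0)" unfolding N_def sobolev_norm_def micro by (simp add: sobolev_sq_nonneg)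
    have N0: "N \<ge> 0" unfolding N_def sobolev_norm_def micro by (simp add: sobolev_sq_nonneg)
    have N1: "N\<^sup>2 \<le> (1 + N)\<^sup>2" "1 \<le> (1 + N)\<^sup>2" using N0 by (auto intro: power_mono one_le_power)
    then have B1: "1 \<le> C * (1 + N)\<^sup>2" using C1 mult_mono[of 1 C 1 "(1 + N)\<^sup>2"] by simp
    then have K1: "K N \<ge> 1" unfolding K_def using s by (intro ge_one_powr_ge_zero) auto
    have KN: "K N powr (1 + 2 * s) = C * (1 + N)\<^sup>2" unfolding K_def powr_powr using s B1 by simp
    have le: "sobolev_sq s k (q 0) \<le> N\<^sup>2" if "k \<ge> 1" for k
    proof -
      have "1 / sqrt 3 \<le> k" using that by (simp add: divide_le_eq order_trans[OF _ mult_mono[of 1 k 1 "sqrt 3"]])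
      then show ?thesis unfolding N2 by (intro sobolev_sq_antimono[OF cq _ _ s(2)]) auto
    qed
    have i: "sobolev_sq s k (q t) \<le> D * sobolev_sq s k (q 0)" if k: "k \<ge> 1" "k \<ge> K N" for k t
    proof (rule D(2)[OF q])
      show "k > 0" using k by simp
      have "K N powr (1 + 2 * s) \<le> k powr (1 + 2 * s)" using k K1 s by (intro powr_mono2) auto
      moreover have "C * sobolev_sq s k (q 0) \<le> C * (1 + N)\<^sup>2" using le[OF k(1)] N1 Cp by (intro mult_left_mono) auto
      ultimately have "C * sobolev_sq s k (q 0) \<le> k powr (1 + 2 * s)" unfolding KN by simp
      then have "C * sobolev_sq s k (q 0) * k powr (- 1 - 2 * s) \<le> k powr (1 + 2 * s) * k powr (- 1 - 2 * s)"
        by (rule mult_right_mono) simp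
      also have "\<dots> = 1" unfolding powr_add[symmetric] using k by simp
      finally show "C * k powr (- 1 - 2 * s) * sobolev_sq s k (q 0) \<le> 1" by (simp add: mult_ac)
    qed
    have "microlocal_norm s k (q t) \<le> c * microlocal_norm s k (q 0)" if k: "k \<ge> 1" "k \<ge> K N" for k t
    proof -
      have "D * sobolev_sq s k (q 0) \<le> max D A * sobolev_sq s k (q 0)" by (intro mult_right_mono sobolev_sq_nonneg) simp
      then show ?thesis unfolding micro c_def real_sqrt_mult[symmetric] using i[OF k, of t] by simp
    qed
    moreover have "sobolev_norm s (q t) \<le> c * (1 + N) powr (- s / (1 + 2 * s)) * N" for t
    proof -
      let ?p = "- s / (1 + 2 * s)"
      have Ks: "K N powr (- s) = C powr ?p * ((1 + N) powr ?p)\<^sup>2"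
      proof -
        have "K N powr (- s) = (C * (1 + N)\<^sup>2) powr ?p" unfolding K_def powr_powr by simp
        also have "\<dots> = C powr ?p * ((1 + N)\<^sup>2) powr ?p" using Cp by (simp add: powr_mult)
        also have "((1 + N)\<^sup>2) powr ?p = ((1 + N) powr ?p)\<^sup>2"
          using N0 by (simp add: powr_powr mult.commute flip: powr_numeral)
        finally show ?thesis .
      qed
      have K1s: "1 \<le> K N powr (- s)" using K1 s by (intro ge_one_powr_ge_zero) auto
      have "C * N\<^sup>2 \<le> K N powr (1 + 2 * s)" unfolding KN using N1 Cp by (intro mult_left_mono) auto
      then have "sobolev_sq s (1 / sqrt 3) (q t) \<le> 34 * C * K N powr (- s) * N\<^sup>2 + 2 * sobolev_sq s (K N) (q t)"
        by (rule sobolev_sq_low_high[OF s C Cp q K1 N2])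
      also have "sobolev_sq s (K N) (q t) \<le> D * (K N powr (- s) * N\<^sup>2)"
      proof -
        have "D * sobolev_sq s (K N) (q 0) \<le> D * (1 * N\<^sup>2)" using le[OF K1] D(1) by (intro mult_left_mono) auto
        also have "\<dots> \<le> D * (K N powr (- s) * N\<^sup>2)" using K1s D(1) by (intro mult_left_mono mult_right_mono) auto
        finally show ?thesis using i[OF K1 order_refl, of t] by simp
      qed
      also have "34 * C * K N powr (- s) * N\<^sup>2 + 2 * (D * (K N powr (- s) * N\<^sup>2)) = A * ((1 + N) powr ?p * N)\<^sup>2"
        unfolding Ks A_def by (simp add: algebra_simps power_mult_distrib)
      also have "\<dots> \<le> max D A * ((1 + N) powr ?p * N)\<^sup>2" by (intro mult_right_mono) auto
      finally have "sqrt (sobolev_sq s (1 / sqrt 3) (q t)) \<le> sqrt (max D A * ((1 + N) powr ?p * N)\<^sup>2)" by simp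
      also have "\<dots> = c * ((1 + N) powr ?p * N)" unfolding c_def real_sqrt_mult using N0 by simp
      finally show ?thesis unfolding sobolev_norm_def micro by (simp add: mult.assoc)
    qed
    ultimately show ?thesis unfolding N_def by blast
  qed
  show ?thesis by (rule exI[of _ c], rule conjI[OF c], rule exI[of _ K], rule allI, rule impI, rule main)
qed

end
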